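(* Let $n$ be a positive integer and $2\le p<n$. Let $K:\mathbb{R}^n\to\mathbb{R}$ be an arbitrary concave function, let $y_i\in\mathbb{R}^n$ and $a_i\ge 0$ for $i=1,2,\dots$, and define \[W(x):=\sum_{i=1}^\infty \frac{a_i}{|x-y_i|^{\frac{n-p}{p-1}}}+K(x),\qquad x\in\mathbb{R}^n,\] with values in $(-\infty,\infty]$. If the series converges at some point of $\mathbb{R}^n$, then $W$ is $p$-superharmonic in $\mathbb{R}^n$.
   Context: In the series, a term with $a_i>0$ is interpreted as $+\infty$ at $x=y_i$, and terms with $a_i=0$ are identically $0$; since all terms are nonnegative the series has a value in $[0,\infty]$ at every point. A continuous function $h\in W^{1,p}_{loc}(D)$ on a domain $D\subset\mathbb{R}^n$ is called $p$-harmonic in $D$ if $\int |\nabla h|^{p-2}\nabla h\cdot\nabla\phi\,dx=0$ for every $\phi\in C_0^\infty(D)$. For a domain $\Omega\subset\mathbb{R}^n$, a function $u:\Omega\to(-\infty,\infty]$ is $p$-superharmonic in $\Omega$ if (i) $u\not\equiv\infty$; (ii) $u$ is lower semicontinuous in $\Omega$; (iii) whenever $D$ is an open set with compact closure $\overline D\subset\Omega$ and $h\in C(\overline D)$ is $p$-harmonic in $D$ with $h\le u$ on $\partial D$, then $h\le u$ in $D$. *)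

theory Defs
  imports "HOL-Analysis.Analysis"
begin

fun Ck :: "nat \<Rightarrow> ('a::euclidean_space \<Rightarrow> real) \<Rightarrow> bool" where
  "Ck 0 f = continuous_on UNIV f"
| "Ck (Suc k) f = (continuous_on UNIV f \<and> f differentiable_on UNIV \<and>
      (\<forall>v. Ck k (\<lambda>x. frechet_derivative f (at x) v)))"

definition smooth_fun :: "('a::euclidean_space \<Rightarrow> real) \<Rightarrow> bool" where
  "smooth_fun f \<longleftrightarrow> (\<forall>k. Ck k f)"

definition test_fun :: "'a::euclidean_space set \<Rightarrow> ('a \<Rightarrow> real) \<Rightarrow> bool" where
  "test_fun D \<phi> \<longleftrightarrow> smooth_fun \<phi> \<and> compact (closure {x. \<phi> x \<noteq> 0})
      \<and> closure {x. \<phi> x \<noteq> 0} \<subseteq> D"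

definition grad :: "('a::euclidean_space \<Rightarrow> real) \<Rightarrow> 'a \<Rightarrow> 'a" where
  "grad \<phi> x = (\<Sum>b\<in>Basis. frechet_derivative \<phi> (at x) b *\<^sub>R b)"

definition Lp_loc :: "real \<Rightarrow> 'a::euclidean_space set \<Rightarrow> ('a \<Rightarrow> 'b::euclidean_space) \<Rightarrow> bool" where
  "Lp_loc p D f \<longleftrightarrow> set_borel_measurable lebesgue D f \<and>
     (\<forall>C. compact C \<and> C \<subseteq> D \<longrightarrow> set_integrable lebesgue C (\<lambda>x. norm (f x) powr p))"

definition weak_grad :: "'a::euclidean_space set \<Rightarrow> ('a \<Rightarrow> real) \<Rightarrow> ('a \<Rightarrow> 'a) \<Rightarrow> bool" where
  "weak_grad D h g \<longleftrightarrow> (\<forall>\<phi>. test_fun D \<phi> \<longrightarrow>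
      (LINT x:D|lebesgue. h x *\<^sub>R grad \<phi> x) = - (LINT x:D|lebesgue. \<phi> x *\<^sub>R g x))"

definition sobolev_loc :: "real \<Rightarrow> 'a::euclidean_space set \<Rightarrow> ('a \<Rightarrow> real) \<Rightarrow> ('a \<Rightarrow> 'a) \<Rightarrow> bool" where
  "sobolev_loc p D h g \<longleftrightarrow> Lp_loc p D h \<and> Lp_loc p D g \<and> weak_grad D h g"

definition p_harmonic :: "real \<Rightarrow> 'a::euclidean_space set \<Rightarrow> ('a \<Rightarrow> real) \<Rightarrow> bool" where
  "p_harmonic p D h \<longleftrightarrow> continuous_on D h \<and>
     (\<exists>g. sobolev_loc p D h g \<and>
        (\<forall>\<phi>. test_fun D \<phi> \<longrightarrow>
           (LINT x:D|lebesgue. norm (g x) powr (p - 2) * (g x \<bullet> grad \<phi> x)) = 0))"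

definition p_superharmonic :: "real \<Rightarrow> 'a::euclidean_space set \<Rightarrow> ('a \<Rightarrow> ereal) \<Rightarrow> bool" where
  "p_superharmonic p \<Omega> u \<longleftrightarrow>
     (\<exists>x\<in>\<Omega>. u x \<noteq> \<infinity>) \<and>
     (\<forall>x\<in>\<Omega>. u x \<le> Liminf (at x within \<Omega>) u) \<and>
     (\<forall>D h. open D \<and> compact (closure D) \<and> closure D \<subseteq> \<Omega> \<and>
        continuous_on (closure D) h \<and> p_harmonic p D h \<and>
        (\<forall>x\<in>frontier D. ereal (h x) \<le> u x) \<longrightarrow> (\<forall>x\<in>D. ereal (h x) \<le> u x))"

definition pole_term :: "real \<Rightarrow> real \<Rightarrow> 'a::euclidean_space \<Rightarrow> 'a \<Rightarrow> ereal" where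
  "pole_term e a y x = (if a = 0 then 0 else if x = y then \<infinity>
      else ereal (a / (norm (x - y) powr e)))"

end

theory Submission
  imports Defs
begin

text \<open>The regularised pole \<open>(|x - z|\<^sup>2 + d\<^sup>2) powr (- e / 2)\<close> is smooth with Hessian \<open>X\<close> such that
  \<open>tr X + (p - 2) * (X \<zeta> \<bullet> \<zeta>) < 0\<close> whenever \<open>|\<zeta>| \<le> 1\<close>. At a fixed \<open>\<zeta>\<close> this condition is linear in
  \<open>X\<close>, so sums of regularised poles and affine functions satisfy it, and it makes the p-Laplacian
  nonpositive although that operator is not linear. The comparison principle against such smooth functions
  follows by testing the equation of \<open>h\<close> with functions of a mollification of \<open>max 0 (h - w)\<close>. The
  concave part enters only through supporting affine functions, and letting \<open>d\<close> tend to 0 along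
  partial sums gives an increasing sequence of continuous functions with limit the series, so that a
  compactness argument on the boundary concludes.\<close>

section \<open>Smooth functions and bumps\<close>

text \<open>\<open>p_harmonic\<close> admits only smooth test functions, while \<open>h - w\<close>
  has just a weak gradient. So its positive part cannot be inserted as it stands, and mollification
  is forced. Monotonicity of the flux is used only in its weak form, so the mollification error has
  to be beaten by a quantity fixed beforehand; this is why the smooth competitor must satisfy its
  inequality with a positive \<open>\<kappa>\<close>. Truncating at a level
  \<open>\<tau> > 0\<close> keeps the test functions compactly inside \<open>D\<close>, so no trace
  theory enters. The exponent \<open>e\<close> is the one for which |x|^(-e) is p-harmonic off the
  origin. In the form (e + 2) (p - 1) = n + p - 2 it makes the trace condition an equality for
  radial unit vectors before regularisation; \<open>d\<^sup>2\<close> supplies the strictness, and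
  \<open>p \<ge> 2\<close> covers all other \<zeta>. Affine functions and vanishing coefficients
  contribute no strictness, so the final competitor carries one small extra pole.\<close>

lemma Ck_SucI:
  assumes "\<And>x. (f has_derivative f' x) (at x)" and "\<And>v. Ck k (\<lambda>x. f' x v)"
  shows "Ck (Suc k) f"
proof -
  have "frechet_derivative f (at x) = f' x" for x
    using frechet_derivative_at[OF assms(1)] by simp
  moreover have "f differentiable_on UNIV"
    using assms(1) by (auto simp: differentiable_on_def differentiable_def)
  ultimately show ?thesis
    using assms(2) differentiable_imp_continuous_on by auto
qed

lemma Ck_Suc_has_derivative:
  assumes "Ck (Suc k) f"
  shows "(f has_derivative frechet_derivative f (at x)) (at x)"
  using assms by (auto simp: differentiable_on_def frechet_derivative_works)

lemma Ck_SucD: "Ck (Suc k) f \<Longrightarrow> Ck k f"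
  by (induction k arbitrary: f) auto

lemma Ck_imp_continuous: "Ck k f \<Longrightarrow> continuous_on UNIV f"
  by (cases k) auto

lemma Ck_const: "Ck k (\<lambda>x. c)"
proof (induction k arbitrary: c)
  case (Suc k)
  show ?case
    by (rule Ck_SucI[where f' = "\<lambda>x v. 0"]) (use Suc in auto)
qed auto

lemma Ck_add: "Ck k f \<Longrightarrow> Ck k g \<Longrightarrow> Ck k (\<lambda>x. f x + g x)"
proof (induction k arbitrary: f g)
  case (Suc k)
  show ?case
  proof (rule Ck_SucI)
    show "((\<lambda>x. f x + g x) has_derivative
        (\<lambda>v. frechet_derivative f (at x) v + frechet_derivative g (at x) v)) (at x)" for x
      using Suc.prems by (intro has_derivative_add Ck_Suc_has_derivative)
  qed (use Suc in auto)
qed (auto intro: continuous_intros)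

lemma Ck_mult: "Ck k f \<Longrightarrow> Ck k g \<Longrightarrow> Ck k (\<lambda>x. f x * g x)"
proof (induction k arbitrary: f g)
  case (Suc k)
  show ?case
  proof (rule Ck_SucI)
    show "((\<lambda>x. f x * g x) has_derivative
        (\<lambda>v. f x * frechet_derivative g (at x) v + frechet_derivative f (at x) v * g x)) (at x)" for x
      using Suc.prems by (intro has_derivative_mult Ck_Suc_has_derivative)
    show "Ck k (\<lambda>x. f x * frechet_derivative g (at x) v + frechet_derivative f (at x) v * g x)" for v
      using Suc.prems by (intro Ck_add Suc.IH) (auto intro: Ck_SucD[OF Suc.prems(1)] Ck_SucD[OF Suc.prems(2)])
  qed
qed (auto intro: continuous_intros)

lemma Ck_inner: "Ck k (\<lambda>x. (x - z) \<bullet> v)"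
proof (cases k)
  case (Suc m)
  show ?thesis unfolding Suc
    by (rule Ck_SucI[where f' = "\<lambda>x u. u \<bullet> v"])
      (auto intro!: derivative_eq_intros Ck_const)
qed (auto intro!: continuous_intros)

section \<open>Flat exponentials and smooth bumps\<close>

definition exp_flat :: "nat \<Rightarrow> real \<Rightarrow> real" where
  "exp_flat k t = (if t > 0 then exp (- 1 / t) / t ^ k else 0)"

lemma exp_flat_nonneg [simp]: "exp_flat k t \<ge> 0"
  by (simp add: exp_flat_def)

lemma exp_flat_eq_0_iff [simp]: "exp_flat k t = 0 \<longleftrightarrow> t \<le> 0"
  by (simp add: exp_flat_def)

lemma tendsto_exp_flat_at_right: "((\<lambda>t. exp (- 1 / t) / t ^ k) \<longlongrightarrow> 0) (at_right (0::real))"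
proof -
  have "((\<lambda>s. s ^ k / exp s) \<longlongrightarrow> 0) (at_top :: real filter)"
    by (rule tendsto_power_div_exp_0)
  then have "((\<lambda>t. inverse t ^ k / exp (inverse t)) \<longlongrightarrow> 0) (at_right (0::real))"
    using filterlim_compose filterlim_inverse_at_top_right by blast
  then show ?thesis
    by (simp add: exp_minus field_simps)
qed

text \<open>Differentiating exp(-1/t) / t^k yields only functions of the same shape, with powers k +
  2 and k + 1. This closure is the reason for the parameter \<open>k\<close> in
  \<open>exp_flat\<close>: every higher derivative of \<open>exp_flat 0\<close> is a combination of
  members of the family.\<close>

lemma exp_flat_has_real_derivative:
  "(exp_flat k has_real_derivative exp_flat (k + 2) t - real k * exp_flat (k + 1) t) (at t)"
proof -
  consider "t > 0" | "t < 0" | "t = 0" by linarith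
  then show ?thesis
  proof cases
    case 1
    have "((\<lambda>t. exp (- 1 / t) / t ^ k) has_real_derivative
        (exp_flat (k + 2) t - real k * exp_flat (k + 1) t)) (at t)"
      using 1
      by (auto intro!: derivative_eq_intros simp: exp_flat_def divide_simps power2_eq_square)
        (cases k; simp add: algebra_simps)
    then show ?thesis
      by (rule has_field_derivative_transform_within_open[of _ _ _ "{0<..}"])
        (use 1 in \<open>auto simp: exp_flat_def\<close>)
  next
    case 2
    have "((\<lambda>t. 0) has_real_derivative 0) (at t)" by simp
    then have "(exp_flat k has_real_derivative 0) (at t)"
      by (rule has_field_derivative_transform_within_open[of _ _ _ "{..<0}"])
        (use 2 in \<open>auto simp: exp_flat_def\<close>)
    then show ?thesis using 2 by (simp add: exp_flat_def)
  next
    case 3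
    \<comment> \<open>The difference quotient at 0 is itself flat, with power
      \<open>Suc k\<close>.\<close>
    have r: "((\<lambda>h. exp_flat k h / h) \<longlongrightarrow> 0) (at_right 0)"
      by (rule Lim_transform_eventually[OF tendsto_exp_flat_at_right[of "Suc k"]])
        (auto simp: eventually_at_right_less exp_flat_def eventually_at_filter field_simps)
    have l: "((\<lambda>h. exp_flat k h / h) \<longlongrightarrow> 0) (at_left 0)"
      by (rule Lim_transform_eventually[OF tendsto_const])
        (auto simp: exp_flat_def eventually_at_filter)
    have "((\<lambda>h. exp_flat k h / h) \<longlongrightarrow> 0) (at 0)"
      using filterlim_split_at l r by blast
    then show ?thesis using 3
      by (simp add: DERIV_def exp_flat_def)
  qed
qed

lemma exp_flat_0_has_real_derivative: "(exp_flat 0 has_real_derivative exp_flat 2 t) (at t)"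
  using exp_flat_has_real_derivative[of 0 t] by (simp add: numeral_2_eq_2)

lemma exp_flat_mono: "s \<le> t \<Longrightarrow> exp_flat 0 s \<le> exp_flat 0 t"
  by (auto simp: exp_flat_def frac_le)

lemma continuous_exp_flat: "continuous_on UNIV (exp_flat k)"
  by (rule DERIV_continuous_on[OF has_field_derivative_at_within[OF exp_flat_has_real_derivative]])

lemma continuous_exp_flat_compose [continuous_intros]:
  "continuous_on S f \<Longrightarrow> continuous_on S (\<lambda>x. exp_flat k (f x))"
  using continuous_on_compose2[OF continuous_exp_flat, of S f] by auto

text \<open>The induction on \<open>m\<close> generalises over \<open>k\<close>, because the
  derivative involves the indices \<open>k + 1\<close> and \<open>k + 2\<close>.\<close>

lemma Ck_exp_flat_compose:
  "(\<And>j. Ck j q) \<Longrightarrow> Ck m (\<lambda>x. exp_flat k (q x))"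
proof (induction m arbitrary: k)
  case 0
  have "continuous_on UNIV q" using "0"[of 0] by simp
  then show ?case by (simp add: continuous_intros)
next
  case (Suc m)
  show ?case
  proof (rule Ck_SucI)
    show "((\<lambda>x. exp_flat k (q x)) has_derivative
      (\<lambda>v. (exp_flat (k + 2) (q x) + (- real k) * exp_flat (k + 1) (q x)) * frechet_derivative q (at x) v))
        (at x)" for x
      using has_derivative_compose[OF Ck_Suc_has_derivative[OF Suc.prems, of x]
          exp_flat_has_real_derivative[unfolded has_field_derivative_def, of k "q x"]]
      by simp
    show "Ck m (\<lambda>x. (exp_flat (k + 2) (q x) + (- real k) * exp_flat (k + 1) (q x)) * frechet_derivative q (at x) v)" for v
      using Suc.prems[of "Suc m"] by (intro Ck_add Ck_mult Suc.IH Suc.prems Ck_const) auto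
  qed
qed

text \<open>Squared distances make the inner function a polynomial in the coordinates, hence smooth
  also at the centre. The bump is left unnormalised; \<open>mollifier\<close> divides by its
  mass.\<close>

definition bump :: "real \<Rightarrow> 'a::euclidean_space \<Rightarrow> 'a \<Rightarrow> real" where
  "bump \<epsilon> z x = exp_flat 0 (\<epsilon>\<^sup>2 - (norm (x - z))\<^sup>2)"

lemma bump_nonneg [simp]: "bump \<epsilon> z x \<ge> 0"
  by (simp add: bump_def)

lemma bump_eq_0_iff: "\<epsilon> > 0 \<Longrightarrow> bump \<epsilon> z x = 0 \<longleftrightarrow> dist z x \<ge> \<epsilon>"
  using power2_le_iff_abs_le[of \<epsilon> "norm (x - z)"]
  by (simp add: bump_def dist_norm norm_minus_commute)

lemma Ck_bump: "Ck k (bump \<epsilon> (z::'a::euclidean_space))"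
proof -
  have q: "Ck j (\<lambda>x. \<epsilon>\<^sup>2 - (norm (x - z))\<^sup>2)" for j
  proof -
    have s: "Ck j (\<lambda>x. \<Sum>b\<in>B. ((x - z) \<bullet> b) * ((x - z) \<bullet> b))" if "finite B" for B
      using that by (induction B) (auto intro!: Ck_const Ck_add Ck_mult Ck_inner)
    have "Ck j (\<lambda>x. \<epsilon>\<^sup>2 + (-1) * (\<Sum>b\<in>Basis. ((x - z) \<bullet> b) * ((x - z) \<bullet> b)))"
      by (intro Ck_add Ck_mult Ck_const s) auto
    moreover have "(norm (x - z))\<^sup>2 = (\<Sum>b\<in>Basis. ((x - z) \<bullet> b) * ((x - z) \<bullet> b))" for x
      unfolding power2_norm_eq_inner using euclidean_inner[of "x - z" "x - z"] by simp
    ultimately show ?thesis by simp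
  qed
  show ?thesis
    unfolding bump_def by (rule Ck_exp_flat_compose) (rule q)
qed

lemma support_bump: "\<epsilon> > 0 \<Longrightarrow> closure {x. bump \<epsilon> z x \<noteq> 0} = cball z \<epsilon>"
  by (simp add: bump_eq_0_iff not_le flip: ball_def)

lemma test_fun_bump:
  assumes "\<epsilon> > 0" and "cball z \<epsilon> \<subseteq> D"
  shows "test_fun D (bump \<epsilon> z)"
  using assms by (simp add: test_fun_def smooth_fun_def Ck_bump support_bump)

lemma bump_integral_pos:
  assumes "\<epsilon> > 0"
  shows "integrable lborel (bump \<epsilon> z)" "(\<integral>x. bump \<epsilon> z x \<partial>lborel) > 0"
proof -
  have "integrable lborel (\<lambda>x. indicator (cball z \<epsilon>) x *\<^sub>R bump \<epsilon> z x)"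
    by (intro borel_integrable_compact continuous_on_subset[OF Ck_imp_continuous[OF Ck_bump[of 0]]]) auto
  moreover have "indicator (cball z \<epsilon>) x *\<^sub>R bump \<epsilon> z x = bump \<epsilon> z x" for x
    using assms by (auto simp: indicator_def bump_eq_0_iff)
  ultimately show i: "integrable lborel (bump \<epsilon> z)" by (simp only:)
  have "(\<integral>x. bump \<epsilon> z x \<partial>lborel) \<noteq> 0"
  proof
    assume "(\<integral>x. bump \<epsilon> z x \<partial>lborel) = 0"
    then have "AE x in lborel. bump \<epsilon> z x = 0"
      using integral_nonneg_eq_0_iff_AE[OF i] bump_nonneg[of \<epsilon> z] by simp
    then have "AE x in lborel. x \<notin> ball z \<epsilon>"
      by (rule AE_mp) (use assms in \<open>auto simp: bump_eq_0_iff\<close>)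
    then have "emeasure lborel (ball z \<epsilon>) = 0"
      by (simp add: AE_iff_null_sets null_setsD1)
    then show False
      using assms open_not_negligible[of "ball z \<epsilon>"]
      by (simp add: negligible_iff_emeasure0)
  qed
  then show "(\<integral>x. bump \<epsilon> z x \<partial>lborel) > 0"
    using Bochner_Integration.integral_nonneg[of lborel "bump \<epsilon> z"] by (simp add: less_le)
qed

section \<open>Integration and convolution\<close>

lemma integrable_continuous_compact_support:
  fixes f :: "'a::euclidean_space \<Rightarrow> 'b::{banach, second_countable_topology}"
  assumes "continuous_on UNIV f" and "compact C" and "\<And>x. x \<notin> C \<Longrightarrow> f x = 0"
  shows "integrable lborel f"
proof -
  have "integrable lborel (\<lambda>x. indicator C x *\<^sub>R f x)"
    by (intro borel_integrable_compact assms continuous_on_subset[OF assms(1)]) auto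
  moreover have "(\<lambda>x. indicator C x *\<^sub>R f x) = f"
    using assms(3) by (auto simp: indicator_def)
  ultimately show ?thesis by simp
qed

lemma lborel_translation_invariant:
  fixes f :: "'a::euclidean_space \<Rightarrow> 'b::{banach, second_countable_topology}"
  shows "integrable lborel f \<Longrightarrow> integrable lborel (\<lambda>x. f (c + x))"
    and "f \<in> borel_measurable borel \<Longrightarrow> (\<integral>x. f (c + x) \<partial>lborel) = (\<integral>x. f x \<partial>lborel)"
proof -
  have m: "(+) c \<in> measurable lborel borel" by simp
  show "integrable lborel f \<Longrightarrow> integrable lborel (\<lambda>x. f (c + x))"
    using integrable_distr_eq[OF m, of f] by (simp add: lborel_distr_plus)
  show "f \<in> borel_measurable borel \<Longrightarrow> (\<integral>x. f (c + x) \<partial>lborel) = (\<integral>x. f x \<partial>lborel)"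
    using integral_distr[OF m, of f] by (simp add: lborel_distr_plus)
qed

lemma nn_integral_translation_invariant:
  fixes f :: "'a::euclidean_space \<Rightarrow> ennreal"
  assumes "f \<in> borel_measurable borel"
  shows "(\<integral>\<^sup>+x. f (c + x) \<partial>lborel) = (\<integral>\<^sup>+x. f x \<partial>lborel)"
proof -
  have m: "(+) c \<in> measurable lborel borel" by simp
  show ?thesis
    using nn_integral_distr[OF m, of f] assms by (simp add: lborel_distr_plus)
qed

text \<open>The integral of the difference quotient vanishes by translation invariance.\<close>
lemma integral_directional_derivative_eq_0:
  fixes f :: "'a::euclidean_space \<Rightarrow> real"
  assumes f: "\<And>x. (f has_derivative f' x) (at x)"
    and f': "continuous_on UNIV (\<lambda>x. f' x v)"
    and C: "compact C" and out: "\<And>x. x \<notin> C \<Longrightarrow> f x = 0"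
  shows "(\<integral>x. f' x v \<partial>lborel) = 0"
proof -
  obtain R where R: "C \<subseteq> cball 0 R" "R > 0"
    using C compact_imp_bounded bounded_pos by (metis mem_cball_0 subsetI)
  \<comment> \<open>The complement of \<open>C\<close> is open and \<open>f\<close> is constant
    there, so the derivative has its support in \<open>C\<close> as well.\<close>
  have f'0: "f' x v = 0" if "x \<notin> C" for x
  proof -
    have "((\<lambda>_. 0) has_derivative f' x) (at x)"
      by (rule has_derivative_transform_within_open[OF f open_Compl[OF compact_imp_closed[OF C]]])
        (use that out in auto)
    then have "f' x = (\<lambda>_. 0)"
      by (rule has_derivative_unique) simp
    then show ?thesis by simp
  qed
  have contf: "continuous_on UNIV f"
    using f has_derivative_continuous_on by blast
  have "bounded ((\<lambda>x. f' x v) ` C)"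
    using C f' by (meson compact_continuous_image compact_imp_bounded continuous_on_subset top_greatest)
  then obtain M where M: "M > 0" "\<And>x. x \<in> C \<Longrightarrow> \<bar>f' x v\<bar> \<le> M"
    unfolding bounded_pos by auto
  have M': "\<bar>f' x v\<bar> \<le> M" for x
    using M f'0[of x] by (cases "x \<in> C") auto
  have d: "((\<lambda>t. f (x + t *\<^sub>R v)) has_real_derivative f' (x + t *\<^sub>R v) v) (at t)" for x t
  proof -
    have "((\<lambda>t. f (x + t *\<^sub>R v)) has_derivative (\<lambda>h. f' (x + t *\<^sub>R v) (h *\<^sub>R v))) (at t)"
      by (rule has_derivative_compose[OF _ f]) (auto intro!: derivative_eq_intros)
    moreover have "(\<lambda>h. f' (x + t *\<^sub>R v) (h *\<^sub>R v)) = (*) (f' (x + t *\<^sub>R v) v)"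
      using has_derivative_linear[OF f] by (auto simp: fun_eq_iff linear_cmul)
    ultimately show ?thesis by (simp add: has_field_derivative_def)
  qed
  define q where "q k x = (f (x + inverse (real (Suc k)) *\<^sub>R v) - f x) / inverse (real (Suc k))" for k x
  have intf: "integrable lborel f"
    by (rule integrable_continuous_compact_support[OF contf C out])
  have q0: "(\<integral>x. q k x \<partial>lborel) = 0" for k
  proof -
    let ?c = "inverse (real (Suc k)) *\<^sub>R v"
    have "integrable lborel (\<lambda>x. f (?c + x))"
      using lborel_translation_invariant(1)[OF intf] .
    moreover have "(\<integral>x. f (?c + x) \<partial>lborel) = (\<integral>x. f x \<partial>lborel)"
      by (rule lborel_translation_invariant(2)) (use contf in \<open>simp add: borel_measurable_continuous_onI\<close>)
    ultimately show ?thesis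
      using intf by (simp add: q_def[abs_def] add.commute)
  qed
  have "(\<lambda>k. \<integral>x. q k x \<partial>lborel) \<longlonglongrightarrow> (\<integral>x. f' x v \<partial>lborel)"
  \<comment> \<open>The mean value theorem bounds all quotients by \<open>M\<close>, and step
    lengths at most 1 keep their supports in one ball of radius \<open>R + norm v\<close>.\<close>
  proof (rule integral_dominated_convergence[where w = "\<lambda>x. M * indicator (cball 0 (R + norm v)) x"])
    show "(\<lambda>x. f' x v) \<in> borel_measurable lborel"
      using f' by (simp add: borel_measurable_continuous_onI)
    show "q k \<in> borel_measurable lborel" for k
    proof -
      have "continuous_on UNIV (q k)"
        unfolding q_def by (intro continuous_intros continuous_on_compose2[OF contf]) auto
      then show ?thesis by (simp add: borel_measurable_continuous_onI)
    qed
    show "integrable lborel (\<lambda>x. M * indicator (cball 0 (R + norm v)) x)"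
      by (intro integrable_mult_right integrable_real_indicator) (auto simp: emeasure_bounded_finite[unfolded infinity_ennreal_def])
    show "AE x in lborel. (\<lambda>k. q k x) \<longlonglongrightarrow> f' x v"
    proof (rule AE_I2)
      fix x
      have l: "((\<lambda>h. (f (x + h *\<^sub>R v) - f x) / h) \<longlongrightarrow> f' x v) (at 0)"
        using d[of x 0] by (simp add: DERIV_def)
      have "filterlim (\<lambda>k. inverse (real (Suc k))) (at 0) sequentially"
        by (rule filterlim_atI[OF LIMSEQ_inverse_real_of_nat]) auto
      from filterlim_compose[OF l this] show "(\<lambda>k. q k x) \<longlonglongrightarrow> f' x v"
        by (simp add: q_def)
    qed
    show "AE x in lborel. norm (q k x) \<le> M * indicator (cball 0 (R + norm v)) x" for k
    proof (rule AE_I2)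
      fix x
      let ?t = "inverse (real (Suc k))"
      have t: "0 < ?t" "?t \<le> 1" by (auto simp: inverse_le_1_iff)
      show "norm (q k x) \<le> M * indicator (cball 0 (R + norm v)) x"
      proof (cases "x \<in> cball 0 (R + norm v)")
        case True
        obtain s where "f (x + ?t *\<^sub>R v) - f (x + 0 *\<^sub>R v) = (?t - 0) * f' (x + s *\<^sub>R v) v"
          using MVT2[OF t(1), of "\<lambda>t. f (x + t *\<^sub>R v)" "\<lambda>t. f' (x + t *\<^sub>R v) v"] d by blast
        then have "q k x = f' (x + s *\<^sub>R v) v"
          using t(1) by (simp add: q_def)
        then show ?thesis using True M' by simp
      next
        case False
        have "norm (?t *\<^sub>R v) \<le> norm v" using t by (simp add: mult_left_le_one_le)
        then have "norm x \<le> norm (x + ?t *\<^sub>R v) + norm v"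
          using norm_triangle_ineq4[of "x + ?t *\<^sub>R v" "?t *\<^sub>R v"] by simp
        then have "\<not> norm (x + ?t *\<^sub>R v) \<le> R" "\<not> norm x \<le> R"
          using False norm_ge_zero[of v] unfolding mem_cball_0 by linarith+
        then have "x + ?t *\<^sub>R v \<notin> C" "x \<notin> C"
          using R by (auto simp: subset_iff)
        then show ?thesis using out M(1) by (simp add: q_def)
      qed
    qed
  qed
  then show ?thesis
    by (simp add: q0 LIMSEQ_const_iff)
qed

text \<open>Passage to the gauge integral over a box, the setting of the Leibniz rule and of the
  continuity of parameter integrals used for convolutions.\<close>

lemma integral_eq_integral_cbox:
  fixes f :: "'a::euclidean_space \<Rightarrow> real"
  assumes "continuous_on UNIV f" and "\<And>x. x \<notin> cbox a b \<Longrightarrow> f x = 0"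
  shows "(\<integral>x. f x \<partial>lborel) = integral (cbox a b) f"
proof -
  have "integrable lborel f"
    by (rule integrable_continuous_compact_support[OF assms(1) compact_cbox assms(2)])
  then have "(\<integral>x. f x \<partial>lborel) = integral UNIV f"
    by (metis has_integral_integral_lborel integral_unique)
  also have "\<dots> = integral UNIV (\<lambda>x. if x \<in> cbox a b then f x else 0)"
    using assms(2) by (intro arg_cong[where f = "integral UNIV"]) auto
  finally show ?thesis by (simp only: integral_restrict_UNIV)
qed

lemma convolution_has_derivative:
  fixes f u :: "'a::euclidean_space \<Rightarrow> real"
  assumes f: "\<And>x. (f has_derivative f' x) (at x)"
    and f': "\<And>v. continuous_on UNIV (\<lambda>x. f' x v)"
    and u: "continuous_on UNIV u" and C: "compact C" "\<And>x. x \<notin> C \<Longrightarrow> u x = 0"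
  shows "((\<lambda>x. \<integral>y. f (x - y) * u y \<partial>lborel) has_derivative
      (\<lambda>v. \<integral>y. f' (x - y) v * u y \<partial>lborel)) (at x)"
proof -
  obtain a b where ab: "C \<subseteq> cbox a b"
    using C(1) bounded_subset_cbox_symmetric compact_imp_bounded by metis
  then have u0: "u y = 0" if "y \<notin> cbox a b" for y using C(2) that by auto
  have contf: "continuous_on UNIV f"
    using f has_derivative_continuous_on by blast
  \<comment> \<open>The Leibniz rule asks for a derivative that is jointly continuous as a map into
    bounded linear functions. Hence \<open>f'\<close> is packed with \<open>Blinfun\<close>, and
    continuity is checked direction by direction.\<close>
  define F where "F x y = u y *\<^sub>R Blinfun (f' (x - y))" for x y
  have F: "blinfun_apply (F x y) v = f' (x - y) v * u y" for x y v
    using bounded_linear_Blinfun_apply[OF has_derivative_bounded_linear[OF f], of "x - y"]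
    by (simp add: F_def blinfun.scaleR_left)
  have contF: "continuous_on S (\<lambda>(x, y). F x y)" for S
    unfolding case_prod_unfold
    by (intro continuous_on_blinfun_componentwise)
      (auto simp: F intro!: continuous_intros continuous_on_compose2[OF f'] continuous_on_compose2[OF u])
  have F': "integral (cbox a b) (F x) v = (\<integral>y. f' (x - y) v * u y \<partial>lborel)" for v
  proof -
    have i: "F x integrable_on cbox a b"
    proof (rule integrable_continuous)
      have "continuous_on (cbox a b) (\<lambda>y. (x, y))" by (intro continuous_intros)
      from continuous_on_compose2[OF contF[of UNIV] this]
      show "continuous_on (cbox a b) (F x)" by simp
    qed
    have "integral (cbox a b) (F x) v = integral (cbox a b) (\<lambda>y. F x y v)"
      using integral_linear[OF i blinfun.bounded_linear_left[of v]] by (simp add: o_def)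
    also have "\<dots> = (\<integral>y. f' (x - y) v * u y \<partial>lborel)"
      unfolding F by (rule integral_eq_integral_cbox[symmetric])
        (auto simp: u0 intro!: continuous_intros continuous_on_compose2[OF f'] continuous_on_compose2[OF u])
    finally show ?thesis .
  qed
  have "((\<lambda>x. integral (cbox a b) (\<lambda>y. f (x - y) * u y)) has_derivative integral (cbox a b) (F x)) (at x)"
  proof (rule leibniz_rule[where U = UNIV])
    show "((\<lambda>x. f (x - t) * u t) has_derivative blinfun_apply (F x t)) (at x within UNIV)" for x t
    proof -
      have "((\<lambda>x. f (x - t)) has_derivative f' (x - t)) (at x)"
        by (rule has_derivative_compose[OF _ f]) (auto intro!: derivative_eq_intros)
      then show ?thesis
        using has_derivative_mult_left[of "\<lambda>x. f (x - t)" "f' (x - t)" "at x" "u t"] F[of x t, symmetric] by simp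
    qed
    show "(\<lambda>y. f (x - y) * u y) integrable_on cbox a b" for x
      by (intro integrable_continuous continuous_intros continuous_on_compose2[OF contf] continuous_on_subset[OF u]) auto
  qed (auto intro: contF)
  moreover have "integral (cbox a b) (\<lambda>y. f (x - y) * u y) = (\<integral>y. f (x - y) * u y \<partial>lborel)" for x
    by (rule integral_eq_integral_cbox[symmetric])
      (auto simp: u0 intro!: continuous_intros continuous_on_compose2[OF contf] continuous_on_compose2[OF u])
  ultimately show ?thesis
    unfolding F'[abs_def, symmetric] by simp
qed

text \<open>All derivatives fall on \<open>f\<close>, so continuity of \<open>u\<close> is enough;
  the induction therefore generalises over \<open>f\<close>.\<close>

lemma Ck_convolution:
  fixes f u :: "'a::euclidean_space \<Rightarrow> real"
  assumes u: "continuous_on UNIV u" "compact C" "\<And>x. x \<notin> C \<Longrightarrow> u x = 0"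
  shows "Ck k f \<Longrightarrow> Ck k (\<lambda>x. \<integral>y. f (x - y) * u y \<partial>lborel)"
proof (induction k arbitrary: f)
  case 0
  then have contf: "continuous_on UNIV f" by simp
  obtain a b where ab: "C \<subseteq> cbox a b"
    using u(2) bounded_subset_cbox_symmetric compact_imp_bounded by metis
  then have u0: "u y = 0" if "y \<notin> cbox a b" for y using u(3) that by auto
  have "integral (cbox a b) (\<lambda>y. f (x - y) * u y) = (\<integral>y. f (x - y) * u y \<partial>lborel)" for x
    by (rule integral_eq_integral_cbox[symmetric])
      (auto simp: u0 intro!: continuous_intros continuous_on_compose2[OF contf] continuous_on_compose2[OF u(1)])
  moreover have "continuous_on UNIV (\<lambda>x. integral (cbox a b) (\<lambda>y. f (x - y) * u y))"
    by (rule integral_continuous_on_param)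
      (auto simp: case_prod_unfold intro!: continuous_intros continuous_on_compose2[OF contf] continuous_on_compose2[OF u(1)])
  ultimately show ?case by simp
next
  case (Suc k)
  show ?case
  proof (rule Ck_SucI)
    show "((\<lambda>x. \<integral>y. f (x - y) * u y \<partial>lborel) has_derivative
      (\<lambda>v. \<integral>y. frechet_derivative f (at (x - y)) v * u y \<partial>lborel)) (at x)" for x
      using Suc.prems
      by (intro convolution_has_derivative[OF Ck_Suc_has_derivative[OF Suc.prems] _ u])
        (auto intro: Ck_imp_continuous)
    show "Ck k (\<lambda>x. \<integral>y. frechet_derivative f (at (x - y)) v * u y \<partial>lborel)" for v
      using Suc.prems by (intro Suc.IH) auto
  qed
qed

section \<open>Continuity of translation in Lp\<close>

lemma powr_sum3_le:
  fixes a b c p :: real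
  assumes "a \<ge> 0" "b \<ge> 0" "c \<ge> 0" "p \<ge> 0"
  shows "(a + b + c) powr p \<le> 3 powr p * (a powr p + b powr p + c powr p)"
proof -
  define m where "m = max a (max b c)"
  have m: "m \<ge> 0" "a + b + c \<le> 3 * m" using assms by (auto simp: m_def)
  have "(a + b + c) powr p \<le> (3 * m) powr p"
    using assms m by (intro powr_mono2) auto
  also have "\<dots> = 3 powr p * m powr p" using m by (simp add: powr_mult)
  also have "m powr p \<le> a powr p + b powr p + c powr p"
    by (auto simp: m_def max_def)
  finally show ?thesis by (simp add: mult_left_mono)
qed

text \<open>A Young inequality with a free parameter, obtained without convexity: either
  \<open>b \<le> t * a\<close>, or \<open>a\<close> is below \<open>b / t\<close>, and each case
  gives one of the two summands.\<close>

lemma powr_mult_le_powr_add_powr: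
  fixes a b t p :: real
  assumes "a \<ge> 0" "b \<ge> 0" "t > 0" "p \<ge> 1"
  shows "a powr (p - 1) * b \<le> t * a powr p + t powr (1 - p) * b powr p"
proof (cases "b \<le> t * a")
  case True
  have "a powr (p - 1) * b \<le> a powr (p - 1) * (t * a)"
    using True by (intro mult_left_mono) auto
  also have "\<dots> = t * a powr p"
    using assms by (cases "a = 0") (auto simp: powr_diff)
  finally show ?thesis by (simp add: add_increasing2)
next
  case False
  then have b: "b > 0" using assms by (smt (verit) mult_nonneg_nonneg)
  have "a powr (p - 1) * b \<le> (b / t) powr (p - 1) * b"
    using assms False b by (intro mult_right_mono powr_mono2) (auto simp: field_simps)
  also have "\<dots> = t powr (1 - p) * b powr p"
    using assms b by (simp add: powr_divide powr_diff)
  finally show ?thesis using assms by (simp add: add_increasing)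
qed

text \<open>The radial retraction onto the closed ball of radius \<open>M\<close>; writing it with
  \<open>max\<close> makes continuity visible without a case distinction.\<close>

definition clamp_norm :: "real \<Rightarrow> 'a::real_normed_vector \<Rightarrow> 'a" where
  "clamp_norm M x = (M / max M (norm x)) *\<^sub>R x"

lemma norm_clamp_norm_le: "M > 0 \<Longrightarrow> norm (clamp_norm M x) \<le> M"
  by (auto simp: clamp_norm_def max_def divide_simps)

lemma clamp_norm_eq: "M > 0 \<Longrightarrow> norm x \<le> M \<Longrightarrow> clamp_norm M x = x"
  by (simp add: clamp_norm_def max_def)

lemma norm_diff_clamp_norm_le: "M > 0 \<Longrightarrow> norm (x - clamp_norm M x) \<le> norm x"
proof -
  assume M: "M > 0"
  have "x - clamp_norm M x = (1 - M / max M (norm x)) *\<^sub>R x"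
    by (simp add: clamp_norm_def scaleR_diff_left)
  moreover have "\<bar>1 - M / max M (norm x)\<bar> \<le> 1"
    using M by (auto simp: max_def divide_simps abs_if)
  ultimately show ?thesis
    by (simp add: mult_left_le_one_le)
qed

lemma continuous_clamp_norm: "M > 0 \<Longrightarrow> continuous_on UNIV (clamp_norm M)"
  unfolding clamp_norm_def by (intro continuous_intros) auto

text \<open>Two dominated limits: clamping the values of \<open>G\<close> costs little because the
  remainder is dominated by \<open>G\<close> itself; the clamped function is then an almost
  everywhere limit of continuous functions that share its bound and live on a common ball.\<close>

lemma Lp_continuous_approximation:
  fixes G :: "'a::euclidean_space \<Rightarrow> 'b::euclidean_space"
  assumes G[measurable]: "G \<in> borel_measurable borel"
    and fin: "(\<integral>\<^sup>+x. ennreal (norm (G x) powr p) \<partial>lborel) < \<infinity>"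
    and R: "\<And>x. x \<notin> cball 0 R \<Longrightarrow> G x = 0" and p: "p > 0" and \<eta>: "\<eta> > 0"
  obtains c where "continuous_on UNIV c" "\<And>x. x \<notin> cball 0 (R + 1) \<Longrightarrow> c x = 0"
    "(\<integral>\<^sup>+x. ennreal (norm (G x - c x) powr p) \<partial>lborel) < ennreal \<eta>"
proof -
  \<comment> \<open>Chosen so that two errors of size \<open>\<eta>'\<close>, multiplied by the
    constant of \<open>powr_sum3_le\<close>, add up to \<open>\<eta>\<close>.\<close>
  define \<eta>' where "\<eta>' = \<eta> / (2 * 3 powr p)"
  have \<eta>': "\<eta>' > 0" using \<eta> by (simp add: \<eta>'_def)
  have powr0: "(\<lambda>n. ennreal (norm (a n) powr p)) \<longlonglongrightarrow> 0" if "a \<longlonglongrightarrow> 0" for a :: "nat \<Rightarrow> 'b"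
  proof -
    have "(\<lambda>n. norm (a n) powr p) \<longlonglongrightarrow> 0 powr p"
      using that p by (intro tendsto_powr') (auto intro: tendsto_norm_zero)
    then show ?thesis using tendsto_ennrealI by fastforce
  qed
  have "(\<lambda>n. \<integral>\<^sup>+x. ennreal (norm (G x - clamp_norm (real (Suc n)) (G x)) powr p) \<partial>lborel) \<longlonglongrightarrow> (\<integral>\<^sup>+x. 0 \<partial>(lborel::'a measure))"
  proof (rule nn_integral_dominated_convergence[where w = "\<lambda>x. ennreal (norm (G x) powr p)"])
    show "(\<lambda>x. ennreal (norm (G x - clamp_norm (real (Suc n)) (G x)) powr p)) \<in> borel_measurable lborel" for n
      using borel_measurable_continuous_onI[OF continuous_clamp_norm[of "real (Suc n)"]] by measurable
    show "AE x in lborel. ennreal (norm (G x - clamp_norm (real (Suc n)) (G x)) powr p) \<le> ennreal (norm (G x) powr p)" for n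
      using p by (intro AE_I2 ennreal_leI powr_mono2 norm_diff_clamp_norm_le) auto
    show "AE x in lborel. (\<lambda>n. ennreal (norm (G x - clamp_norm (real (Suc n)) (G x)) powr p)) \<longlonglongrightarrow> 0"
    proof (intro AE_I2 powr0)
      fix x
      obtain n0 where n0: "norm (G x) \<le> real n0" using real_arch_simple by blast
      have "\<forall>\<^sub>F n in sequentially. 0 = G x - clamp_norm (real (Suc n)) (G x)"
        using eventually_ge_at_top[of n0] by eventually_elim (use n0 in \<open>simp add: clamp_norm_eq\<close>)
      then show "(\<lambda>n. G x - clamp_norm (real (Suc n)) (G x)) \<longlonglongrightarrow> 0"
        by (rule Lim_transform_eventually[OF tendsto_const])
    qed
  qed (use fin in auto)
  then have "\<forall>\<^sub>F n in sequentially. (\<integral>\<^sup>+x. ennreal (norm (G x - clamp_norm (real (Suc n)) (G x)) powr p) \<partial>lborel) < ennreal \<eta>'"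
    using \<eta>' by (intro order_tendstoD) auto
  from eventually_happens'[OF sequentially_bot this]
  obtain n where n: "(\<integral>\<^sup>+x. ennreal (norm (G x - clamp_norm (real (Suc n)) (G x)) powr p) \<partial>lborel) < ennreal \<eta>'"
    by blast
  define M where "M = real (Suc n)"
  have M: "M > 0" by (simp add: M_def)
  have contcl: "continuous_on UNIV (clamp_norm M :: 'b \<Rightarrow> 'b)" by (rule continuous_clamp_norm[OF M])
  note [measurable] = borel_measurable_continuous_onI[OF contcl]
  define H where "H x = clamp_norm M (G x)" for x
  have H[measurable]: "H \<in> borel_measurable borel" unfolding H_def by measurable
  \<comment> \<open>\<open>measurable_on\<close> supplies continuous functions that converge to
    \<open>H\<close> off a negligible set, but without any common bound or support; both are imposed
    afterwards.\<close>
  have "H measurable_on UNIV"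
    by (rule lebesgue_measurable_imp_measurable_on) (auto intro!: measurable_completion)
  then obtain N g where N: "negligible N" and g: "\<And>n. continuous_on UNIV (g n)"
    and gl: "\<And>x. x \<notin> N \<Longrightarrow> (\<lambda>n. g n x) \<longlonglongrightarrow> H x"
    unfolding measurable_on_def by auto
  \<comment> \<open>The cutoff equals 1 where \<open>H\<close> may be nonzero, so it does not
    disturb the limit, and vanishes off the ball of radius \<open>R + 1\<close>.\<close>
  define \<theta> where "\<theta> x = max 0 (min 1 (R + 1 - norm x))" for x :: 'a
  have cont\<theta>: "continuous_on UNIV \<theta>" unfolding \<theta>_def by (intro continuous_intros)
  define c where "c k x = \<theta> x *\<^sub>R clamp_norm M (g k x)" for k x
  have contc: "continuous_on UNIV (c k)" for k
    unfolding c_def by (intro continuous_intros cont\<theta> continuous_on_compose2[OF contcl g]) auto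
  have c_meas: "c k \<in> borel_measurable borel" for k
    by (rule borel_measurable_continuous_onI[OF contc])
  have Hc[measurable]: "(\<lambda>x. H x - c k x) \<in> borel_measurable borel" for k
    by (rule borel_measurable_diff[OF H c_meas])
  have Hm: "(\<lambda>x. ennreal (norm (H x - c k x) powr p)) \<in> borel_measurable lborel" for k
  proof -
    have "(\<lambda>v::'b. ennreal (norm v powr p)) \<in> borel_measurable borel" by measurable
    from measurable_compose[OF Hc[of k] this] show ?thesis by (simp only: measurable_lborel2)
  qed
  have c0: "c k x = 0" if "x \<notin> cball 0 (R + 1)" for k x
    using that by (simp add: c_def \<theta>_def)
  have H\<theta>: "\<theta> x *\<^sub>R H x = H x" for x
  proof (cases "x \<in> cball 0 R")
    case False
    then show ?thesis using R by (simp add: H_def clamp_norm_def)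
  qed (simp add: \<theta>_def)
  have HM: "norm (H x) \<le> M" for x unfolding H_def by (rule norm_clamp_norm_le[OF M])
  have cM: "norm (c k x) \<le> M" for k x
  proof -
    have "norm (c k x) \<le> 1 * M"
      unfolding c_def norm_scaleR by (intro mult_mono norm_clamp_norm_le[OF M]) (auto simp: \<theta>_def)
    then show ?thesis by simp
  qed
  have "AE x in lborel. x \<notin> N"
    using AE_not_in[of N lebesgue] N by (simp add: negligible_iff_null_sets AE_completion_iff)
  then have aeconv: "AE x in lborel. (\<lambda>k. H x - c k x) \<longlonglongrightarrow> 0"
  proof eventually_elim
    case (elim x)
    have "(\<lambda>k. clamp_norm M (g k x)) \<longlonglongrightarrow> clamp_norm M (H x)"
      by (rule continuous_on_tendsto_compose[OF contcl gl[OF elim]]) auto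
    then have "(\<lambda>k. H x - c k x) \<longlonglongrightarrow> H x - \<theta> x *\<^sub>R clamp_norm M (H x)"
      unfolding c_def by (intro tendsto_intros)
    then show ?case using H\<theta>[of x] HM[of x] M by (simp add: clamp_norm_eq)
  qed
  have "(\<lambda>k. \<integral>\<^sup>+x. ennreal (norm (H x - c k x) powr p) \<partial>lborel) \<longlonglongrightarrow> (\<integral>\<^sup>+x. 0 \<partial>(lborel::'a measure))"
  proof (rule nn_integral_dominated_convergence[where w = "\<lambda>x. ennreal ((2 * M) powr p) * indicator (cball 0 (R + 1)) x"])
    show "(\<lambda>x. ennreal (norm (H x - c k x) powr p)) \<in> borel_measurable lborel" for k
      by (rule Hm)
    show "AE x in lborel. ennreal (norm (H x - c k x) powr p) \<le> ennreal ((2 * M) powr p) * indicator (cball 0 (R + 1)) x" for k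
    proof (rule AE_I2)
      fix x
      show "ennreal (norm (H x - c k x) powr p) \<le> ennreal ((2 * M) powr p) * indicator (cball 0 (R + 1)) x"
      proof (cases "x \<in> cball 0 (R + 1)")
        case True
        have "norm (H x - c k x) \<le> 2 * M"
          using norm_triangle_ineq4[of "H x" "c k x"] HM[of x] cM[of k x] by simp
        then show ?thesis using True p by (auto intro!: ennreal_leI powr_mono2)
      next
        case False
        then have "H x = 0" using R[of x] by (simp add: H_def clamp_norm_def)
        then show ?thesis using c0[OF False] p by simp
      qed
    qed
    show "(\<integral>\<^sup>+x. ennreal ((2 * M) powr p) * indicator (cball 0 (R + 1)) x \<partial>(lborel::'a measure)) < \<infinity>"
      using emeasure_bounded_finite[of "cball (0::'a) (R + 1)"]
      by (subst nn_integral_cmult_indicator) (auto simp: ennreal_mult_less_top)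
    show "AE x in lborel. (\<lambda>k. ennreal (norm (H x - c k x) powr p)) \<longlonglongrightarrow> 0"
      by (rule eventually_mono[OF aeconv]) (rule powr0)
    show "(\<lambda>x. ennreal ((2 * M) powr p) * indicator (cball 0 (R + 1)) x) \<in> borel_measurable lborel"
      by (intro borel_measurable_times_ennreal borel_measurable_const borel_measurable_indicator) simp
    show "(\<lambda>x. 0) \<in> borel_measurable lborel"
      by (rule borel_measurable_const)
  qed
  then have "\<forall>\<^sub>F k in sequentially. (\<integral>\<^sup>+x. ennreal (norm (H x - c k x) powr p) \<partial>lborel) < ennreal \<eta>'"
    using \<eta>' by (intro order_tendstoD) auto
  from eventually_happens'[OF sequentially_bot this]
  obtain k where k: "(\<integral>\<^sup>+x. ennreal (norm (H x - c k x) powr p) \<partial>lborel) < ennreal \<eta>'"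
    by blast
  have "(\<integral>\<^sup>+x. ennreal (norm (G x - c k x) powr p) \<partial>lborel)
    \<le> (\<integral>\<^sup>+x. ennreal (3 powr p) * (ennreal (norm (G x - H x) powr p) + ennreal (norm (H x - c k x) powr p)) \<partial>lborel)"
  proof (intro nn_integral_mono)
    fix x
    have "norm (G x - c k x) powr p \<le> (norm (G x - H x) + norm (H x - c k x) + 0) powr p"
      using p norm_triangle_ineq[of "G x - H x" "H x - c k x"] by (intro powr_mono2) auto
    also have "\<dots> \<le> 3 powr p * (norm (G x - H x) powr p + norm (H x - c k x) powr p + 0 powr p)"
      using p by (intro powr_sum3_le) auto
    finally show "ennreal (norm (G x - c k x) powr p)
      \<le> ennreal (3 powr p) * (ennreal (norm (G x - H x) powr p) + ennreal (norm (H x - c k x) powr p))"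
      by (simp add: ennreal_mult'[symmetric] ennreal_plus[symmetric] del: ennreal_plus)
  qed
  also have "\<dots> = ennreal (3 powr p) * ((\<integral>\<^sup>+x. ennreal (norm (G x - H x) powr p) \<partial>lborel) + (\<integral>\<^sup>+x. ennreal (norm (H x - c k x) powr p) \<partial>lborel))"
    by (simp add: nn_integral_cmult nn_integral_add)
  also have "\<dots> < ennreal (3 powr p) * (ennreal \<eta>' + ennreal \<eta>')"
    using k n by (intro ennreal_mult_strict_left_mono add_strict_mono) (auto simp: H_def M_def)
  also have "\<dots> = ennreal \<eta>"
    using \<eta>' by (simp add: ennreal_mult'[symmetric] ennreal_plus[symmetric] \<eta>'_def del: ennreal_plus)
  finally show ?thesis using that contc c0 by blast
qed

text \<open>Go from \<open>G\<close> to a continuous approximation \<open>c\<close>, translate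
  \<open>c\<close>, and return. The last error equals the first by translation invariance of the
  measure; uniform continuity of \<open>c\<close> controls the middle one.\<close>

lemma Lp_translation_continuous:
  fixes G :: "'a::euclidean_space \<Rightarrow> 'b::euclidean_space"
  assumes G[measurable]: "G \<in> borel_measurable borel"
    and fin: "(\<integral>\<^sup>+x. ennreal (norm (G x) powr p) \<partial>lborel) < \<infinity>"
    and R: "\<And>x. x \<notin> cball 0 R \<Longrightarrow> G x = 0" and p: "p > 0" and \<eta>: "\<eta> > 0"
  obtains \<delta> where "\<delta> > 0"
    "\<And>z. norm z \<le> \<delta> \<Longrightarrow> (\<integral>\<^sup>+x. ennreal (norm (G x - G (z + x)) powr p) \<partial>lborel) \<le> ennreal \<eta>"
proof -
  define \<eta>' where "\<eta>' = \<eta> / (3 * 3 powr p)"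
  have \<eta>': "\<eta>' > 0" using \<eta> by (simp add: \<eta>'_def)
  obtain c where contc: "continuous_on UNIV c" and c0: "\<And>x. x \<notin> cball 0 (R + 1) \<Longrightarrow> c x = 0"
    and c: "(\<integral>\<^sup>+x. ennreal (norm (G x - c x) powr p) \<partial>lborel) < ennreal \<eta>'"
    using Lp_continuous_approximation[OF G fin R p \<eta>'] by blast
  note [measurable] = borel_measurable_continuous_onI[OF contc]
  define m where "m = measure lborel (cball (0::'a) (R + 2))"
  have em: "emeasure lborel (cball (0::'a) (R + 2)) = ennreal m"
    unfolding m_def using emeasure_bounded_finite[of "cball (0::'a) (R + 2)"]
    by (intro emeasure_eq_ennreal_measure) auto
  have m0: "m \<ge> 0" by (simp add: m_def)
  \<comment> \<open>An oscillation of \<open>\<sigma>\<close> on a ball of measure \<open>m\<close>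
    has p-th power integral at most \<open>\<eta>'\<close>; the added 1 avoids division by
    zero.\<close>
  define \<sigma> where "\<sigma> = (\<eta>' / (m + 1)) powr (1 / p)"
  have \<sigma>: "\<sigma> > 0" "\<sigma> powr p = \<eta>' / (m + 1)"
    using p \<eta>' m0 by (auto simp: \<sigma>_def powr_powr)
  \<comment> \<open>\<open>c\<close> vanishes off radius \<open>R + 1\<close>. For shifts of length
    at most 1 the difference vanishes off radius \<open>R + 2\<close>, and there both arguments stay
    within \<open>R + 3\<close>.\<close>
  have "uniformly_continuous_on (cball 0 (R + 3)) c"
    by (intro compact_uniformly_continuous continuous_on_subset[OF contc]) auto
  then obtain d where d: "d > 0"
    "\<And>x y. x \<in> cball 0 (R + 3) \<Longrightarrow> y \<in> cball 0 (R + 3) \<Longrightarrow> dist y x < d \<Longrightarrow> dist (c y) (c x) < \<sigma>"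
    using \<sigma>(1) unfolding uniformly_continuous_on_def by metis
  define \<delta> where "\<delta> = min 1 (d / 2)"
  have "(\<integral>\<^sup>+x. ennreal (norm (G x - G (z + x)) powr p) \<partial>lborel) \<le> ennreal \<eta>" if z: "norm z \<le> \<delta>" for z
  proof -
    have z1: "norm z \<le> 1" "norm z < d" using z d(1) by (auto simp: \<delta>_def)
    have osc: "ennreal (norm (c x - c (z + x)) powr p) \<le> ennreal (\<sigma> powr p) * indicator (cball 0 (R + 2)) x" for x
    proof (cases "x \<in> cball 0 (R + 2)")
      case True
      then have "norm (z + x) \<le> R + 3" using z1 norm_triangle_ineq[of z x] by simp
      then have "dist (c x) (c (z + x)) < \<sigma>"
        using True z1 d(2)[of "z + x" x] by (simp add: dist_norm norm_minus_commute add.commute)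
      then show ?thesis
        using True p by (auto simp: dist_norm intro!: ennreal_leI powr_mono2)
    next
      case False
      have "norm x \<le> norm (z + x) + norm z" using norm_triangle_ineq4[of "z + x" z] by simp
      then have "x \<notin> cball 0 (R + 1)" "z + x \<notin> cball 0 (R + 1)"
        using False z1 unfolding mem_cball_0 by linarith+
      then show ?thesis using c0 p by simp
    qed
    have "(\<integral>\<^sup>+x. ennreal (norm (c x - c (z + x)) powr p) \<partial>lborel)
      \<le> (\<integral>\<^sup>+x. ennreal (\<sigma> powr p) * indicator (cball 0 (R + 2)) x \<partial>(lborel::'a measure))"
      by (intro nn_integral_mono osc)
    also have "\<dots> = ennreal (\<sigma> powr p * m)"
      by (subst nn_integral_cmult_indicator) (auto simp: em ennreal_mult' m0)
    also have "\<dots> \<le> ennreal \<eta>'"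
      using m0 \<eta>' by (intro ennreal_leI) (simp add: \<sigma>(2) field_simps)
    finally have I2: "(\<integral>\<^sup>+x. ennreal (norm (c x - c (z + x)) powr p) \<partial>lborel) \<le> ennreal \<eta>'" .
    have I3: "(\<integral>\<^sup>+x. ennreal (norm (G (z + x) - c (z + x)) powr p) \<partial>lborel) \<le> ennreal \<eta>'"
      using c nn_integral_translation_invariant[of "\<lambda>x. ennreal (norm (G x - c x) powr p)" z] by simp
    have "(\<integral>\<^sup>+x. ennreal (norm (G x - G (z + x)) powr p) \<partial>lborel)
      \<le> (\<integral>\<^sup>+x. ennreal (3 powr p) * (ennreal (norm (G x - c x) powr p)
          + ennreal (norm (c x - c (z + x)) powr p) + ennreal (norm (G (z + x) - c (z + x)) powr p)) \<partial>lborel)"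
    proof (intro nn_integral_mono)
      fix x
      have "norm (G x - G (z + x)) powr p
          \<le> (norm (G x - c x) + norm (c x - c (z + x)) + norm (G (z + x) - c (z + x))) powr p"
        using p norm_triangle_ineq[of "G x - c x" "c x - c (z + x)"]
          norm_triangle_ineq4[of "G x - c (z + x)" "G (z + x) - c (z + x)"] by (intro powr_mono2) auto
      also have "\<dots> \<le> 3 powr p * (norm (G x - c x) powr p + norm (c x - c (z + x)) powr p + norm (G (z + x) - c (z + x)) powr p)"
        using p by (intro powr_sum3_le) auto
      finally show "ennreal (norm (G x - G (z + x)) powr p)
        \<le> ennreal (3 powr p) * (ennreal (norm (G x - c x) powr p)
          + ennreal (norm (c x - c (z + x)) powr p) + ennreal (norm (G (z + x) - c (z + x)) powr p))"
        by (simp add: ennreal_mult'[symmetric] ennreal_plus[symmetric] ennreal_leI del: ennreal_plus)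
    qed
    also have "\<dots> = ennreal (3 powr p) * ((\<integral>\<^sup>+x. ennreal (norm (G x - c x) powr p) \<partial>lborel)
          + (\<integral>\<^sup>+x. ennreal (norm (c x - c (z + x)) powr p) \<partial>lborel)
          + (\<integral>\<^sup>+x. ennreal (norm (G (z + x) - c (z + x)) powr p) \<partial>lborel))"
      by (simp add: nn_integral_cmult nn_integral_add)
    also have "\<dots> \<le> ennreal (3 powr p) * (ennreal \<eta>' + ennreal \<eta>' + ennreal \<eta>')"
      using c I2 I3 by (intro mult_left_mono add_mono) auto
    also have "\<dots> = ennreal \<eta>"
      using \<eta>' by (simp add: ennreal_mult'[symmetric] ennreal_plus[symmetric] \<eta>'_def del: ennreal_plus)
    finally show ?thesis .
  qed
  moreover have "\<delta> > 0" using d(1) by (simp add: \<delta>_def)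
  ultimately show ?thesis using that by blast
qed

text \<open>The power \<open>p - 1\<close> is the growth of the flux. In the Young inequality,
  \<open>t\<close> is first taken so small that the weight contributes at most
  \<open>\<eta> / 2\<close>; the factor \<open>t powr (1 - p)\<close> is then fixed and is absorbed
  by taking the shift small.\<close>

lemma weighted_translation_continuous:
  fixes G :: "'a::euclidean_space \<Rightarrow> 'b::euclidean_space" and \<beta> :: "'a \<Rightarrow> real"
  assumes G[measurable]: "G \<in> borel_measurable borel"
    and fin: "(\<integral>\<^sup>+x. ennreal (norm (G x) powr p) \<partial>lborel) < \<infinity>"
    and R: "\<And>x. x \<notin> cball 0 R \<Longrightarrow> G x = 0" and p: "p \<ge> 1" and \<eta>: "\<eta> > 0"
    and \<beta>[measurable]: "\<beta> \<in> borel_measurable borel" and \<beta>0: "\<And>x. \<beta> x \<ge> 0"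
    and fin\<beta>: "(\<integral>\<^sup>+x. ennreal (\<beta> x powr p) \<partial>lborel) < \<infinity>"
  obtains \<delta> where "\<delta> > 0"
    "\<And>z. norm z \<le> \<delta> \<Longrightarrow> (\<integral>\<^sup>+x. ennreal (\<beta> x powr (p - 1) * norm (G x - G (z + x))) \<partial>lborel) \<le> ennreal \<eta>"
proof -
  obtain J where J: "J \<ge> 0" "(\<integral>\<^sup>+x. ennreal (\<beta> x powr p) \<partial>lborel) = ennreal J"
    using fin\<beta> by (auto simp: less_top_ennreal)
  define t where "t = \<eta> / (2 * (J + 1))"
  have t: "t > 0" using \<eta> J by (simp add: t_def)
  define \<eta>' where "\<eta>' = \<eta> / (2 * t powr (1 - p))"
  have \<eta>': "\<eta>' > 0" using \<eta> t by (simp add: \<eta>'_def)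
  obtain \<delta> where \<delta>: "\<delta> > 0"
    "\<And>z. norm z \<le> \<delta> \<Longrightarrow> (\<integral>\<^sup>+x. ennreal (norm (G x - G (z + x)) powr p) \<partial>lborel) \<le> ennreal \<eta>'"
    using Lp_translation_continuous[OF G fin R _ \<eta>'] p by (metis less_le_trans zero_less_one)
  have "(\<integral>\<^sup>+x. ennreal (\<beta> x powr (p - 1) * norm (G x - G (z + x))) \<partial>lborel) \<le> ennreal \<eta>"
    if z: "norm z \<le> \<delta>" for z
  proof -
    have "(\<integral>\<^sup>+x. ennreal (\<beta> x powr (p - 1) * norm (G x - G (z + x))) \<partial>lborel)
      \<le> (\<integral>\<^sup>+x. ennreal t * ennreal (\<beta> x powr p)
          + ennreal (t powr (1 - p)) * ennreal (norm (G x - G (z + x)) powr p) \<partial>lborel)"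
    proof (intro nn_integral_mono)
      fix x
      show "ennreal (\<beta> x powr (p - 1) * norm (G x - G (z + x)))
        \<le> ennreal t * ennreal (\<beta> x powr p) + ennreal (t powr (1 - p)) * ennreal (norm (G x - G (z + x)) powr p)"
        using powr_mult_le_powr_add_powr[OF \<beta>0[of x] norm_ge_zero t p] t
        by (simp add: ennreal_mult'[symmetric] ennreal_plus[symmetric] ennreal_leI del: ennreal_plus)
    qed
    also have "\<dots> = ennreal t * ennreal J
          + ennreal (t powr (1 - p)) * (\<integral>\<^sup>+x. ennreal (norm (G x - G (z + x)) powr p) \<partial>lborel)"
      using J(2) by (simp add: nn_integral_cmult nn_integral_add)
    also have "\<dots> \<le> ennreal t * ennreal J + ennreal (t powr (1 - p)) * ennreal \<eta>'"
      by (intro add_left_mono mult_left_mono \<delta>(2) z) auto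
    also have "\<dots> = ennreal (t * J + t powr (1 - p) * \<eta>')"
      using t J \<eta>' by (simp add: ennreal_mult'[symmetric] ennreal_plus[symmetric] del: ennreal_plus)
    also have "\<dots> \<le> ennreal \<eta>"
    proof (intro ennreal_leI)
      have "t * J \<le> \<eta> / 2" using J(1) \<eta> by (simp add: t_def field_simps)
      moreover have "t powr (1 - p) * \<eta>' = \<eta> / 2" using t by (simp add: \<eta>'_def)
      ultimately show "t * J + t powr (1 - p) * \<eta>' \<le> \<eta>" by simp
    qed
    finally show ?thesis .
  qed
  then show ?thesis using that \<delta>(1) by blast
qed

text \<open>Mollification averages translations against a kernel of mass 1, so by Tonelli its error
  inherits the bound for small shifts. The bound holds for all kernels near the origin at once,
  which allows the kernel to be picked after \<open>\<delta>\<close>.\<close>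

lemma weighted_mollification_error:
  fixes G :: "'a::euclidean_space \<Rightarrow> 'b::euclidean_space" and \<beta> :: "'a \<Rightarrow> real"
  assumes G[measurable]: "G \<in> borel_measurable borel"
    and fin: "(\<integral>\<^sup>+x. ennreal (norm (G x) powr p) \<partial>lborel) < \<infinity>"
    and R: "\<And>x. x \<notin> cball 0 R \<Longrightarrow> G x = 0" and p: "p \<ge> 1" and \<eta>: "\<eta> > 0"
    and \<beta>[measurable]: "\<beta> \<in> borel_measurable borel" and \<beta>0: "\<And>x. \<beta> x \<ge> 0"
    and fin\<beta>: "(\<integral>\<^sup>+x. ennreal (\<beta> x powr p) \<partial>lborel) < \<infinity>"
  obtains \<delta> where "\<delta> > 0"
    "\<forall>\<rho>\<in>borel_measurable borel. (\<forall>z. \<rho> z \<ge> 0) \<and> (\<forall>z. norm z > \<delta> \<longrightarrow> \<rho> z = 0) \<and>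
      (\<integral>\<^sup>+z. ennreal (\<rho> z) \<partial>lborel) = 1 \<longrightarrow>
      (\<integral>\<^sup>+x. \<integral>\<^sup>+y. ennreal (\<beta> x powr (p - 1) * (\<rho> (y - x) * norm (G x - G y))) \<partial>lborel \<partial>lborel) \<le> ennreal \<eta>"
proof -
  obtain \<delta> where \<delta>: "\<delta> > 0"
    "\<And>z. norm z \<le> \<delta> \<Longrightarrow> (\<integral>\<^sup>+x. ennreal (\<beta> x powr (p - 1) * norm (G x - G (z + x))) \<partial>lborel) \<le> ennreal \<eta>"
    using weighted_translation_continuous[OF G fin R p \<eta> \<beta> \<beta>0 fin\<beta>] by blast
  have "(\<integral>\<^sup>+x. \<integral>\<^sup>+y. ennreal (\<beta> x powr (p - 1) * (\<rho> (y - x) * norm (G x - G y))) \<partial>lborel \<partial>lborel) \<le> ennreal \<eta>"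
    if \<rho>[measurable]: "\<rho> \<in> borel_measurable borel" and \<rho>0: "\<And>z. \<rho> z \<ge> 0"
      and supp: "\<And>z. norm z > \<delta> \<Longrightarrow> \<rho> z = 0" and one: "(\<integral>\<^sup>+z. ennreal (\<rho> z) \<partial>lborel) = 1" for \<rho>
  proof -
    have "(\<integral>\<^sup>+y. ennreal (\<beta> x powr (p - 1) * (\<rho> (y - x) * norm (G x - G y))) \<partial>lborel)
        = (\<integral>\<^sup>+z. ennreal (\<beta> x powr (p - 1) * (\<rho> z * norm (G x - G (z + x)))) \<partial>lborel)" for x
      using nn_integral_translation_invariant[of "\<lambda>y. ennreal (\<beta> x powr (p - 1) * (\<rho> (y - x) * norm (G x - G y)))" x]
      by (simp add: add.commute)
    then have "(\<integral>\<^sup>+x. \<integral>\<^sup>+y. ennreal (\<beta> x powr (p - 1) * (\<rho> (y - x) * norm (G x - G y))) \<partial>lborel \<partial>lborel)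
      = (\<integral>\<^sup>+x. \<integral>\<^sup>+z. ennreal (\<beta> x powr (p - 1) * (\<rho> z * norm (G x - G (z + x)))) \<partial>lborel \<partial>lborel)"
      by simp
    also have "\<dots> = (\<integral>\<^sup>+z. \<integral>\<^sup>+x. ennreal (\<beta> x powr (p - 1) * (\<rho> z * norm (G x - G (z + x)))) \<partial>lborel \<partial>lborel)"
      by (rule lborel_pair.Fubini'[symmetric]) measurable
    also have "\<dots> = (\<integral>\<^sup>+z. ennreal (\<rho> z) * (\<integral>\<^sup>+x. ennreal (\<beta> x powr (p - 1) * norm (G x - G (z + x))) \<partial>lborel) \<partial>lborel)"
      by (intro nn_integral_cong, subst nn_integral_cmult[symmetric])
        (auto simp: ennreal_mult'[symmetric] \<rho>0 mult_ac)
    also have "\<dots> \<le> (\<integral>\<^sup>+z. ennreal (\<rho> z) * ennreal \<eta> \<partial>lborel)"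
    proof (intro nn_integral_mono)
      fix z
      show "ennreal (\<rho> z) * (\<integral>\<^sup>+x. ennreal (\<beta> x powr (p - 1) * norm (G x - G (z + x))) \<partial>lborel) \<le> ennreal (\<rho> z) * ennreal \<eta>"
        using supp[of z] \<delta>(2)[of z] by (cases "norm z \<le> \<delta>") (auto intro: mult_left_mono)
    qed
    also have "\<dots> = ennreal \<eta>"
      using one by (simp add: nn_integral_multc)
    finally show ?thesis .
  qed
  then show ?thesis using that \<delta>(1) by blast
qed

section \<open>The flux and classical supersolutions\<close>

text \<open>The vector field whose divergence, taken along a gradient, is the p-Laplacian.\<close>

definition flux :: "real \<Rightarrow> 'a::real_inner \<Rightarrow> 'a" where
  "flux p \<xi> = norm \<xi> powr (p - 2) *\<^sub>R \<xi>"

lemma norm_flux: "norm (flux p \<xi>) = norm \<xi> powr (p - 1)"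
  using powr_mult_base[of "norm \<xi>" "p - 2"] by (simp add: flux_def mult.commute)

text \<open>The Cauchy-Schwarz inequality reduces this to the lengths \<open>A\<close> and
  \<open>B\<close>, where it is monotonicity of the power \<open>p - 1\<close> on the half
  line.\<close>

lemma flux_monotone:
  assumes "p \<ge> 1"
  shows "(flux p a - flux p b) \<bullet> (a - b) \<ge> 0"
proof -
  define A B where "A = norm a" and "B = norm b"
  have AB: "A \<ge> 0" "B \<ge> 0" by (auto simp: A_def B_def)
  have mono: "(A powr (p - 1) - B powr (p - 1)) * (A - B) \<ge> 0"
    using AB assms by (cases "A \<le> B") (auto intro!: mult_nonneg_nonneg mult_nonpos_nonpos powr_mono2 simp: powr_mono2)
  have e: "A powr (p - 1) = A powr (p - 2) * A" "B powr (p - 1) = B powr (p - 2) * B"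
    using powr_mult_base[of A "p - 2"] powr_mult_base[of B "p - 2"] AB by (auto simp: mult.commute)
  have "(A powr (p - 2) + B powr (p - 2)) * (a \<bullet> b) \<le> (A powr (p - 2) + B powr (p - 2)) * (A * B)"
    unfolding A_def B_def by (intro mult_left_mono norm_cauchy_schwarz) auto
  moreover have "(flux p a - flux p b) \<bullet> (a - b)
      = A powr (p - 2) * A * A + B powr (p - 2) * B * B - (A powr (p - 2) + B powr (p - 2)) * (a \<bullet> b)"
    by (simp add: flux_def A_def B_def inner_diff_left inner_diff_right algebra_simps inner_commute
        power2_norm_eq_inner[symmetric] power2_eq_square)
  ultimately show ?thesis
    using mono unfolding e by (simp add: algebra_simps)
qed

lemma continuous_norm_powr:
  fixes f :: "'a::topological_space \<Rightarrow> 'b::real_normed_vector"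
  assumes "q > 0" "continuous_on S f"
  shows "continuous_on S (\<lambda>x. norm (f x) powr q)"
  using assms by (intro continuous_on_powr' continuous_intros) auto

text \<open>The case \<open>p = 2\<close> stands apart because \<open>0 powr 0\<close> is 0: the
  scalar factor then jumps at the origin although the product is continuous.\<close>

lemma continuous_flux:
  assumes "p \<ge> 2"
  shows "continuous_on UNIV (flux p)"
proof (cases "p = 2")
  case True
  then have "flux p = (\<lambda>x::'a. x)" by (auto simp: flux_def fun_eq_iff)
  then show ?thesis by simp
next
  case False
  then show ?thesis
    unfolding flux_def using assms by (intro continuous_intros continuous_norm_powr) auto
qed

text \<open>At a nonzero gradient, the last clause with \<open>z = \<xi> x / |\<xi> x|\<close> says that the p-Laplacian of \<open>w\<close> is at
  most \<open>- |\<xi> x| powr (p - 2) * \<kappa> x\<close>; admitting shorter \<open>z\<close> makes it survive the regularisation of the flux.\<close>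
definition strict_supersolution ::
  "real \<Rightarrow> ('a::euclidean_space \<Rightarrow> real) \<Rightarrow> ('a \<Rightarrow> 'a) \<Rightarrow> ('a \<Rightarrow> 'a \<Rightarrow> 'a) \<Rightarrow> ('a \<Rightarrow> real) \<Rightarrow> bool" where
  "strict_supersolution p w \<xi> X \<kappa> \<longleftrightarrow>
     (\<forall>x. (w has_derivative (\<lambda>v. \<xi> x \<bullet> v)) (at x)) \<and>
     (\<forall>x. (\<xi> has_derivative X x) (at x)) \<and>
     (\<forall>v. continuous_on UNIV (\<lambda>x. X x v)) \<and>
     continuous_on UNIV \<kappa> \<and>
     (\<forall>x z. norm z \<le> 1 \<longrightarrow> (\<Sum>b\<in>Basis. X x b \<bullet> b) + (p - 2) * (X x z \<bullet> z) \<le> - \<kappa> x)"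

text \<open>The divergence of the compactly supported field \<open>\<phi>\<close> times regularised
  flux has integral zero; expanding it pointwise gives the claim. The term \<open>s\<^sup>2\<close>
  keeps the power differentiable at critical points of \<open>w\<close>.\<close>

lemma regularised_flux_inequality:
  fixes w :: "'a::euclidean_space \<Rightarrow> real"
  assumes super: "strict_supersolution p w \<xi> X \<kappa>" and s: "s > 0"
    and \<phi>: "\<And>x. (\<phi> has_derivative (\<lambda>v. \<gamma> x \<bullet> v)) (at x)" and \<gamma>: "continuous_on UNIV \<gamma>"
    and \<phi>0: "\<And>x. \<phi> x \<ge> 0" and S: "compact S" "\<And>x. x \<notin> S \<Longrightarrow> \<phi> x = 0" "\<And>x. x \<notin> S \<Longrightarrow> \<gamma> x = 0"
  shows "(\<integral>x. \<phi> x * ((\<xi> x \<bullet> \<xi> x + s\<^sup>2) powr ((p - 2) / 2) * \<kappa> x) \<partial>lborel)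
    \<le> (\<integral>x. (\<xi> x \<bullet> \<xi> x + s\<^sup>2) powr ((p - 2) / 2) * (\<xi> x \<bullet> \<gamma> x) \<partial>lborel)"
proof -
  have \<xi>: "(\<xi> has_derivative X x) (at x)"
    and X: "continuous_on UNIV (\<lambda>x. X x v)"
    and cont\<kappa>: "continuous_on UNIV \<kappa>"
    and neg: "norm z \<le> 1 \<Longrightarrow> (\<Sum>b\<in>Basis. X x b \<bullet> b) + (p - 2) * (X x z \<bullet> z) \<le> - \<kappa> x" for x z v
    using super by (auto simp: strict_supersolution_def)
  have cont\<xi>: "continuous_on UNIV \<xi>" by (rule has_derivative_continuous_on[OF \<xi>])
  have cont\<phi>: "continuous_on UNIV \<phi>" by (rule has_derivative_continuous_on[OF \<phi>])
  define Q where "Q x = \<xi> x \<bullet> \<xi> x + s\<^sup>2" for x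
  have Q: "Q x > 0" for x using s by (simp add: Q_def add_nonneg_pos)
  have contQ: "continuous_on UNIV Q" unfolding Q_def by (intro continuous_intros cont\<xi>)
  define e where "e = (p - 2) / 2"
  define N where "N x = Q x powr e" for x
  have contQe: "continuous_on UNIV (\<lambda>x. Q x powr a)" for a
    by (intro continuous_on_powr contQ continuous_intros) (use Q in \<open>auto simp: less_imp_neq[symmetric]\<close>)
  have contN: "continuous_on UNIV N" unfolding N_def by (rule contQe)
  have N0: "N x > 0" for x using Q[of x] by (simp add: N_def)
  define dN where "dN x v = (p - 2) * Q x powr (e - 1) * (\<xi> x \<bullet> X x v)" for x v
  have dQ: "(Q has_derivative (\<lambda>v. 2 * (\<xi> x \<bullet> X x v))) (at x)" for x
    unfolding Q_def by (auto intro!: derivative_eq_intros \<xi> simp: inner_commute)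
  have dN: "(N has_derivative dN x) (at x)" for x
  proof -
    have "((\<lambda>t. t powr e) has_derivative (\<lambda>h. h * (e * Q x powr (e - 1)))) (at (Q x))"
      using has_real_derivative_powr[OF Q[of x], of e] by (simp add: has_field_derivative_def mult.commute[of _ "e * _"])
    from has_derivative_compose[OF dQ this]
    show ?thesis by (simp add: N_def[abs_def] dN_def[abs_def] e_def mult_ac)
  qed
  define V where "V b x = \<phi> x * (N x * (\<xi> x \<bullet> b))" for b x
  define dV where "dV b x v = (\<gamma> x \<bullet> v) * (N x * (\<xi> x \<bullet> b)) + \<phi> x * (dN x v * (\<xi> x \<bullet> b) + N x * (X x v \<bullet> b))" for b x v
  have dV: "(V b has_derivative dV b x) (at x)" for b x
    unfolding V_def[abs_def] dV_def[abs_def]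
    by (rule derivative_eq_intros \<phi> dN \<xi> refl)+ (simp add: algebra_simps)
  have contdV: "continuous_on UNIV (\<lambda>x. dV b x v)" for b v
    unfolding dV_def dN_def by (intro continuous_intros \<gamma> contN cont\<xi> cont\<phi> X contQe)
  have V0: "(\<integral>x. dV b x b \<partial>lborel) = 0" for b
    by (rule integral_directional_derivative_eq_0[OF dV contdV S(1)]) (simp add: V_def S(2))
  have intdV: "integrable lborel (\<lambda>x. dV b x b)" for b
    by (rule integrable_continuous_compact_support[OF contdV S(1)]) (simp add: dV_def S)
  have sum0: "(\<integral>x. (\<Sum>b\<in>Basis. dV b x b) \<partial>lborel) = 0"
    using V0 intdV by simp
  have point: "(\<Sum>b\<in>Basis. dV b x b) \<le> N x * (\<xi> x \<bullet> \<gamma> x) - \<phi> x * (N x * \<kappa> x)" for x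
  proof -
    have linX: "linear (X x)" using \<xi> has_derivative_linear by blast
    have lin: "(\<Sum>b\<in>Basis. (y \<bullet> X x b) * (z \<bullet> b)) = y \<bullet> X x z" for y z
    proof -
      have "X x z = X x (\<Sum>b\<in>Basis. (z \<bullet> b) *\<^sub>R b)" by (simp add: euclidean_representation)
      also have "\<dots> = (\<Sum>b\<in>Basis. (z \<bullet> b) *\<^sub>R X x b)" using linX by (simp add: linear_sum linear_cmul)
      finally show ?thesis by (simp add: inner_sum_right mult.commute)
    qed
    have "(\<Sum>b\<in>Basis. dV b x b)
      = N x * (\<Sum>b\<in>Basis. (\<gamma> x \<bullet> b) * (\<xi> x \<bullet> b)) + \<phi> x * ((p - 2) * Q x powr (e - 1) * (\<Sum>b\<in>Basis. (\<xi> x \<bullet> X x b) * (\<xi> x \<bullet> b))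
          + N x * (\<Sum>b\<in>Basis. X x b \<bullet> b))"
      by (simp add: dV_def dN_def sum.distrib sum_subtractf sum_distrib_left algebra_simps)
    also have "(\<Sum>b\<in>Basis. (\<gamma> x \<bullet> b) * (\<xi> x \<bullet> b)) = \<xi> x \<bullet> \<gamma> x"
      using euclidean_inner[of "\<xi> x" "\<gamma> x"] by (simp add: mult.commute)
    also have "(\<Sum>b\<in>Basis. (\<xi> x \<bullet> X x b) * (\<xi> x \<bullet> b)) = \<xi> x \<bullet> X x (\<xi> x)" by (rule lin)
    also have "Q x powr (e - 1) = N x / Q x"
      using Q[of x] by (simp add: N_def powr_diff)
    finally have eq: "(\<Sum>b\<in>Basis. dV b x b) = N x * (\<xi> x \<bullet> \<gamma> x)
        + \<phi> x * (N x * ((\<Sum>b\<in>Basis. X x b \<bullet> b) + (p - 2) * ((\<xi> x \<bullet> X x (\<xi> x)) / Q x)))"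
      by (simp add: algebra_simps)
    \<comment> \<open>This vector turns the quotient of
      \<open>\<xi> x \<bullet> X x (\<xi> x)\<close> by \<open>Q x\<close> into a value of the
      quadratic form at \<open>z\<close>. It is shorter than a unit vector, since \<open>Q x\<close>
      exceeds the squared length of \<open>\<xi> x\<close>.\<close>
    define z where "z = inverse (sqrt (Q x)) *\<^sub>R \<xi> x"
    have "norm (\<xi> x) \<le> sqrt (Q x)"
      by (rule real_le_rsqrt) (simp add: Q_def power2_norm_eq_inner)
    then have "norm z \<le> 1"
      using Q[of x] by (simp add: z_def field_simps)
    moreover have "X x z \<bullet> z = (\<xi> x \<bullet> X x (\<xi> x)) / Q x"
      using Q[of x] linX by (simp add: z_def linear_cmul inner_commute field_simps)
    ultimately have "(\<Sum>b\<in>Basis. X x b \<bullet> b) + (p - 2) * ((\<xi> x \<bullet> X x (\<xi> x)) / Q x) \<le> - \<kappa> x"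
      using neg[of z x] by simp
    then have "\<phi> x * (N x * ((\<Sum>b\<in>Basis. X x b \<bullet> b) + (p - 2) * ((\<xi> x \<bullet> X x (\<xi> x)) / Q x)))
        \<le> \<phi> x * (N x * (- \<kappa> x))"
      using \<phi>0[of x] N0[of x] by (intro mult_left_mono) auto
    then show ?thesis using eq by simp
  qed
  have i1: "integrable lborel (\<lambda>x. N x * (\<xi> x \<bullet> \<gamma> x))"
    by (rule integrable_continuous_compact_support[OF _ S(1)]) (auto simp: S intro!: continuous_intros contN cont\<xi> \<gamma>)
  have i2: "integrable lborel (\<lambda>x. \<phi> x * (N x * \<kappa> x))"
    by (rule integrable_continuous_compact_support[OF _ S(1)]) (auto simp: S intro!: continuous_intros contN cont\<phi> cont\<kappa>)
  have "(\<integral>x. (\<Sum>b\<in>Basis. dV b x b) \<partial>lborel) \<le> (\<integral>x. N x * (\<xi> x \<bullet> \<gamma> x) - \<phi> x * (N x * \<kappa> x) \<partial>lborel)"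
    using i1 i2 intdV point by (intro integral_mono) auto
  then show ?thesis
    using sum0 i1 i2 by (simp add: N_def Q_def e_def)
qed

text \<open>Removes the regularisation. The left side is bounded below by a fixed integrable
  \<open>f\<close> before the limit, so only the right side has to converge; there the weights
  decrease with \<open>s\<close>, and the first one dominates.\<close>

lemma flux_inequality:
  fixes w :: "'a::euclidean_space \<Rightarrow> real"
  assumes p: "p \<ge> 2" and super: "strict_supersolution p w \<xi> X \<kappa>" and \<kappa>0: "\<And>x. \<kappa> x \<ge> 0"
    and \<phi>: "\<And>x. (\<phi> has_derivative (\<lambda>v. \<gamma> x \<bullet> v)) (at x)" and \<gamma>: "continuous_on UNIV \<gamma>"
    and \<phi>0: "\<And>x. \<phi> x \<ge> 0" and S: "compact S" "\<And>x. x \<notin> S \<Longrightarrow> \<phi> x = 0" "\<And>x. x \<notin> S \<Longrightarrow> \<gamma> x = 0"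
    and f: "integrable lborel f" "\<And>x. f x \<le> \<phi> x * (norm (\<xi> x) powr (p - 2) * \<kappa> x)"
  shows "(\<integral>x. f x \<partial>lborel) \<le> (\<integral>x. flux p (\<xi> x) \<bullet> \<gamma> x \<partial>lborel)"
proof -
  have \<xi>: "(\<xi> has_derivative X x) (at x)" and cont\<kappa>: "continuous_on UNIV \<kappa>" for x
    using super by (auto simp: strict_supersolution_def)
  have cont\<xi>: "continuous_on UNIV \<xi>" by (rule has_derivative_continuous_on[OF \<xi>])
  have cont\<phi>: "continuous_on UNIV \<phi>" by (rule has_derivative_continuous_on[OF \<phi>])
  define s where "s k = inverse (real (Suc k))" for k
  have s: "s k > 0" "s k \<le> 1" for k by (auto simp: s_def inverse_le_1_iff)
  define N where "N k x = (\<xi> x \<bullet> \<xi> x + (s k)\<^sup>2) powr ((p - 2) / 2)" for k x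
  have Q: "\<xi> x \<bullet> \<xi> x + (s k)\<^sup>2 > 0" for k x using s(1)[of k] by (simp add: add_nonneg_pos)
  have sq: "(y \<bullet> y) powr ((p - 2) / 2) = norm y powr (p - 2)" for y :: 'a
  proof -
    have "y \<bullet> y = norm y powr 2" by (simp add: power2_norm_eq_inner[symmetric])
    moreover have "2 * ((p - 2) / 2) = p - 2" by simp
    ultimately show ?thesis by (simp only: powr_powr)
  qed
  have contN: "continuous_on UNIV (N k)" for k
    unfolding N_def by (intro continuous_on_powr continuous_intros cont\<xi>) (use Q in \<open>auto simp: less_imp_neq[symmetric]\<close>)
  have le: "(\<integral>x. f x \<partial>lborel) \<le> (\<integral>x. N k x * (\<xi> x \<bullet> \<gamma> x) \<partial>lborel)" for k
  proof -
    have "f x \<le> \<phi> x * (N k x * \<kappa> x)" for x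
    proof -
      have "norm (\<xi> x) powr (p - 2) \<le> N k x"
        unfolding sq[symmetric] N_def using p by (intro powr_mono2) auto
      then have "\<phi> x * (norm (\<xi> x) powr (p - 2) * \<kappa> x) \<le> \<phi> x * (N k x * \<kappa> x)"
        using \<phi>0 \<kappa>0 by (intro mult_left_mono mult_right_mono) auto
      then show ?thesis using f(2)[of x] by simp
    qed
    moreover have "integrable lborel (\<lambda>x. \<phi> x * (N k x * \<kappa> x))"
      by (rule integrable_continuous_compact_support[OF _ S(1)]) (auto simp: S intro!: continuous_intros contN cont\<phi> cont\<kappa>)
    ultimately have "(\<integral>x. f x \<partial>lborel) \<le> (\<integral>x. \<phi> x * (N k x * \<kappa> x) \<partial>lborel)"
      using f(1) by (intro integral_mono) auto
    also have "\<dots> \<le> (\<integral>x. N k x * (\<xi> x \<bullet> \<gamma> x) \<partial>lborel)"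
      unfolding N_def by (rule regularised_flux_inequality[OF super s(1) \<phi> \<gamma> \<phi>0 S])
    finally show ?thesis .
  qed
  have "(\<lambda>k. \<integral>x. N k x * (\<xi> x \<bullet> \<gamma> x) \<partial>lborel) \<longlonglongrightarrow> (\<integral>x. flux p (\<xi> x) \<bullet> \<gamma> x \<partial>lborel)"
  proof (rule integral_dominated_convergence[where w = "\<lambda>x. norm (N 0 x * (\<xi> x \<bullet> \<gamma> x))"])
    have "continuous_on UNIV (\<lambda>x. flux p (\<xi> x) \<bullet> \<gamma> x)"
      by (intro continuous_intros \<gamma> continuous_on_compose2[OF continuous_flux[OF p] cont\<xi>]) auto
    then show "(\<lambda>x. flux p (\<xi> x) \<bullet> \<gamma> x) \<in> borel_measurable lborel"
      by (simp add: borel_measurable_continuous_onI)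
    have contN\<gamma>: "continuous_on UNIV (\<lambda>x. N k x * (\<xi> x \<bullet> \<gamma> x))" for k
      by (intro continuous_intros contN cont\<xi> \<gamma>)
    then show "(\<lambda>x. N k x * (\<xi> x \<bullet> \<gamma> x)) \<in> borel_measurable lborel" for k
      by (simp add: borel_measurable_continuous_onI)
    show "integrable lborel (\<lambda>x. norm (N 0 x * (\<xi> x \<bullet> \<gamma> x)))"
      by (intro integrable_norm integrable_continuous_compact_support[OF contN\<gamma> S(1)]) (simp add: S)
    show "AE x in lborel. norm (N k x * (\<xi> x \<bullet> \<gamma> x)) \<le> norm (N 0 x * (\<xi> x \<bullet> \<gamma> x))" for k
    proof (rule AE_I2)
      fix x
      have "(s k)\<^sup>2 \<le> (s 0)\<^sup>2" using s[of k] by (intro power_mono) (auto simp: s_def)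
      then have "N k x \<le> N 0 x"
        unfolding N_def using p Q[of x k] by (intro powr_mono2) auto
      then show "norm (N k x * (\<xi> x \<bullet> \<gamma> x)) \<le> norm (N 0 x * (\<xi> x \<bullet> \<gamma> x))"
        unfolding norm_mult by (intro mult_right_mono) (auto simp: N_def)
    qed
    show "AE x in lborel. (\<lambda>k. N k x * (\<xi> x \<bullet> \<gamma> x)) \<longlonglongrightarrow> flux p (\<xi> x) \<bullet> \<gamma> x"
    proof (rule AE_I2)
      fix x
      show "(\<lambda>k. N k x * (\<xi> x \<bullet> \<gamma> x)) \<longlonglongrightarrow> flux p (\<xi> x) \<bullet> \<gamma> x"
      \<comment> \<open>At a critical point the factor \<open>\<xi> x \<bullet> \<gamma> x\<close>
        vanishes, so the behaviour of the power at base 0 does not matter.\<close>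
      proof (cases "\<xi> x = 0")
        case False
        have "s \<longlonglongrightarrow> 0" unfolding s_def by (rule LIMSEQ_inverse_real_of_nat)
        then have "(\<lambda>k. \<xi> x \<bullet> \<xi> x + (s k)\<^sup>2) \<longlonglongrightarrow> \<xi> x \<bullet> \<xi> x + 0\<^sup>2"
          by (intro tendsto_intros)
        then have "(\<lambda>k. N k x * (\<xi> x \<bullet> \<gamma> x)) \<longlonglongrightarrow> (\<xi> x \<bullet> \<xi> x) powr ((p - 2) / 2) * (\<xi> x \<bullet> \<gamma> x)"
          unfolding N_def using False by (intro tendsto_intros) auto
        then show ?thesis by (simp add: sq flux_def)
      qed (simp add: flux_def)
    qed
  qed
  then show ?thesis
    by (rule LIMSEQ_le_const) (use le in auto)
qed

section \<open>Weak gradients and mollification\<close>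

lemma test_fun_has_derivative:
  assumes "test_fun D \<phi>"
  shows "(\<phi> has_derivative (\<lambda>v. grad \<phi> x \<bullet> v)) (at x)"
proof -
  have d: "(\<phi> has_derivative frechet_derivative \<phi> (at x)) (at x)"
    using assms Ck_Suc_has_derivative unfolding test_fun_def smooth_fun_def by blast
  have "frechet_derivative \<phi> (at x) v = grad \<phi> x \<bullet> v" for v
  proof -
    have "frechet_derivative \<phi> (at x) v = frechet_derivative \<phi> (at x) (\<Sum>b\<in>Basis. (v \<bullet> b) *\<^sub>R b)"
      by (simp add: euclidean_representation)
    also have "\<dots> = (\<Sum>b\<in>Basis. (v \<bullet> b) * frechet_derivative \<phi> (at x) b)"
      using has_derivative_linear[OF d] by (simp add: linear_sum linear_cmul)
    finally show ?thesis
      by (simp add: grad_def inner_sum_right inner_commute[of _ v] mult.commute)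
  qed
  then have "frechet_derivative \<phi> (at x) = (\<lambda>v. grad \<phi> x \<bullet> v)" by (rule ext)
  then show ?thesis using d by simp
qed

lemma grad_unique:
  assumes "(\<phi> has_derivative (\<lambda>v. \<gamma> \<bullet> v)) (at x)"
  shows "grad \<phi> x = \<gamma>"
  using frechet_derivative_at[OF assms, symmetric] by (simp add: grad_def euclidean_representation)

lemma test_fun_continuous:
  assumes "test_fun D \<phi>"
  shows "continuous_on UNIV \<phi>" "continuous_on UNIV (grad \<phi>)"
proof -
  have "Ck (Suc 0) \<phi>" using assms unfolding test_fun_def smooth_fun_def by blast
  then have c: "continuous_on UNIV (\<lambda>x. frechet_derivative \<phi> (at x) v)" for v by simp
  show "continuous_on UNIV (grad \<phi>)"
    unfolding grad_def[abs_def] by (intro continuous_intros c)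
  show "continuous_on UNIV \<phi>"
    by (rule has_derivative_continuous_on[OF test_fun_has_derivative[OF assms]])
qed

lemma test_fun_support:
  assumes "test_fun D \<phi>"
  obtains S where "compact S" "S \<subseteq> D" "\<And>x. x \<notin> S \<Longrightarrow> \<phi> x = 0" "\<And>x. x \<notin> S \<Longrightarrow> grad \<phi> x = 0"
proof -
  define S where "S = closure {x. \<phi> x \<noteq> 0}"
  have S: "compact S" "S \<subseteq> D" using assms by (auto simp: test_fun_def S_def)
  have \<phi>0: "\<phi> x = 0" if "x \<notin> S" for x
    using that closure_subset[of "{x. \<phi> x \<noteq> 0}"] by (auto simp: S_def)
  have "grad \<phi> x = 0" if "x \<notin> S" for x
  proof (rule grad_unique)
    have "((\<lambda>_. 0) has_derivative (\<lambda>v. 0)) (at x)" by simp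
    then show "(\<phi> has_derivative (\<lambda>v. 0 \<bullet> v)) (at x)"
      unfolding inner_zero_left
      by (rule has_derivative_transform_within_open[OF _ open_Compl[OF compact_imp_closed[OF S(1)]]])
        (use that \<phi>0 in auto)
  qed
  then show ?thesis using that S \<phi>0 by blast
qed

text \<open>The Sobolev notions are phrased over \<open>lebesgue\<close>, whereas translations and
  Tonelli are applied over \<open>lborel\<close>; a Borel version of the weak gradient bridges the
  two. It is built coordinate by coordinate.\<close>

lemma lebesgue_borel_representative:
  fixes f :: "'a::euclidean_space \<Rightarrow> 'b::euclidean_space"
  assumes "f \<in> borel_measurable lebesgue"
  obtains g where "g \<in> borel_measurable borel" "AE x in lborel. f x = g x"
proof -
  have "\<exists>g\<in>borel_measurable lborel. AE x in lborel. f x \<bullet> b = g x" for b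
    by (rule completion_ex_borel_measurable_real) (use assms in measurable)
  then obtain g where g: "\<And>b. g b \<in> borel_measurable lborel" "\<And>b. AE x in lborel. f x \<bullet> b = g b x"
    by metis
  define G where "G x = (\<Sum>b\<in>Basis. g b x *\<^sub>R b)" for x
  have "G \<in> borel_measurable borel"
    unfolding G_def using g(1) by (intro borel_measurable_sum borel_measurable_scaleR) (auto)
  moreover have "AE x in lborel. \<forall>b\<in>Basis. f x \<bullet> b = g b x"
    using g(2) by (intro AE_finite_allI) auto
  then have "AE x in lborel. f x = G x"
  proof eventually_elim
    case (elim x)
    have "f x = (\<Sum>b\<in>Basis. (f x \<bullet> b) *\<^sub>R b)" by (simp add: euclidean_representation)
    then show ?case using elim by (simp add: G_def)
  qed
  ultimately show ?thesis using that by blast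
qed

lemma integral_lebesgue_eq_lborel:
  fixes f g :: "'a::euclidean_space \<Rightarrow> 'b::euclidean_space"
  assumes "g \<in> borel_measurable borel" "AE x in lborel. f x = g x"
  shows "(\<integral>x. f x \<partial>lebesgue) = (\<integral>x. g x \<partial>lborel)"
proof -
  have m: "g \<in> borel_measurable lebesgue"
    using assms(1) by (intro measurable_completion) simp
  have ae: "AE x in lebesgue. g x = f x"
    by (rule AE_completion, rule eventually_mono[OF assms(2)]) simp
  have "f \<in> borel_measurable lebesgue"
    by (rule borel_measurable_AE[OF m ae])
  then have "(\<integral>x. f x \<partial>lebesgue) = (\<integral>x. g x \<partial>lebesgue)"
    using m ae by (intro integral_cong_AE) auto
  also have "\<dots> = (\<integral>x. g x \<partial>lborel)"
    using assms(1) by (intro integral_completion) simp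
  finally show ?thesis .
qed

text \<open>The representative is taken of the gradient multiplied by the indicator of
  \<open>D\<close>, so integrals involving \<open>g\<close> extend over the whole space. The
  indicator stays next to \<open>h\<close>, which is continuous, and hence known to be measurable,
  on \<open>D\<close> alone.\<close>

lemma p_harmonic_borel_gradient:
  fixes h :: "'a::euclidean_space \<Rightarrow> real"
  assumes D: "open D" and ph: "p_harmonic p D h"
  obtains g where "g \<in> borel_measurable borel"
    "\<And>C. compact C \<Longrightarrow> C \<subseteq> D \<Longrightarrow> (\<integral>\<^sup>+x. ennreal (indicator C x * norm (g x) powr p) \<partial>lborel) < \<infinity>"
    "\<And>\<phi>. test_fun D \<phi> \<Longrightarrow> (\<integral>x. indicator D x *\<^sub>R (h x *\<^sub>R grad \<phi> x) \<partial>lborel) = - (\<integral>x. \<phi> x *\<^sub>R g x \<partial>lborel)"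
    "\<And>\<phi>. test_fun D \<phi> \<Longrightarrow> (\<integral>x. flux p (g x) \<bullet> grad \<phi> x \<partial>lborel) = 0"
proof -
  obtain g0 where cont: "continuous_on D h" and lp: "Lp_loc p D g0" and wg: "weak_grad D h g0"
    and eq: "\<And>\<phi>. test_fun D \<phi> \<Longrightarrow> (LINT x:D|lebesgue. norm (g0 x) powr (p - 2) * (g0 x \<bullet> grad \<phi> x)) = 0"
    using ph by (auto simp: p_harmonic_def sobolev_loc_def)
  obtain g where g[measurable]: "g \<in> borel_measurable borel"
    and ae: "AE x in lborel. indicator D x *\<^sub>R g0 x = g x"
    using lebesgue_borel_representative[of "\<lambda>x. indicator D x *\<^sub>R g0 x"] lp
    unfolding Lp_loc_def set_borel_measurable_def by blast
  have [measurable]: "D \<in> sets borel" using D by simp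
  show ?thesis
  proof
    show "g \<in> borel_measurable borel" by (rule g)
    show "(\<integral>\<^sup>+x. ennreal (indicator C x * norm (g x) powr p) \<partial>lborel) < \<infinity>" if C: "compact C" "C \<subseteq> D" for C
    proof -
      have "integrable lebesgue (\<lambda>x. indicator C x *\<^sub>R norm (g0 x) powr p)"
        using lp C by (auto simp: Lp_loc_def set_integrable_def)
      then have "(\<integral>\<^sup>+x. ennreal (norm (indicator C x *\<^sub>R norm (g0 x) powr p)) \<partial>lebesgue) < \<infinity>"
        by (simp add: integrable_iff_bounded)
      then have "(\<integral>\<^sup>+x. ennreal (norm (indicator C x *\<^sub>R norm (g0 x) powr p)) \<partial>lborel) < \<infinity>"
        by (simp only: nn_integral_completion)
      moreover have "(\<integral>\<^sup>+x. ennreal (norm (indicator C x *\<^sub>R norm (g0 x) powr p)) \<partial>lborel)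
          = (\<integral>\<^sup>+x. ennreal (indicator C x * norm (g x) powr p) \<partial>lborel)"
      proof (rule nn_integral_cong_AE)
        show "AE x in lborel. ennreal (norm (indicator C x *\<^sub>R norm (g0 x) powr p)) = ennreal (indicator C x * norm (g x) powr p)"
          using ae by eventually_elim (use C in \<open>auto simp: indicator_def\<close>)
      qed
      ultimately show ?thesis by simp
    qed
  next
    fix \<phi> assume t: "test_fun D \<phi>"
    note [measurable] = borel_measurable_continuous_onI[OF test_fun_continuous(1)[OF t]]
      borel_measurable_continuous_onI[OF test_fun_continuous(2)[OF t]]
    obtain S where S: "compact S" "S \<subseteq> D" "\<And>x. x \<notin> S \<Longrightarrow> \<phi> x = 0" "\<And>x. x \<notin> S \<Longrightarrow> grad \<phi> x = 0"
      by (rule test_fun_support[OF t]) (rule that)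
    have "(LINT x:D|lebesgue. h x *\<^sub>R grad \<phi> x) = (\<integral>x. indicator D x *\<^sub>R (h x *\<^sub>R grad \<phi> x) \<partial>lborel)"
      unfolding set_lebesgue_integral_def
    proof (rule integral_lebesgue_eq_lborel)
      have "(\<lambda>x. indicator D x *\<^sub>R (h x *\<^sub>R grad \<phi> x)) = (\<lambda>x. (indicator D x *\<^sub>R h x) *\<^sub>R grad \<phi> x)"
        by auto
      moreover have [measurable]: "(\<lambda>x. indicator D x *\<^sub>R h x) \<in> borel_measurable borel"
        using borel_measurable_continuous_on_indicator[of D h] cont by simp
      ultimately show "(\<lambda>x. indicator D x *\<^sub>R (h x *\<^sub>R grad \<phi> x)) \<in> borel_measurable borel"
        by simp
    qed simp
    moreover have "(LINT x:D|lebesgue. \<phi> x *\<^sub>R g0 x) = (\<integral>x. \<phi> x *\<^sub>R g x \<partial>lborel)"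
      unfolding set_lebesgue_integral_def
    proof (rule integral_lebesgue_eq_lborel)
      show "AE x in lborel. indicator D x *\<^sub>R \<phi> x *\<^sub>R g0 x = \<phi> x *\<^sub>R g x"
        using ae by eventually_elim (metis scaleR_left_commute)
    qed measurable
    ultimately show "(\<integral>x. indicator D x *\<^sub>R (h x *\<^sub>R grad \<phi> x) \<partial>lborel) = - (\<integral>x. \<phi> x *\<^sub>R g x \<partial>lborel)"
      using wg t unfolding weak_grad_def by metis
    have "(LINT x:D|lebesgue. norm (g0 x) powr (p - 2) * (g0 x \<bullet> grad \<phi> x)) = (\<integral>x. flux p (g x) \<bullet> grad \<phi> x \<partial>lborel)"
      unfolding set_lebesgue_integral_def
    proof (rule integral_lebesgue_eq_lborel)
      show "AE x in lborel. indicator D x *\<^sub>R (norm (g0 x) powr (p - 2) * (g0 x \<bullet> grad \<phi> x)) = flux p (g x) \<bullet> grad \<phi> x"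
        using ae by eventually_elim (use S in \<open>auto simp: flux_def indicator_def\<close>)
    qed (unfold flux_def, measurable)
    then show "(\<integral>x. flux p (g x) \<bullet> grad \<phi> x \<partial>lborel) = 0"
      using eq[OF t] by simp
  qed
qed

text \<open>On a set of finite measure lower powers are integrable too, because r^q is at most 1 +
  r^p. It serves for \<open>q = 1\<close>, the gradient itself, and \<open>q = p - 1\<close>, its
  flux.\<close>

lemma integrable_of_local_powr_bound:
  fixes f :: "'a::euclidean_space \<Rightarrow> 'b::euclidean_space" and g :: "'a \<Rightarrow> 'c::euclidean_space"
  assumes g[measurable]: "g \<in> borel_measurable borel" and C: "compact C"
    and fin: "(\<integral>\<^sup>+x. ennreal (indicator C x * norm (g x) powr p) \<partial>lborel) < \<infinity>"
    and q: "0 \<le> q" "q \<le> p" and f: "f \<in> borel_measurable borel"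
    and M: "M \<ge> 0" and le: "\<And>x. norm (f x) \<le> M * (indicator C x * norm (g x) powr q)"
  shows "integrable lborel f"
proof (rule Bochner_Integration.integrable_bound)
  have [measurable]: "C \<in> sets borel" using C by (simp add: compact_imp_closed)
  have "integrable lborel (indicator C :: 'a \<Rightarrow> real)"
    using emeasure_bounded_finite[OF compact_imp_bounded[OF C]] by (intro integrable_real_indicator) auto
  moreover have "integrable lborel (\<lambda>x. indicator C x * norm (g x) powr p)"
    using fin by (intro integrableI_bounded) (auto simp: indicator_def)
  ultimately show "integrable lborel (\<lambda>x. M * (indicator C x + indicator C x * norm (g x) powr p))"
    by (intro integrable_mult_right Bochner_Integration.integrable_add)
  show "AE x in lborel. norm (f x) \<le> norm (M * (indicator C x + indicator C x * norm (g x) powr p))"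
  proof (rule AE_I2)
    fix x
    have "norm (g x) powr q \<le> 1 + norm (g x) powr p"
    proof (cases "norm (g x) \<le> 1")
      case True
      then have "norm (g x) powr q \<le> 1" using q(1) by (intro powr_le1) auto
      then show ?thesis by (simp add: add_increasing2)
    next
      case False
      then have "norm (g x) powr q \<le> norm (g x) powr p" using q(2) by (intro powr_mono) auto
      then show ?thesis by simp
    qed
    then have "M * (indicator C x * norm (g x) powr q) \<le> M * (indicator C x * (1 + norm (g x) powr p))"
      using M by (intro mult_left_mono) auto
    with le[of x] show "norm (f x) \<le> norm (M * (indicator C x + indicator C x * norm (g x) powr p))"
      using M by (simp add: algebra_simps abs_of_nonneg add_nonneg_nonneg)
  qed
qed (use f in simp)

section \<open>Mollifiers\<close>

definition mollifier :: "real \<Rightarrow> 'a::euclidean_space \<Rightarrow> real" where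
  "mollifier \<epsilon> z = inverse (\<integral>x. bump \<epsilon> (0::'a) x \<partial>lborel) * bump \<epsilon> 0 z"

lemma mollifier_nonneg [simp]: "mollifier \<epsilon> z \<ge> 0"
  by (simp add: mollifier_def Bochner_Integration.integral_nonneg)

lemma mollifier_minus: "mollifier \<epsilon> (- z) = mollifier \<epsilon> z"
  by (simp add: mollifier_def bump_def)

lemma mollifier_diff_commute: "mollifier \<epsilon> (x - y) = mollifier \<epsilon> (y - x)"
  using mollifier_minus[of \<epsilon> "y - x"] by simp

lemma mollifier_eq_0: "\<epsilon> > 0 \<Longrightarrow> norm z \<ge> \<epsilon> \<Longrightarrow> mollifier \<epsilon> z = 0"
  by (simp add: mollifier_def bump_eq_0_iff)

lemma Ck_mollifier: "Ck k (mollifier \<epsilon>)"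
  unfolding mollifier_def[abs_def] by (intro Ck_mult Ck_const Ck_bump)

lemma mollifier_integral:
  assumes "\<epsilon> > 0"
  shows "integrable lborel (mollifier \<epsilon> :: 'a::euclidean_space \<Rightarrow> real)"
    and "(\<integral>z. mollifier \<epsilon> z \<partial>(lborel :: 'a measure)) = 1"
  using bump_integral_pos[OF assms, of "0::'a"] by (auto simp: mollifier_def[abs_def])

lemma mollifier_integral_translate:
  fixes x :: "'a::euclidean_space"
  assumes "\<epsilon> > 0"
  shows "integrable lborel (\<lambda>y. mollifier \<epsilon> (y - x))" "(\<integral>y. mollifier \<epsilon> (y - x) \<partial>lborel) = 1"
proof -
  note i = mollifier_integral[OF assms, where 'a = 'a]
  show "integrable lborel (\<lambda>y. mollifier \<epsilon> (y - x))"
    using lborel_translation_invariant(1)[OF i(1), of "- x"] by simp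
  show "(\<integral>y. mollifier \<epsilon> (y - x) \<partial>lborel) = 1"
    using lborel_translation_invariant(2)[of "mollifier \<epsilon>" "- x"] i
      borel_measurable_continuous_onI[OF Ck_imp_continuous[OF Ck_mollifier]] by simp
qed

lemma test_fun_mollifier:
  assumes "\<epsilon> > 0" and "cball x \<epsilon> \<subseteq> D"
  shows "test_fun D (\<lambda>y. mollifier \<epsilon> (y - x))"
proof -
  define c where "c = inverse (\<integral>x. bump \<epsilon> (0::'a) x \<partial>lborel)"
  have c: "c > 0" using bump_integral_pos(2)[OF assms(1)] by (simp add: c_def)
  have "(\<lambda>y. mollifier \<epsilon> (y - x)) = (\<lambda>y. c * bump \<epsilon> x y)"
    by (auto simp: mollifier_def c_def bump_def)
  moreover have "test_fun D (\<lambda>y. c * bump \<epsilon> x y)"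
    using test_fun_bump[OF assms] c by (simp add: test_fun_def smooth_fun_def Ck_mult Ck_const)
  ultimately show ?thesis by simp
qed

lemma continuous_mollifier_compose [continuous_intros]:
  "continuous_on S f \<Longrightarrow> continuous_on S (\<lambda>x. mollifier \<epsilon> (f x))"
  using continuous_on_compose2[OF Ck_imp_continuous[OF Ck_mollifier], of S f] by auto

text \<open>The kernel has mass 1, so the difference is an average of \<open>u y - u x\<close> over
  a ball of radius \<open>\<epsilon>\<close>.\<close>

lemma convolution_mollifier_close:
  fixes u :: "'a::euclidean_space \<Rightarrow> real"
  assumes \<epsilon>: "\<epsilon> > 0" and u: "continuous_on UNIV u" "compact C" "\<And>x. x \<notin> C \<Longrightarrow> u x = 0"
    and osc: "\<And>y. dist x y \<le> \<epsilon> \<Longrightarrow> \<bar>u y - u x\<bar> \<le> \<sigma>"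
  shows "\<bar>(\<integral>y. mollifier \<epsilon> (x - y) * u y \<partial>lborel) - u x\<bar> \<le> \<sigma>"
proof -
  note i = mollifier_integral_translate[OF \<epsilon>, of x]
  have "integrable lborel (\<lambda>y. mollifier \<epsilon> (y - x) * u y)"
    by (rule integrable_continuous_compact_support[OF _ u(2)]) (auto simp: u(3) intro!: continuous_intros u(1))
  then have i2: "integrable lborel (\<lambda>y. mollifier \<epsilon> (y - x) * (u y - u x))"
    and e: "(\<integral>y. mollifier \<epsilon> (y - x) * (u y - u x) \<partial>lborel) = (\<integral>y. mollifier \<epsilon> (y - x) * u y \<partial>lborel) - u x"
    using i by (simp_all add: right_diff_distrib)
  have "norm (\<integral>y. mollifier \<epsilon> (y - x) * (u y - u x) \<partial>lborel) \<le> (\<integral>y. norm (mollifier \<epsilon> (y - x) * (u y - u x)) \<partial>lborel)"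
    by (rule integral_norm_bound)
  also have "\<dots> \<le> (\<integral>y. mollifier \<epsilon> (y - x) * \<sigma> \<partial>lborel)"
  proof (rule integral_mono)
    show "norm (mollifier \<epsilon> (y - x) * (u y - u x)) \<le> mollifier \<epsilon> (y - x) * \<sigma>" for y
    proof (cases "dist x y \<le> \<epsilon>")
      case True
      then show ?thesis using osc by (simp add: abs_mult mult_left_mono)
    next
      case False
      then show ?thesis using mollifier_eq_0[OF \<epsilon>, of "y - x"] by (simp add: dist_norm norm_minus_commute)
    qed
  qed (use i i2 in auto)
  also have "\<dots> = \<sigma>" using i by simp
  finally show ?thesis unfolding e by (simp add: mollifier_diff_commute)
qed

text \<open>The weak gradient identity is assumed only for the kernel centred at this
  \<open>x\<close>. That locality is essential later, where \<open>G\<close> represents the gradient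
  of \<open>u\<close> only on a region inside \<open>D\<close>. The sign comes from exchanging
  derivatives in \<open>x\<close> and \<open>y\<close>.\<close>

lemma convolution_mollifier_has_derivative:
  fixes u :: "'a::euclidean_space \<Rightarrow> real"
  assumes \<epsilon>: "\<epsilon> > 0" and u: "continuous_on UNIV u" "compact C" "\<And>x. x \<notin> C \<Longrightarrow> u x = 0"
    and G: "\<And>v. (\<integral>y. (grad (\<lambda>y. mollifier \<epsilon> (y - x)) y \<bullet> v) * u y \<partial>lborel)
        = - (\<integral>y. mollifier \<epsilon> (y - x) * (G y \<bullet> v) \<partial>lborel)"
  shows "((\<lambda>x. \<integral>y. mollifier \<epsilon> (x - y) * u y \<partial>lborel) has_derivative
      (\<lambda>v. \<integral>y. mollifier \<epsilon> (y - x) * (G y \<bullet> v) \<partial>lborel)) (at x)"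
proof -
  have t: "test_fun UNIV (mollifier \<epsilon> :: 'a \<Rightarrow> real)"
    using test_fun_mollifier[OF \<epsilon>, of 0 UNIV] by simp
  note d = test_fun_has_derivative[OF t]
  have d1: "((\<lambda>x. \<integral>y. mollifier \<epsilon> (x - y) * u y \<partial>lborel) has_derivative
      (\<lambda>v. \<integral>y. (grad (mollifier \<epsilon>) (x - y) \<bullet> v) * u y \<partial>lborel)) (at x)"
    by (rule convolution_has_derivative[OF d _ u]) (intro continuous_intros test_fun_continuous[OF t])
  have "grad (\<lambda>y. mollifier \<epsilon> (y - x)) y = - grad (mollifier \<epsilon>) (x - y)" for y
  proof (rule grad_unique)
    have "((\<lambda>y. mollifier \<epsilon> (x - y)) has_derivative (\<lambda>v. grad (mollifier \<epsilon>) (x - y) \<bullet> (- v))) (at y)"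
      by (rule has_derivative_compose[OF _ d]) (auto intro!: derivative_eq_intros)
    then show "((\<lambda>y. mollifier \<epsilon> (y - x)) has_derivative (\<lambda>v. - grad (mollifier \<epsilon>) (x - y) \<bullet> v)) (at y)"
      unfolding mollifier_diff_commute[of \<epsilon> x] by simp
  qed
  then have "(\<integral>y. (grad (mollifier \<epsilon>) (x - y) \<bullet> v) * u y \<partial>lborel) = (\<integral>y. mollifier \<epsilon> (y - x) * (G y \<bullet> v) \<partial>lborel)" for v
    using G[of v] by simp
  then show ?thesis using d1 by simp
qed

section \<open>The comparison principle\<close>

text \<open>\<open>ennreal (- f x)\<close> is 0 wherever \<open>f\<close> is nonnegative, so the
  hypothesis bounds the negative part; this is the form in which the mollification error
  arrives.\<close>

lemma integral_bounded_below:
  fixes f :: "'a \<Rightarrow> real"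
  assumes f: "integrable M f" and le: "(\<integral>\<^sup>+x. ennreal (- f x) \<partial>M) \<le> ennreal c" and c: "c \<ge> 0"
  shows "- c \<le> (\<integral>x. f x \<partial>M)"
proof -
  have m: "integrable M (\<lambda>x. max 0 (- f x))" using f by simp
  have "- (\<integral>x. f x \<partial>M) = (\<integral>x. - f x \<partial>M)" by simp
  also have "\<dots> \<le> (\<integral>x. max 0 (- f x) \<partial>M)"
    using f m by (intro integral_mono) auto
  also have "\<dots> \<le> c"
  proof -
    have "ennreal (\<integral>x. max 0 (- f x) \<partial>M) = (\<integral>\<^sup>+x. ennreal (max 0 (- f x)) \<partial>M)"
      using m by (intro nn_integral_eq_integral[symmetric]) auto
    also have "\<dots> \<le> ennreal c" using le by (simp add: ennreal_max_0)
    finally show ?thesis using c by (simp add: ennreal_le_iff)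
  qed
  finally show ?thesis by simp
qed

text \<open>With s = 1/t this is s^2 \<le> 2 exp(s). Since \<open>exp_flat 2\<close> is the
  derivative of \<open>exp_flat 0\<close>, the gradient of the test function is at most twice that
  of the mollification.\<close>

lemma exp_flat_2_le: "exp_flat 2 t \<le> 2"
proof (cases "t > 0")
  case True
  define s where "s = 1 / t"
  have s: "s > 0" using True by (simp add: s_def)
  have "exp_flat 2 t = exp (- s) * s\<^sup>2"
    using True by (simp add: exp_flat_def s_def power_divide)
  also have "\<dots> \<le> exp (- s) * (2 * exp s)"
    using exp_lower_Taylor_quadratic[of s] s by (intro mult_left_mono) auto
  also have "\<dots> = 2" by (simp add: exp_minus)
  finally show ?thesis .
qed (simp add: exp_flat_def)

text \<open>\<open>u\<close> has to agree with \<open>h - w\<close> only on the support of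
  \<open>\<phi>\<close>. Hence, for test functions supported where the difference is positive, no
  chain rule for the positive part is required.\<close>

lemma weak_gradient_difference:
  fixes h w u :: "'a::euclidean_space \<Rightarrow> real"
  assumes D: "open D" and h: "continuous_on D h"
    and g[measurable]: "g \<in> borel_measurable borel" and p: "p \<ge> 1"
    and fin: "\<And>C. compact C \<Longrightarrow> C \<subseteq> D \<Longrightarrow> (\<integral>\<^sup>+x. ennreal (indicator C x * norm (g x) powr p) \<partial>lborel) < \<infinity>"
    and weak: "(\<integral>x. indicator D x *\<^sub>R (h x *\<^sub>R grad \<phi> x) \<partial>lborel) = - (\<integral>x. \<phi> x *\<^sub>R g x \<partial>lborel)"
    and w: "\<And>x. (w has_derivative (\<lambda>v. \<xi> x \<bullet> v)) (at x)" and \<xi>: "continuous_on UNIV \<xi>"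
    and t: "test_fun D \<phi>"
    and S: "compact S" "S \<subseteq> D" "\<And>x. x \<notin> S \<Longrightarrow> \<phi> x = 0" "\<And>x. x \<notin> S \<Longrightarrow> grad \<phi> x = 0"
    and u: "\<And>x. x \<in> S \<Longrightarrow> u x = h x - w x"
  shows "(\<integral>x. (grad \<phi> x \<bullet> v) * u x \<partial>lborel) = - (\<integral>x. \<phi> x * ((g x - \<xi> x) \<bullet> v) \<partial>lborel)"
proof -
  note \<phi> = test_fun_has_derivative[OF t] and cont\<phi> = test_fun_continuous[OF t]
  have contw: "continuous_on UNIV w" by (rule has_derivative_continuous_on[OF w])
  have ih: "integrable lborel (\<lambda>x. indicator D x *\<^sub>R (h x *\<^sub>R grad \<phi> x))"
  proof -
    have "integrable lborel (\<lambda>x. indicator S x *\<^sub>R (h x *\<^sub>R grad \<phi> x))"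
      using S cont\<phi> h by (intro borel_integrable_compact continuous_intros) (auto intro: continuous_on_subset)
    moreover have "(\<lambda>x. indicator S x *\<^sub>R (h x *\<^sub>R grad \<phi> x)) = (\<lambda>x. indicator D x *\<^sub>R (h x *\<^sub>R grad \<phi> x))"
      using S by (auto simp: indicator_def fun_eq_iff)
    ultimately show ?thesis by simp
  qed
  have ig: "integrable lborel (\<lambda>x. \<phi> x *\<^sub>R g x)"
  proof -
    have "bounded (\<phi> ` S)"
      using S(1) cont\<phi>(1) by (meson compact_continuous_image compact_imp_bounded continuous_on_subset top_greatest)
    then obtain M where M: "M > 0" "\<And>x. x \<in> S \<Longrightarrow> \<bar>\<phi> x\<bar> \<le> M" unfolding bounded_pos by auto
    have [measurable]: "\<phi> \<in> borel_measurable borel" by (rule borel_measurable_continuous_onI[OF cont\<phi>(1)])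
    show ?thesis
    proof (rule integrable_of_local_powr_bound[OF g S(1) fin[OF S(1,2)], of 1])
      show "norm (\<phi> x *\<^sub>R g x) \<le> M * (indicator S x * norm (g x) powr 1)" for x
        using M S(3)[of x] by (cases "x \<in> S") (auto intro: mult_right_mono)
    qed (use p M in auto)
  qed
  have iw: "integrable lborel (\<lambda>x. w x * (grad \<phi> x \<bullet> v))" and i\<xi>: "integrable lborel (\<lambda>x. \<phi> x * (\<xi> x \<bullet> v))"
    by (rule integrable_continuous_compact_support[OF _ S(1)];
        auto simp: S intro!: continuous_intros cont\<phi> contw \<xi>)+
  have "(\<integral>x. w x * (grad \<phi> x \<bullet> v) + (\<xi> x \<bullet> v) * \<phi> x \<partial>lborel) = 0"
    by (rule integral_directional_derivative_eq_0[where f = "\<lambda>x. w x * \<phi> x" and C = S])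
      (auto simp: S intro!: has_derivative_mult w \<phi> continuous_intros cont\<phi> contw \<xi>)
  then have ew: "(\<integral>x. w x * (grad \<phi> x \<bullet> v) \<partial>lborel) = - (\<integral>x. \<phi> x * (\<xi> x \<bullet> v) \<partial>lborel)"
    using iw i\<xi> by (simp add: mult.commute)
  have "(\<integral>x. (indicator D x *\<^sub>R (h x *\<^sub>R grad \<phi> x)) \<bullet> v \<partial>lborel) = - (\<integral>x. (\<phi> x *\<^sub>R g x) \<bullet> v \<partial>lborel)"
    by (simp only: integral_inner_left[OF ih] integral_inner_left[OF ig] weak inner_minus_left)
  then have eh: "(\<integral>x. (indicator D x *\<^sub>R (h x *\<^sub>R grad \<phi> x)) \<bullet> v \<partial>lborel) = - (\<integral>x. \<phi> x * (g x \<bullet> v) \<partial>lborel)"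
    by simp
  have igv: "integrable lborel (\<lambda>x. \<phi> x * (g x \<bullet> v))"
    using integrable_inner_left[of v lborel, OF ig] by simp
  have ihv: "integrable lborel (\<lambda>x. (indicator D x *\<^sub>R (h x *\<^sub>R grad \<phi> x)) \<bullet> v)"
    using ih by (intro integrable_inner_left)
  have "(\<integral>x. (grad \<phi> x \<bullet> v) * u x \<partial>lborel)
      = (\<integral>x. (indicator D x *\<^sub>R (h x *\<^sub>R grad \<phi> x)) \<bullet> v - w x * (grad \<phi> x \<bullet> v) \<partial>lborel)"
  proof (rule Bochner_Integration.integral_cong[OF refl])
    fix x
    show "(grad \<phi> x \<bullet> v) * u x = (indicator D x *\<^sub>R (h x *\<^sub>R grad \<phi> x)) \<bullet> v - w x * (grad \<phi> x \<bullet> v)"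
    proof (cases "x \<in> S")
      case True
      then show ?thesis using S(2) by (auto simp: u[OF True] left_diff_distrib mult.commute)
    qed (simp add: S(4))
  qed
  also have "\<dots> = - (\<integral>x. \<phi> x * (g x \<bullet> v) \<partial>lborel) + (\<integral>x. \<phi> x * (\<xi> x \<bullet> v) \<partial>lborel)"
    using ihv iw eh ew by simp
  also have "\<dots> = - (\<integral>x. \<phi> x * ((g x - \<xi> x) \<bullet> v) \<partial>lborel)"
    using igv i\<xi> by (simp add: inner_diff_left right_diff_distrib)
  finally show ?thesis .
qed

lemma mollified_gradient_error:
  fixes G :: "'a::euclidean_space \<Rightarrow> 'a"
  assumes \<epsilon>: "\<epsilon> > 0" and i: "integrable lborel (\<lambda>y. mollifier \<epsilon> (y - x) *\<^sub>R G y)"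
  shows "ennreal (norm (G x - (\<integral>y. mollifier \<epsilon> (y - x) *\<^sub>R G y \<partial>lborel)))
    \<le> (\<integral>\<^sup>+y. ennreal (mollifier \<epsilon> (y - x) * norm (G x - G y)) \<partial>lborel)"
proof -
  note m = mollifier_integral_translate[OF \<epsilon>, of x]
  have i2: "integrable lborel (\<lambda>y. mollifier \<epsilon> (y - x) *\<^sub>R G x)" using m by simp
  have "(\<integral>y. mollifier \<epsilon> (y - x) *\<^sub>R (G x - G y) \<partial>lborel) = G x - (\<integral>y. mollifier \<epsilon> (y - x) *\<^sub>R G y \<partial>lborel)"
    unfolding scaleR_diff_right using i i2 m by simp
  moreover have "integrable lborel (\<lambda>y. mollifier \<epsilon> (y - x) *\<^sub>R (G x - G y))"
    unfolding scaleR_diff_right using i i2 by simp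
  then have "ennreal (norm (\<integral>y. mollifier \<epsilon> (y - x) *\<^sub>R (G x - G y) \<partial>lborel))
      \<le> (\<integral>\<^sup>+y. ennreal (norm (mollifier \<epsilon> (y - x) *\<^sub>R (G x - G y))) \<partial>lborel)"
    by (rule integral_norm_bound_ennreal)
  ultimately show ?thesis by simp
qed

text \<open>A gradient vanishing on an open set has zero derivative there, which contradicts the
  trace condition at \<open>z = 0\<close>. For \<open>p > 2\<close> this is needed because the
  weight \<open>norm (\<xi> x) powr (p - 2)\<close> degenerates at critical points.\<close>

lemma strict_supersolution_gradient_nonzero:
  assumes super: "strict_supersolution p w \<xi> X \<kappa>" and "\<kappa> x > 0" and "open U" "x \<in> U"
  obtains x' where "x' \<in> U" "\<xi> x' \<noteq> 0"
proof -
  have "\<exists>x'\<in>U. \<xi> x' \<noteq> 0"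
  proof (rule ccontr)
    assume "\<not> (\<exists>x'\<in>U. \<xi> x' \<noteq> 0)"
    then have z: "\<And>x'. x' \<in> U \<Longrightarrow> 0 = \<xi> x'" by auto
    have "((\<lambda>_. 0) has_derivative (\<lambda>_. 0)) (at x)" by simp
    then have "(\<xi> has_derivative (\<lambda>_. 0)) (at x)"
      by (rule has_derivative_transform_within_open[OF _ assms(3,4) z])
    moreover have "(\<xi> has_derivative X x) (at x)"
      using super by (simp add: strict_supersolution_def)
    ultimately have X0: "X x = (\<lambda>_. 0)" by (rule has_derivative_unique[symmetric])
    have "norm (0::'a) \<le> 1 \<longrightarrow> (\<Sum>b\<in>Basis. X x b \<bullet> b) + (p - 2) * (X x 0 \<bullet> 0) \<le> - \<kappa> x"
      using super unfolding strict_supersolution_def by blast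
    then show False using \<open>\<kappa> x > 0\<close> X0 by simp
  qed
  then show ?thesis using that by blast
qed

lemma uniform_continuity_compact_support:
  fixes u :: "'a::euclidean_space \<Rightarrow> real"
  assumes u: "continuous_on UNIV u" "compact C" "\<And>x. x \<notin> C \<Longrightarrow> u x = 0" and \<sigma>: "\<sigma> > 0"
  obtains d where "d > 0" "\<And>x y. dist x y < d \<Longrightarrow> \<bar>u y - u x\<bar> < \<sigma>"
proof -
  obtain R where R: "\<And>x. x \<in> C \<Longrightarrow> norm x \<le> R"
    using u(2) compact_imp_bounded bounded_iff by metis
  have "uniformly_continuous_on (cball 0 (R + 1)) u"
    by (intro compact_uniformly_continuous continuous_on_subset[OF u(1)]) auto
  then obtain d where d: "d > 0"
    "\<And>x y. x \<in> cball 0 (R + 1) \<Longrightarrow> y \<in> cball 0 (R + 1) \<Longrightarrow> dist y x < d \<Longrightarrow> dist (u y) (u x) < \<sigma>"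
    using \<sigma> unfolding uniformly_continuous_on_def by metis
  have "\<bar>u y - u x\<bar> < \<sigma>" if xy: "dist x y < min 1 d" for x y
  proof (cases "x \<in> C \<or> y \<in> C")
    case True
    have "norm (x - y) < 1" using xy by (simp add: dist_norm)
    then have "norm x \<le> R + 1 \<and> norm y \<le> R + 1"
      using True R[of x] R[of y] norm_triangle_ineq2[of x y] norm_triangle_ineq3[of x y] by linarith
    then show ?thesis using d(2)[of x y] xy by (simp add: dist_real_def dist_commute)
  next
    case False
    then show ?thesis using u(3) \<sigma> by simp
  qed
  then show ?thesis using that[of "min 1 d"] d(1) by simp
qed

text \<open>Test both inequalities with \<open>exp_flat 0 (u' - \<tau>)\<close>, where \<open>u'\<close> is a mollification of \<open>u = max 0 (h - w)\<close>;
  up to the mollification error, monotonicity of the flux contradicts the strictness of \<open>w\<close>.\<close>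
lemma comparison_principle:
  fixes h w :: "'a::euclidean_space \<Rightarrow> real"
  assumes p: "p \<ge> 2" and super: "strict_supersolution p w \<xi> X \<kappa>" and \<kappa>0: "\<And>x. \<kappa> x > 0"
    and D: "open D" "compact (closure D)" and conth: "continuous_on (closure D) h"
    and ph: "p_harmonic p D h" and bd: "\<And>x. x \<in> frontier D \<Longrightarrow> h x \<le> w x"
    and x0: "x0 \<in> D"
  shows "h x0 \<le> w x0"
proof (rule ccontr)
  assume "\<not> h x0 \<le> w x0"
  then have neg: "h x0 > w x0" by simp
  have w: "(w has_derivative (\<lambda>v. \<xi> x \<bullet> v)) (at x)" and d\<xi>: "(\<xi> has_derivative X x) (at x)"
    and cont\<kappa>: "continuous_on UNIV \<kappa>" for x
    using super by (auto simp: strict_supersolution_def)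
  have contw: "continuous_on UNIV w" by (rule has_derivative_continuous_on[OF w])
  have cont\<xi>: "continuous_on UNIV \<xi>" by (rule has_derivative_continuous_on[OF d\<xi>])
  note [measurable] = borel_measurable_continuous_onI[OF cont\<xi>]
  have [measurable]: "flux p \<in> borel_measurable (borel :: 'a measure)"
    by (rule borel_measurable_continuous_onI[OF continuous_flux[OF p]])
  obtain g where g[measurable]: "g \<in> borel_measurable borel"
    and fin: "\<And>C. compact C \<Longrightarrow> C \<subseteq> D \<Longrightarrow> (\<integral>\<^sup>+x. ennreal (indicator C x * norm (g x) powr p) \<partial>lborel) < \<infinity>"
    and weak: "\<And>\<phi>. test_fun D \<phi> \<Longrightarrow> (\<integral>x. indicator D x *\<^sub>R (h x *\<^sub>R grad \<phi> x) \<partial>lborel) = - (\<integral>x. \<phi> x *\<^sub>R g x \<partial>lborel)"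
    and harm: "\<And>\<phi>. test_fun D \<phi> \<Longrightarrow> (\<integral>x. flux p (g x) \<bullet> grad \<phi> x \<partial>lborel) = 0"
    by (rule p_harmonic_borel_gradient[OF D(1) ph]) (rule that)

  \<comment> \<open>The boundary inequality makes this extension by zero continuous on the whole
    space.\<close>
  define u where "u x = (if x \<in> D then max 0 (h x - w x) else 0)" for x
  have contu: "continuous_on UNIV u"
  proof -
    have "continuous_on (closure D \<union> - D) (\<lambda>x. if x \<in> D then max 0 (h x - w x) else 0)"
    proof (rule continuous_on_cases)
      show "closed (- D)" using D(1) by (simp add: closed_Compl)
      show "continuous_on (closure D) (\<lambda>x. max 0 (h x - w x))"
        by (intro continuous_intros conth continuous_on_subset[OF contw]) auto
      show "\<forall>x. x \<in> closure D \<and> x \<notin> D \<or> x \<in> - D \<and> x \<in> D \<longrightarrow> max 0 (h x - w x) = 0"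
        using bd D(1) by (auto simp: frontier_def interior_open)
    qed auto
    moreover have "closure D \<union> - D = UNIV" using closure_subset[of D] by blast
    ultimately show ?thesis unfolding u_def by simp
  qed
  have u_out: "u x = 0" if "x \<notin> closure D" for x
    using that closure_subset[of D] by (auto simp: u_def)
  have uD: "x \<in> D" "u x = h x - w x" if "u x > 0" for x
    using that by (auto simp: u_def max_def split: if_splits)
  \<comment> \<open>Superlevel sets of \<open>u\<close> at positive heights are compact subsets of
    \<open>D\<close>, so a truncation at \<open>\<tau>\<close> stays away from the frontier.\<close>
  define \<tau> where "\<tau> = u x0 / 2"
  have \<tau>: "\<tau> > 0" "u x0 > \<tau>" using neg x0 by (auto simp: \<tau>_def u_def)
  have level_compact: "compact {x. u x \<ge> s}" if "s > 0" for s
  proof -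
    have "closed {x. u x \<ge> s}" using contu by (intro closed_Collect_le) auto
    moreover have "{x. u x \<ge> s} \<subseteq> closure D" using that u_out by (force simp: not_le[symmetric])
    ultimately show ?thesis using D(2) by (metis compact_Int_closed inf.absorb2)
  qed
  \<comment> \<open>Two nested levels: the test function will live on \<open>C\<close>, and
    mollifying at a point of \<open>C\<close> only sees values of \<open>u\<close> in
    \<open>C'\<close>, where \<open>u\<close> equals \<open>h - w\<close>.\<close>
  define C C' where "C = {x. u x \<ge> \<tau> / 2}" and "C' = {x. u x \<ge> \<tau> / 4}"
  have C: "compact C" "compact C'" using \<tau> level_compact[of "\<tau> / 2"] level_compact[of "\<tau> / 4"] by (auto simp: C_def C'_def)
  have CD: "C' \<subseteq> D" "C \<subseteq> C'" using uD \<tau> by (force simp: C'_def C_def)+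
  have [measurable]: "C \<in> sets borel" "C' \<in> sets borel" using C by (auto simp: compact_imp_closed)

  have opU: "open {x. u x > \<tau>}" using contu by (intro open_Collect_less) auto
  obtain x1 where x1: "u x1 > \<tau>" "\<xi> x1 \<noteq> 0"
    using strict_supersolution_gradient_nonzero[OF super \<kappa>0 opU, of x0] \<tau> by auto
  \<comment> \<open>\<open>\<sigma>\<close> bounds both the error of the mollification and the
    oscillation of \<open>u\<close> within a kernel's reach. At most \<open>\<tau> / 4\<close>, it
    separates the two levels; at most a quarter of \<open>u x1 - \<tau>\<close>, it leaves a ball
    around \<open>x1\<close> where the mollified function still exceeds
    \<open>\<tau> + \<sigma>\<close>.\<close>
  define \<sigma> where "\<sigma> = min (\<tau> / 4) ((u x1 - \<tau>) / 4)"
  have \<sigma>: "\<sigma> > 0" "\<sigma> \<le> \<tau> / 4" "4 * \<sigma> \<le> u x1 - \<tau>"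
    using \<tau> x1 by (auto simp: \<sigma>_def min_def)
  have "open {x. u x > \<tau> + 2 * \<sigma> \<and> norm (\<xi> x) > norm (\<xi> x1) / 2 \<and> \<kappa> x > \<kappa> x1 / 2}"
    using contu cont\<xi> cont\<kappa>
    by (intro open_Collect_conj open_Collect_less continuous_intros)
  then obtain r where r: "r > 0" "ball x1 r \<subseteq> {x. u x > \<tau> + 2 * \<sigma> \<and> norm (\<xi> x) > norm (\<xi> x1) / 2 \<and> \<kappa> x > \<kappa> x1 / 2}"
    using x1 \<sigma> \<kappa>0[of x1] openE[of _ x1] by (smt (verit) half_gt_zero mem_Collect_eq zero_less_norm_iff field_sum_of_halves)
  define m where "m = (norm (\<xi> x1) / 2) powr (p - 2) * (\<kappa> x1 / 2)"
  have m: "m > 0" using x1 \<kappa>0[of x1] by (simp add: m_def)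
  \<comment> \<open>The gain from strictness on the ball around \<open>x1\<close>. It does not
    depend on the mollification radius, which can therefore be chosen afterwards to make the error
    smaller than this gain.\<close>
  define c0 where "c0 = exp_flat 0 \<sigma> * m * measure lborel (ball x1 r)"
  have "measure lborel (ball x1 r) > 0"
    using r(1) content_ball_pos by simp
  moreover have "exp_flat 0 \<sigma> > 0" using \<sigma> by (simp add: exp_flat_def)
  ultimately have c0: "c0 > 0" using m by (simp add: c0_def)

  \<comment> \<open>\<open>\<beta>\<close> dominates both gradients, so the difference of the fluxes
    is at most twice \<open>\<beta> x powr (p - 1)\<close>; \<open>G\<close> is the weak gradient of
    \<open>h - w\<close> on \<open>C'\<close>, cut off outside.\<close>
  define \<beta> where "\<beta> x = indicator C' x * max (norm (g x)) (norm (\<xi> x))" for x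
  define G where "G x = indicator C' x *\<^sub>R (g x - \<xi> x)" for x
  have \<beta>m[measurable]: "\<beta> \<in> borel_measurable borel" unfolding \<beta>_def by measurable
  have Gm[measurable]: "G \<in> borel_measurable borel" unfolding G_def by measurable
  have \<beta>0: "\<beta> x \<ge> 0" for x by (simp add: \<beta>_def le_max_iff_disj)
  have fin\<beta>: "(\<integral>\<^sup>+x. ennreal (\<beta> x powr p) \<partial>lborel) < \<infinity>"
  proof -
    have "integrable lborel (\<lambda>x. indicator C' x *\<^sub>R norm (\<xi> x) powr p)"
      using C p by (intro borel_integrable_compact continuous_norm_powr continuous_on_subset[OF cont\<xi>]) auto
    then have "(\<integral>\<^sup>+x. ennreal (indicator C' x * norm (\<xi> x) powr p) \<partial>lborel) < \<infinity>"
      by (simp add: integrable_iff_bounded abs_mult)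
    moreover have "(\<integral>\<^sup>+x. ennreal (\<beta> x powr p) \<partial>lborel)
      \<le> (\<integral>\<^sup>+x. ennreal (indicator C' x * norm (g x) powr p) + ennreal (indicator C' x * norm (\<xi> x) powr p) \<partial>lborel)"
    proof (rule nn_integral_mono)
      fix x
      have "\<beta> x powr p \<le> indicator C' x * norm (g x) powr p + indicator C' x * norm (\<xi> x) powr p"
        by (auto simp: \<beta>_def indicator_def max_def)
      then show "ennreal (\<beta> x powr p) \<le> ennreal (indicator C' x * norm (g x) powr p) + ennreal (indicator C' x * norm (\<xi> x) powr p)"
        by (simp add: ennreal_plus[symmetric] ennreal_leI del: ennreal_plus)
    qed
    ultimately show ?thesis
      using fin[OF C(2) CD(1)] by (subst (asm) nn_integral_add) (auto simp: ennreal_add_eq_top less_top[symmetric] top_unique)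
  qed
  have G\<beta>: "norm (G x) \<le> 2 * \<beta> x" for x
    using norm_triangle_ineq4[of "g x" "\<xi> x"] by (auto simp: G_def \<beta>_def indicator_def)
  have finG: "(\<integral>\<^sup>+x. ennreal (norm (G x) powr p) \<partial>lborel) < \<infinity>"
  proof -
    have "(\<integral>\<^sup>+x. ennreal (norm (G x) powr p) \<partial>lborel) \<le> (\<integral>\<^sup>+x. ennreal (2 powr p) * ennreal (\<beta> x powr p) \<partial>lborel)"
    proof (rule nn_integral_mono)
      fix x
      have "norm (G x) powr p \<le> (2 * \<beta> x) powr p" using G\<beta> p by (intro powr_mono2) auto
      then show "ennreal (norm (G x) powr p) \<le> ennreal (2 powr p) * ennreal (\<beta> x powr p)"
        using \<beta>0[of x] by (simp add: powr_mult ennreal_mult'[symmetric] ennreal_leI)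
    qed
    also have "\<dots> < \<infinity>" using fin\<beta> by (simp add: nn_integral_cmult ennreal_mult_less_top)
    finally show ?thesis .
  qed
  obtain R where R: "C' \<subseteq> cball 0 R"
    using C(2) compact_imp_bounded bounded_pos by (metis mem_cball_0 subsetI)
  have GR: "G x = 0" if "x \<notin> cball 0 R" for x
    using that R by (auto simp: G_def indicator_def)
  have intG: "integrable lborel (\<lambda>y. mollifier \<epsilon> (y - x) *\<^sub>R G y)" for \<epsilon> x
  proof -
    have c: "continuous_on S (\<lambda>y. mollifier \<epsilon> (y - x))" for S by (intro continuous_intros)
    then have "bounded ((\<lambda>y. mollifier \<epsilon> (y - x)) ` C')"
      using C(2) compact_continuous_image compact_imp_bounded by blast
    then obtain M where M: "M > 0" "\<And>y. y \<in> C' \<Longrightarrow> \<bar>mollifier \<epsilon> (y - x)\<bar> \<le> M" unfolding bounded_pos by auto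
    have "(\<lambda>y. ennreal (indicator C' y * norm (G y) powr p)) = (\<lambda>y. ennreal (norm (G y) powr p))"
      by (auto simp: G_def indicator_def)
    then have finG': "(\<integral>\<^sup>+y. ennreal (indicator C' y * norm (G y) powr p) \<partial>lborel) < \<infinity>"
      using finG by simp
    note [measurable] = borel_measurable_continuous_onI[OF c[of UNIV]]
    show ?thesis
    proof (rule integrable_of_local_powr_bound[OF Gm C(2) finG', of 1])
      show "norm (mollifier \<epsilon> (y - x) *\<^sub>R G y) \<le> M * (indicator C' y * norm (G y) powr 1)" for y
        using M by (cases "y \<in> C'") (auto simp: G_def intro: mult_right_mono)
    qed (use p M in auto)
  qed

  \<comment> \<open>The pointwise estimate below carries a factor 4, namely 2 from the derivative of
    \<open>exp_flat 0\<close> and 2 from the flux difference. An error of \<open>c0 / 8\<close> thus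
    costs \<open>c0 / 2\<close>, half of the gain.\<close>
  have p1: "p \<ge> 1" and c8: "c0 / 8 > 0" using p c0 by auto
  obtain \<delta> where \<delta>: "\<delta> > 0"
    "\<forall>\<rho>\<in>borel_measurable borel. (\<forall>z. \<rho> z \<ge> 0) \<and> (\<forall>z. norm z > \<delta> \<longrightarrow> \<rho> z = 0) \<and>
      (\<integral>\<^sup>+z. ennreal (\<rho> z) \<partial>lborel) = 1 \<longrightarrow>
      (\<integral>\<^sup>+x. \<integral>\<^sup>+y. ennreal (\<beta> x powr (p - 1) * (\<rho> (y - x) * norm (G x - G y))) \<partial>lborel \<partial>lborel) \<le> ennreal (c0 / 8)"
    by (rule weighted_mollification_error[where R = R, OF Gm finG _ p1 c8 \<beta>m \<beta>0 fin\<beta>], erule GR) (rule that)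
  obtain d where d: "d > 0" "\<And>x y. dist x y < d \<Longrightarrow> \<bar>u y - u x\<bar> < \<sigma>"
    by (rule uniform_continuity_compact_support[OF contu D(2) _ \<sigma>(1)], erule u_out) (rule that)
  define \<epsilon> where "\<epsilon> = min \<delta> (d / 2)"
  have \<epsilon>: "\<epsilon> > 0" "\<epsilon> \<le> \<delta>" "\<epsilon> < d" using \<delta>(1) d(1) by (auto simp: \<epsilon>_def)

  define u' where "u' x = (\<integral>y. mollifier \<epsilon> (x - y) * u y \<partial>lborel)" for x
  have close: "\<bar>u' x - u x\<bar> \<le> \<sigma>" for x
    unfolding u'_def
    by (rule convolution_mollifier_close[OF \<epsilon>(1) contu D(2) u_out]) (use d(2) \<epsilon>(3) in \<open>auto simp: less_imp_le\<close>)
  have Cku': "Ck k u'" for k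
    unfolding u'_def[abs_def] by (rule Ck_convolution[OF contu D(2) u_out Ck_mollifier])
  have contu': "continuous_on UNIV u'" using Cku'[of 0] by simp
  define \<phi> where "\<phi> x = exp_flat 0 (u' x - \<tau>)" for x
  have \<phi>C: "\<phi> x = 0" "exp_flat 2 (u' x - \<tau>) = 0" if "x \<notin> C" for x
    using that close[of x] \<sigma> by (auto simp: \<phi>_def C_def)
  have tC: "test_fun C \<phi>"
  proof -
    have "Ck k (\<lambda>x. u' x + (- \<tau>))" for k by (intro Ck_add Cku' Ck_const)
    from Ck_exp_flat_compose[OF this] have "smooth_fun \<phi>"
      by (simp add: smooth_fun_def \<phi>_def[abs_def])
    moreover have sub: "closure {x. \<phi> x \<noteq> 0} \<subseteq> C"
      using \<phi>C by (intro closure_minimal compact_imp_closed C) auto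
    moreover have "compact (closure {x. \<phi> x \<noteq> 0})"
      using compact_Int_closed[OF C(1) closed_closure] sub by (metis inf.absorb2)
    ultimately show ?thesis unfolding test_fun_def by blast
  qed
  then have t: "test_fun D \<phi>" using CD unfolding test_fun_def by blast
  obtain S where S: "compact S" "S \<subseteq> C" "\<And>x. x \<notin> S \<Longrightarrow> \<phi> x = 0" "\<And>x. x \<notin> S \<Longrightarrow> grad \<phi> x = 0"
    by (rule test_fun_support[OF tC]) (rule that)
  have SD: "S \<subseteq> D" using S(2) CD by blast
  define Du where "Du x = (\<integral>y. mollifier \<epsilon> (y - x) *\<^sub>R G y \<partial>lborel)" for x
  \<comment> \<open>Around a point of \<open>C\<close> the kernel is supported in \<open>C'\<close>,
    where \<open>h - w\<close> coincides with \<open>u\<close>, so the derivative of the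
    mollification is the mollified \<open>G\<close>.\<close>
  have du': "(u' has_derivative (\<lambda>v. Du x \<bullet> v)) (at x)" if x: "x \<in> C" for x
  proof -
    have sub: "cball x \<epsilon> \<subseteq> C'"
    proof
      fix y assume "y \<in> cball x \<epsilon>"
      then have "\<bar>u y - u x\<bar> < \<sigma>" using d(2)[of x y] \<epsilon>(3) by auto
      then show "y \<in> C'" using x \<sigma>(2) by (auto simp: C_def C'_def)
    qed
    have t\<rho>: "test_fun D (\<lambda>y. mollifier \<epsilon> (y - x))"
      using test_fun_mollifier[OF \<epsilon>(1)] sub CD(1) by blast
    have t\<rho>': "test_fun C' (\<lambda>y. mollifier \<epsilon> (y - x))"
      using test_fun_mollifier[OF \<epsilon>(1)] sub by blast
    obtain S where S: "compact S" "S \<subseteq> C'" "\<And>y. y \<notin> S \<Longrightarrow> mollifier \<epsilon> (y - x) = 0"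
      "\<And>y. y \<notin> S \<Longrightarrow> grad (\<lambda>y. mollifier \<epsilon> (y - x)) y = 0"
      by (rule test_fun_support[OF t\<rho>']) (rule that)
    have SD: "S \<subseteq> D" using S(2) CD(1) by blast
    have uS: "u y = h y - w y" if "y \<in> S" for y
      using that S(2) \<tau> by (intro uD) (auto simp: C'_def subset_iff intro: less_le_trans[of 0 "\<tau> / 4"])
    have hD: "continuous_on D h" using conth closure_subset continuous_on_subset by blast
    have "(\<integral>y. (grad (\<lambda>y. mollifier \<epsilon> (y - x)) y \<bullet> v) * u y \<partial>lborel)
        = - (\<integral>y. mollifier \<epsilon> (y - x) * (G y \<bullet> v) \<partial>lborel)" for v
    proof -
      have "(\<integral>y. (grad (\<lambda>y. mollifier \<epsilon> (y - x)) y \<bullet> v) * u y \<partial>lborel)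
        = - (\<integral>y. mollifier \<epsilon> (y - x) * ((g y - \<xi> y) \<bullet> v) \<partial>lborel)"
        using p by (intro weak_gradient_difference[OF D(1) hD g _ fin weak[OF t\<rho>] w cont\<xi> t\<rho> S(1) SD S(3,4) uS]) auto
      also have "(\<lambda>y. mollifier \<epsilon> (y - x) * ((g y - \<xi> y) \<bullet> v)) = (\<lambda>y. mollifier \<epsilon> (y - x) * (G y \<bullet> v))"
        using S(2,3) by (auto simp: G_def indicator_def fun_eq_iff)
      finally show ?thesis .
    qed
    from convolution_mollifier_has_derivative[OF \<epsilon>(1) contu D(2) u_out this]
    have "(u' has_derivative (\<lambda>v. \<integral>y. mollifier \<epsilon> (y - x) * (G y \<bullet> v) \<partial>lborel)) (at x)"
      by (simp add: u'_def[abs_def])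
    moreover have "(\<integral>y. mollifier \<epsilon> (y - x) * (G y \<bullet> v) \<partial>lborel) = Du x \<bullet> v" for v
      using integral_inner_left[of v lborel, OF intG[of \<epsilon> x]] by (simp add: Du_def)
    ultimately show ?thesis by simp
  qed
  have grad\<phi>: "grad \<phi> x = exp_flat 2 (u' x - \<tau>) *\<^sub>R Du x" if x: "x \<in> C" for x
  proof (rule grad_unique)
    have "((\<lambda>x. u' x - \<tau>) has_derivative (\<lambda>v. Du x \<bullet> v)) (at x)"
      by (auto intro!: derivative_eq_intros du'[OF x])
    from has_derivative_compose[OF this exp_flat_0_has_real_derivative[unfolded has_field_derivative_def]]
    show "(\<phi> has_derivative (\<lambda>v. (exp_flat 2 (u' x - \<tau>) *\<^sub>R Du x) \<bullet> v)) (at x)"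
      by (simp add: \<phi>_def[abs_def])
  qed
  have lower: "c0 \<le> (\<integral>x. flux p (\<xi> x) \<bullet> grad \<phi> x \<partial>lborel)"
  proof -
    have "(\<integral>x. exp_flat 0 \<sigma> * m * indicator (ball x1 r) x \<partial>lborel) \<le> (\<integral>x. flux p (\<xi> x) \<bullet> grad \<phi> x \<partial>lborel)"
    proof (rule flux_inequality[OF p super less_imp_le[OF \<kappa>0] test_fun_has_derivative[OF t] test_fun_continuous(2)[OF t] _ S(1) S(3,4)])
      show "\<phi> x \<ge> 0" for x by (simp add: \<phi>_def)
      show "integrable lborel (\<lambda>x. exp_flat 0 \<sigma> * m * indicator (ball x1 r) x)"
        using emeasure_bounded_finite[of "ball x1 r"] by (intro integrable_mult_right integrable_real_indicator) auto
      show "exp_flat 0 \<sigma> * m * indicator (ball x1 r) x \<le> \<phi> x * (norm (\<xi> x) powr (p - 2) * \<kappa> x)" for x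
      proof (cases "x \<in> ball x1 r")
        case True
        then have r': "u x > \<tau> + 2 * \<sigma>" "norm (\<xi> x) > norm (\<xi> x1) / 2" "\<kappa> x > \<kappa> x1 / 2" using r(2) by auto
        have "exp_flat 0 \<sigma> \<le> \<phi> x" unfolding \<phi>_def using close[of x] r'(1) by (intro exp_flat_mono) auto
        moreover have "m \<le> norm (\<xi> x) powr (p - 2) * \<kappa> x"
          unfolding m_def using r' p \<kappa>0[of x1] by (intro mult_mono powr_mono2) auto
        moreover have "\<phi> x \<ge> 0" by (simp add: \<phi>_def)
        ultimately show ?thesis using True m by (simp add: mult_mono)
      next
        case False
        then show ?thesis using \<kappa>0[of x] by (simp add: \<phi>_def)
      qed
    qed
    then show ?thesis by (simp add: c0_def)
  qed
  have contgrad: "continuous_on UNIV (grad \<phi>)" by (rule test_fun_continuous(2)[OF t])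
  note [measurable] = borel_measurable_continuous_onI[OF contgrad]
  have i\<xi>: "integrable lborel (\<lambda>x. flux p (\<xi> x) \<bullet> grad \<phi> x)"
    by (rule integrable_continuous_compact_support[OF _ S(1)])
      (auto simp: S intro!: continuous_intros contgrad continuous_on_compose2[OF continuous_flux[OF p] cont\<xi>])
  have ig: "integrable lborel (\<lambda>x. flux p (g x) \<bullet> grad \<phi> x)"
  proof -
    have "bounded (grad \<phi> ` S)"
      using S(1) contgrad by (meson compact_continuous_image compact_imp_bounded continuous_on_subset top_greatest)
    then obtain M where M: "M > 0" "\<And>x. x \<in> S \<Longrightarrow> norm (grad \<phi> x) \<le> M" unfolding bounded_pos by auto
    show ?thesis
    proof (rule integrable_of_local_powr_bound[OF g S(1) fin[OF S(1) SD], of "p - 1"])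
      show "norm (flux p (g x) \<bullet> grad \<phi> x) \<le> M * (indicator S x * norm (g x) powr (p - 1))" for x
      proof (cases "x \<in> S")
        case True
        have "norm (flux p (g x) \<bullet> grad \<phi> x) \<le> norm (g x) powr (p - 1) * norm (grad \<phi> x)"
          using Cauchy_Schwarz_ineq2[of "flux p (g x)"] by (simp add: norm_flux)
        also have "\<dots> \<le> norm (g x) powr (p - 1) * M" using M(2)[OF True] by (intro mult_left_mono) auto
        finally show ?thesis using True by (simp add: mult.commute)
      qed (simp add: S)
    qed (use p M in auto)
  qed
  define f where "f x = (flux p (g x) - flux p (\<xi> x)) \<bullet> grad \<phi> x" for x
  have intf: "integrable lborel f" unfolding f_def inner_diff_left using i\<xi> ig by simp
  have f_le: "(\<integral>x. f x \<partial>lborel) \<le> - c0"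
    unfolding f_def inner_diff_left using i\<xi> ig harm[OF t] lower by simp
  have point: "ennreal (- f x) \<le> ennreal 4 * (\<integral>\<^sup>+y. ennreal (\<beta> x powr (p - 1) * (mollifier \<epsilon> (y - x) * norm (G x - G y))) \<partial>lborel)" for x
  proof (cases "x \<in> C")
    case False
    then have "grad \<phi> x = 0" using S(2,4) by blast
    then show ?thesis by (simp add: f_def)
  next
    case True
    define \<psi> where "\<psi> = exp_flat 2 (u' x - \<tau>)"
    have \<psi>: "0 \<le> \<psi>" "\<psi> \<le> 2" by (auto simp: \<psi>_def exp_flat_2_le)
    define B where "B = flux p (g x) - flux p (\<xi> x)"
    have Gx: "G x = g x - \<xi> x" using True CD(2) by (auto simp: G_def)
    have \<beta>x: "norm (g x) \<le> \<beta> x" "norm (\<xi> x) \<le> \<beta> x" using True CD(2) by (auto simp: \<beta>_def)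
    have "norm B \<le> norm (g x) powr (p - 1) + norm (\<xi> x) powr (p - 1)"
      unfolding B_def norm_flux[symmetric] by (rule norm_triangle_ineq4)
    also have "\<dots> \<le> \<beta> x powr (p - 1) + \<beta> x powr (p - 1)"
      using \<beta>x p by (intro add_mono powr_mono2) auto
    finally have B: "norm B \<le> 2 * \<beta> x powr (p - 1)" by simp
    \<comment> \<open>\<open>Du x\<close> is replaced by \<open>G x\<close> minus the mollification
      error. The first summand is nonpositive by monotonicity of the flux, so only the error
      remains.\<close>
    have "- f x = - (\<psi> * (B \<bullet> G x)) + \<psi> * (B \<bullet> (G x - Du x))"
      by (simp add: f_def grad\<phi>[OF True] \<psi>_def B_def inner_diff_right algebra_simps)
    also have "\<dots> \<le> \<psi> * (B \<bullet> (G x - Du x))"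
      using flux_monotone[of p "g x" "\<xi> x"] p \<psi>(1) by (simp add: Gx B_def)
    also have "\<dots> \<le> \<psi> * (norm B * norm (G x - Du x))"
      using \<psi>(1) by (intro mult_left_mono norm_cauchy_schwarz) auto
    also have "\<dots> \<le> 2 * (norm B * norm (G x - Du x))"
      using \<psi>(2) by (intro mult_right_mono) auto
    also have "\<dots> \<le> 2 * (2 * \<beta> x powr (p - 1) * norm (G x - Du x))"
      using B by (intro mult_left_mono mult_right_mono) auto
    finally have "ennreal (- f x) \<le> ennreal (4 * (\<beta> x powr (p - 1) * norm (G x - Du x)))"
      by (intro ennreal_leI) simp
    also have "\<dots> = ennreal 4 * (ennreal (\<beta> x powr (p - 1)) * ennreal (norm (G x - Du x)))"
      by (simp add: ennreal_mult')
    also have "\<dots> \<le> ennreal 4 * (ennreal (\<beta> x powr (p - 1)) * (\<integral>\<^sup>+y. ennreal (mollifier \<epsilon> (y - x) * norm (G x - G y)) \<partial>lborel))"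
      unfolding Du_def by (intro mult_left_mono mollified_gradient_error[OF \<epsilon>(1) intG]) auto
    also have "\<dots> = ennreal 4 * (\<integral>\<^sup>+y. ennreal (\<beta> x powr (p - 1) * (mollifier \<epsilon> (y - x) * norm (G x - G y))) \<partial>lborel)"
    proof -
      have [measurable]: "(\<lambda>y. mollifier \<epsilon> (y - x)) \<in> borel_measurable borel"
        by (intro borel_measurable_continuous_onI continuous_intros)
      show ?thesis
        by (subst nn_integral_cmult[symmetric]) (auto simp: ennreal_mult')
    qed
    finally show ?thesis .
  qed
  have "(\<integral>\<^sup>+x. ennreal (- f x) \<partial>lborel)
      \<le> (\<integral>\<^sup>+x. ennreal 4 * (\<integral>\<^sup>+y. ennreal (\<beta> x powr (p - 1) * (mollifier \<epsilon> (y - x) * norm (G x - G y))) \<partial>lborel) \<partial>lborel)"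
    by (intro nn_integral_mono point)
  also have "\<dots> = ennreal 4 * (\<integral>\<^sup>+x. \<integral>\<^sup>+y. ennreal (\<beta> x powr (p - 1) * (mollifier \<epsilon> (y - x) * norm (G x - G y))) \<partial>lborel \<partial>lborel)"
  proof (rule nn_integral_cmult)
    have [measurable]: "mollifier \<epsilon> \<in> borel_measurable (borel :: 'a measure)"
      by (rule borel_measurable_continuous_onI[OF Ck_imp_continuous[OF Ck_mollifier]])
    show "(\<lambda>x. \<integral>\<^sup>+y. ennreal (\<beta> x powr (p - 1) * (mollifier \<epsilon> (y - x) * norm (G x - G y))) \<partial>lborel) \<in> borel_measurable lborel"
      by measurable
  qed
  also have "\<dots> \<le> ennreal 4 * ennreal (c0 / 8)"
  proof (intro mult_left_mono \<delta>(2)[rule_format] conjI allI impI)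
    show "mollifier \<epsilon> \<in> borel_measurable (borel :: 'a measure)"
      by (rule borel_measurable_continuous_onI[OF Ck_imp_continuous[OF Ck_mollifier]])
    show "mollifier \<epsilon> z = 0" if "norm z > \<delta>" for z :: 'a
      using that \<epsilon> by (intro mollifier_eq_0) auto
    have "(\<integral>\<^sup>+z. ennreal (mollifier \<epsilon> z) \<partial>(lborel::'a measure)) = ennreal (\<integral>z. mollifier \<epsilon> z \<partial>(lborel::'a measure))"
      by (intro nn_integral_eq_integral mollifier_integral \<epsilon>) auto
    then show "(\<integral>\<^sup>+z. ennreal (mollifier \<epsilon> z) \<partial>(lborel::'a measure)) = 1"
      using mollifier_integral(2)[OF \<epsilon>(1), where 'a = 'a] by simp
  qed auto
  also have "\<dots> = ennreal (c0 / 2)" by (subst ennreal_mult'[symmetric]) auto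
  finally have "- (c0 / 2) \<le> (\<integral>x. f x \<partial>lborel)"
    using c0 by (intro integral_bounded_below[OF intf]) auto
  then show False using f_le c0 by simp
qed

section \<open>Regularised poles and supporting affine functions\<close>

lemma strict_supersolution_add:
  assumes "strict_supersolution p w1 \<xi>1 X1 \<kappa>1" and "strict_supersolution p w2 \<xi>2 X2 \<kappa>2"
  shows "strict_supersolution p (\<lambda>x. w1 x + w2 x) (\<lambda>x. \<xi>1 x + \<xi>2 x) (\<lambda>x v. X1 x v + X2 x v) (\<lambda>x. \<kappa>1 x + \<kappa>2 x)"
  unfolding strict_supersolution_def
proof (intro conjI allI impI)
  note a = assms[unfolded strict_supersolution_def]
  show "((\<lambda>x. w1 x + w2 x) has_derivative (\<lambda>v. (\<xi>1 x + \<xi>2 x) \<bullet> v)) (at x)" for x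
    unfolding inner_add_left using a by (intro has_derivative_add) auto
  show "((\<lambda>x. \<xi>1 x + \<xi>2 x) has_derivative (\<lambda>v. X1 x v + X2 x v)) (at x)" for x
    using a by (intro has_derivative_add) auto
  show "continuous_on UNIV (\<lambda>x. X1 x v + X2 x v)" for v
    using a by (intro continuous_on_add) auto
  show "continuous_on UNIV (\<lambda>x. \<kappa>1 x + \<kappa>2 x)"
    using a by (intro continuous_on_add) auto
  show "(\<Sum>b\<in>Basis. (X1 x b + X2 x b) \<bullet> b) + (p - 2) * ((X1 x z + X2 x z) \<bullet> z) \<le> - (\<kappa>1 x + \<kappa>2 x)"
    if "norm z \<le> 1" for x z
  proof -
    have "(\<Sum>b\<in>Basis. X1 x b \<bullet> b) + (p - 2) * (X1 x z \<bullet> z) \<le> - \<kappa>1 x"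
      "(\<Sum>b\<in>Basis. X2 x b \<bullet> b) + (p - 2) * (X2 x z \<bullet> z) \<le> - \<kappa>2 x"
      using a that by blast+
    then show ?thesis by (simp add: inner_add_left sum.distrib distrib_left)
  qed
qed

lemma strict_supersolution_affine:
  "strict_supersolution p (\<lambda>x. c + v \<bullet> x) (\<lambda>x. v) (\<lambda>x u. 0) (\<lambda>x. 0)"
  unfolding strict_supersolution_def by (auto intro!: derivative_eq_intros)

definition regularised_pole :: "real \<Rightarrow> real \<Rightarrow> 'a::real_inner \<Rightarrow> 'a \<Rightarrow> real" where
  "regularised_pole e d z x = ((x - z) \<bullet> (x - z) + d\<^sup>2) powr (- e / 2)"

lemma regularised_pole_pos: "d > 0 \<Longrightarrow> (x - z) \<bullet> (x - z) + d\<^sup>2 > 0"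
  by (simp add: add_nonneg_pos)

text \<open>With t the squared length of \<zeta>, the Cauchy-Schwarz inequality reduces the trace
  condition to (e + 2) (1 + (p - 2) t) \<le> n + (p - 2) t for t in [0, 1]. Both sides are affine in
  t; they agree at t = 1 by the choice of \<open>e\<close>, and for smaller t the slack has the sign
  of p - 2. The remaining term \<open>d\<^sup>2\<close> (n + (p - 2) t) is at least
  \<open>d\<^sup>2\<close>, which is the share kept in \<open>\<kappa>\<close>.\<close>

lemma regularised_pole_strict_supersolution:
  fixes z :: "'a::euclidean_space"
  assumes p: "p \<ge> 2" "p < real DIM('a)" and d: "d > 0" and c: "c \<ge> 0"
    and e_def: "e = (real DIM('a) - p) / (p - 1)"
  obtains \<xi> X \<kappa> where "strict_supersolution p (\<lambda>x. c * regularised_pole e d z x) \<xi> X \<kappa>"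
    "\<And>x. \<kappa> x \<ge> 0" "c > 0 \<Longrightarrow> \<forall>x. \<kappa> x > 0"
proof -
  define n where "n = real DIM('a)"
  have n: "n > 2" "p < n" using p by (auto simp: n_def)
  have e: "e > 0" using p by (simp add: e_def)
  have en: "(e + 2) * (p - 1) = n + p - 2" using p by (simp add: e_def n_def field_simps)
  define Q where "Q x = (x - z) \<bullet> (x - z) + d\<^sup>2" for x
  have Q: "Q x > 0" for x unfolding Q_def by (rule regularised_pole_pos[OF d])
  have contQ: "continuous_on UNIV Q" unfolding Q_def by (intro continuous_intros)
  have contQa: "continuous_on UNIV (\<lambda>x. Q x powr a)" for a
    by (intro continuous_on_powr contQ continuous_intros) (use Q in \<open>auto simp: less_imp_neq[symmetric]\<close>)
  have dQ: "(Q has_derivative (\<lambda>v. 2 * ((x - z) \<bullet> v))) (at x)" for x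
    unfolding Q_def by (auto intro!: derivative_eq_intros simp: inner_commute)
  have dQa: "((\<lambda>x. Q x powr a) has_derivative (\<lambda>v. 2 * a * Q x powr (a - 1) * ((x - z) \<bullet> v))) (at x)" for a x
  proof -
    have "((\<lambda>t. t powr a) has_derivative (\<lambda>h. h * (a * Q x powr (a - 1)))) (at (Q x))"
      using has_real_derivative_powr[OF Q[of x], of a] by (simp add: has_field_derivative_def mult.commute[of _ "a * _"])
    from has_derivative_compose[OF dQ this]
    show ?thesis by (simp add: mult_ac)
  qed
  define \<xi> where "\<xi> x = (- (c * e) * Q x powr (- e / 2 - 1)) *\<^sub>R (x - z)" for x
  define X where "X x v = (- (c * e) * Q x powr (- e / 2 - 1)) *\<^sub>R v
      + (c * e * (e + 2) * Q x powr (- e / 2 - 2) * ((x - z) \<bullet> v)) *\<^sub>R (x - z)" for x v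
  define \<kappa> where "\<kappa> x = c * e * d\<^sup>2 * Q x powr (- e / 2 - 2)" for x
  have "strict_supersolution p (\<lambda>x. c * regularised_pole e d z x) \<xi> X \<kappa>"
    unfolding strict_supersolution_def
  proof (intro conjI allI impI)
    show "((\<lambda>x. c * regularised_pole e d z x) has_derivative (\<lambda>v. \<xi> x \<bullet> v)) (at x)" for x
    proof -
      have "((\<lambda>x. c * Q x powr (- e / 2)) has_derivative
          (\<lambda>v. c * (2 * (- e / 2) * Q x powr (- e / 2 - 1) * ((x - z) \<bullet> v)))) (at x)"
        by (intro has_derivative_mult_right dQa)
      then show ?thesis by (simp add: regularised_pole_def Q_def \<xi>_def mult_ac)
    qed
    show "(\<xi> has_derivative X x) (at x)" for x
    proof -
      have "((\<lambda>x. - (c * e) * Q x powr (- e / 2 - 1)) has_derivative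
          (\<lambda>v. - (c * e) * (2 * (- e / 2 - 1) * Q x powr (- e / 2 - 1 - 1) * ((x - z) \<bullet> v)))) (at x)"
        by (intro has_derivative_mult_right dQa)
      moreover have "((\<lambda>x. x - z) has_derivative (\<lambda>v. v)) (at x)"
        by (auto intro!: derivative_eq_intros)
      ultimately have "(\<xi> has_derivative (\<lambda>v. (- (c * e) * Q x powr (- e / 2 - 1)) *\<^sub>R v
          + (- (c * e) * (2 * (- e / 2 - 1) * Q x powr (- e / 2 - 1 - 1) * ((x - z) \<bullet> v))) *\<^sub>R (x - z))) (at x)"
        unfolding \<xi>_def[abs_def] by (rule has_derivative_scaleR)
      moreover have "- (c * e) * (2 * (- e / 2 - 1) * q * i) = c * e * (e + 2) * q * i" for q i
        by (simp add: field_simps)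
      moreover have "- e / 2 - 1 - 1 = - e / 2 - 2" by simp
      ultimately show ?thesis unfolding X_def[abs_def] by (simp only:)
    qed
    show "continuous_on UNIV (\<lambda>x. X x v)" for v
      unfolding X_def by (intro continuous_intros contQa)
    show "continuous_on UNIV \<kappa>"
      unfolding \<kappa>_def by (intro continuous_intros contQa)
    show "(\<Sum>b\<in>Basis. X x b \<bullet> b) + (p - 2) * (X x \<zeta> \<bullet> \<zeta>) \<le> - \<kappa> x" if \<zeta>: "norm \<zeta> \<le> 1" for x \<zeta>
    proof -
      define y where "y = x - z"
      define k where "k = c * e * Q x powr (- e / 2 - 2)"
      define t where "t = \<zeta> \<bullet> \<zeta>"
      define s where "s = y \<bullet> y"
      have k: "k \<ge> 0" using c e by (simp add: k_def)
      have t: "0 \<le> t" "t \<le> 1" using \<zeta> by (auto simp: t_def power2_norm_eq_inner[symmetric] power_le_one)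
      have s: "s \<ge> 0" by (simp add: s_def)
      have cs: "(y \<bullet> \<zeta>)\<^sup>2 \<le> s * t" unfolding s_def t_def by (rule Cauchy_Schwarz_ineq)
      have "- e / 2 - 1 = 1 + (- e / 2 - 2)" by simp
      then have "Q x powr (- e / 2 - 1) = Q x powr (1 + (- e / 2 - 2))" by (rule arg_cong)
      also have "\<dots> = Q x * Q x powr (- e / 2 - 2)"
        using Q[of x] by (simp only: powr_add powr_one less_imp_le)
      finally have qq: "c * e * Q x powr (- e / 2 - 1) = k * (s + d\<^sup>2)"
        by (simp add: k_def Q_def s_def y_def)
      have Xuu: "X x u \<bullet> u = k * (- (s + d\<^sup>2) * (u \<bullet> u) + (e + 2) * (y \<bullet> u)\<^sup>2)" for u
      proof -
        have "X x u \<bullet> u = - (c * e * Q x powr (- e / 2 - 1)) * (u \<bullet> u) + k * (e + 2) * (y \<bullet> u)\<^sup>2"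
          by (simp add: X_def k_def y_def inner_add_left inner_diff_left power2_eq_square mult_ac)
        then show ?thesis unfolding qq by (simp add: algebra_simps)
      qed
      have sq: "(\<Sum>b\<in>Basis. (y \<bullet> b)\<^sup>2) = s"
        using euclidean_inner[of y y] by (simp add: s_def power2_eq_square)
      have one: "(\<Sum>b\<in>(Basis::'a set). b \<bullet> b) = n"
        by (simp add: n_def)
      have tr: "(\<Sum>b\<in>Basis. X x b \<bullet> b) = k * (- (s + d\<^sup>2) * n + (e + 2) * s)"
        unfolding Xuu sum_distrib_left[symmetric] sum.distrib sq one ..
      have "(\<Sum>b\<in>Basis. X x b \<bullet> b) + (p - 2) * (X x \<zeta> \<bullet> \<zeta>)
        = k * (- (s + d\<^sup>2) * (n + (p - 2) * t) + (e + 2) * (s + (p - 2) * (y \<bullet> \<zeta>)\<^sup>2))"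
        unfolding tr Xuu[of \<zeta>] t_def by (simp add: algebra_simps)
      also have "\<dots> \<le> k * (- d\<^sup>2)"
      proof (rule mult_left_mono[OF _ k])
        \<comment> \<open>Multiplying by \<open>p - 1\<close> allows \<open>en\<close> to eliminate
          \<open>e\<close>; the factor \<open>1 - t\<close> shows the equality for unit
          vectors.\<close>
        have "(n + (p - 2) * t) * (p - 1) - (e + 2) * (p - 1) * (1 + (p - 2) * t) = (p - 2) * (n - 1) * (1 - t)"
          unfolding en by (simp add: algebra_simps)
        moreover have "(p - 2) * (n - 1) * (1 - t) \<ge> 0" using p n t by simp
        ultimately have "(e + 2) * (1 + (p - 2) * t) * (p - 1) \<le> (n + (p - 2) * t) * (p - 1)"
          by (simp add: mult_ac)
        then have le: "(e + 2) * (1 + (p - 2) * t) \<le> n + (p - 2) * t"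
          using p by (simp add: mult_le_cancel_right)
        have "(e + 2) * (s + (p - 2) * (y \<bullet> \<zeta>)\<^sup>2) \<le> (e + 2) * (s + (p - 2) * (s * t))"
          using e p cs by (intro mult_left_mono add_left_mono) auto
        also have "\<dots> = s * ((e + 2) * (1 + (p - 2) * t))" by (simp add: algebra_simps)
        also have "\<dots> \<le> s * (n + (p - 2) * t)" by (rule mult_left_mono[OF le s])
        finally have 1: "(e + 2) * (s + (p - 2) * (y \<bullet> \<zeta>)\<^sup>2) \<le> s * (n + (p - 2) * t)" .
        have "1 \<le> n + (p - 2) * t" using n p t by (simp add: add_increasing2)
        then have "d\<^sup>2 * 1 \<le> d\<^sup>2 * (n + (p - 2) * t)" by (intro mult_left_mono) auto
        with 1 show "- (s + d\<^sup>2) * (n + (p - 2) * t) + (e + 2) * (s + (p - 2) * (y \<bullet> \<zeta>)\<^sup>2) \<le> - d\<^sup>2"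
          by (simp add: algebra_simps)
      qed
      also have "\<dots> = - \<kappa> x" by (simp add: k_def \<kappa>_def)
      finally show ?thesis .
    qed
  qed
  moreover have "\<kappa> x \<ge> 0" for x using c e by (simp add: \<kappa>_def)
  moreover have "\<forall>x. \<kappa> x > 0" if "c > 0" using that e d Q by (simp add: \<kappa>_def less_imp_neq[symmetric])
  ultimately show ?thesis using that by blast
qed

lemma regularised_poles_supersolution:
  fixes y :: "nat \<Rightarrow> 'a::euclidean_space"
  assumes p: "p \<ge> 2" "p < real DIM('a)" and d: "d > 0" and a: "\<And>i. a i \<ge> 0"
    and e: "e = (real DIM('a) - p) / (p - 1)"
  shows "\<exists>\<xi> X \<kappa>. strict_supersolution p (\<lambda>x. \<Sum>i<k. a i * regularised_pole e d (y i) x) \<xi> X \<kappa> \<and> (\<forall>x. \<kappa> x \<ge> 0)"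
proof (induction k)
  case 0
  show ?case using strict_supersolution_affine[of p 0 "0::'a"] by (auto intro!: exI)
next
  case (Suc k)
  then obtain \<xi> X \<kappa> where IH: "strict_supersolution p (\<lambda>x. \<Sum>i<k. a i * regularised_pole e d (y i) x) \<xi> X \<kappa>" "\<forall>x. \<kappa> x \<ge> 0"
    by blast
  obtain \<xi>' X' \<kappa>' where 1: "strict_supersolution p (\<lambda>x. a k * regularised_pole e d (y k) x) \<xi>' X' \<kappa>'" "\<And>x. \<kappa>' x \<ge> 0"
    by (rule regularised_pole_strict_supersolution[OF p d a e]) (rule that)
  have "strict_supersolution p (\<lambda>x. \<Sum>i<Suc k. a i * regularised_pole e d (y i) x)
      (\<lambda>x. \<xi> x + \<xi>' x) (\<lambda>x v. X x v + X' x v) (\<lambda>x. \<kappa> x + \<kappa>' x)"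
    using strict_supersolution_add[OF IH(1) 1(1)] by simp
  moreover have "\<forall>x. \<kappa> x + \<kappa>' x \<ge> 0" using IH(2) 1(2) by simp
  ultimately show ?case by blast
qed

lemma regularised_pole_antimono:
  assumes "0 < d" "d \<le> d'" "e \<ge> 0"
  shows "regularised_pole e d' z x \<le> regularised_pole e d z x"
  unfolding regularised_pole_def
  using assms regularised_pole_pos[OF assms(1)] by (intro powr_mono2') (auto intro: power_mono)

lemma continuous_regularised_pole: "d > 0 \<Longrightarrow> continuous_on S (regularised_pole e d z)"
  unfolding regularised_pole_def
  by (intro continuous_on_powr continuous_intros) (use regularised_pole_pos[of d _ z] in \<open>auto simp: less_imp_neq[symmetric]\<close>)

text \<open>The regularised values increase as \<open>d\<close> decreases, so the supremum is the
  limit. At the pole they equal a multiple of \<open>real (Suc k) powr e\<close> and diverge; a zero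
  coefficient is separate because \<open>pole_term\<close> is then 0 even at the pole.\<close>

lemma pole_term_eq_SUP:
  fixes z :: "'a::euclidean_space"
  assumes e: "e > 0" and c: "c \<ge> 0"
  shows "pole_term e c z x = (SUP k. ereal (c * regularised_pole e (inverse (real (Suc k))) z x))"
proof -
  let ?d = "\<lambda>k. inverse (real (Suc k))"
  let ?f = "\<lambda>k. ereal (c * regularised_pole e (?d k) z x)"
  have inc: "incseq ?f"
  proof (rule incseq_SucI)
    fix k
    have "regularised_pole e (?d k) z x \<le> regularised_pole e (?d (Suc k)) z x"
      using e by (intro regularised_pole_antimono) auto
    then show "?f k \<le> ?f (Suc k)" using c by (simp add: mult_left_mono)
  qed
  have "?f \<longlonglongrightarrow> pole_term e c z x"
  proof (cases "c = 0")
    case True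
    then show ?thesis by (simp add: pole_term_def zero_ereal_def)
  next
    case False
    then have c: "c > 0" using c by simp
    show ?thesis
    proof (cases "x = z")
      case True
      have "(?d k)\<^sup>2 powr (- e / 2) = real (Suc k) powr e" for k
      proof -
        have "(?d k)\<^sup>2 = real (Suc k) powr (- 2)"
          by (simp add: powr_minus power_inverse)
        then show ?thesis by (simp only: powr_powr) simp
      qed
      then have f: "?f = (\<lambda>k. ereal (c * real (Suc k) powr e))"
        using True by (simp add: regularised_pole_def)
      have "filterlim (\<lambda>k. exp (e * ln (real (Suc k)))) at_top sequentially"
        by (rule filterlim_compose[OF exp_at_top], rule filterlim_tendsto_pos_mult_at_top[OF tendsto_const e],
            rule filterlim_compose[OF ln_at_top], rule filterlim_compose[OF filterlim_real_sequentially filterlim_Suc])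
      then have "filterlim (\<lambda>k. real (Suc k) powr e) at_top sequentially"
        by (simp add: powr_def)
      then have "filterlim (\<lambda>k. c * real (Suc k) powr e) at_top sequentially"
        by (rule filterlim_tendsto_pos_mult_at_top[OF tendsto_const c])
      then show ?thesis
        unfolding f using True c by (simp add: pole_term_def tendsto_PInfty_eq_at_top)
    next
      case False
      have "?d \<longlonglongrightarrow> 0" by (rule LIMSEQ_inverse_real_of_nat)
      then have "(\<lambda>k. (x - z) \<bullet> (x - z) + (?d k)\<^sup>2) \<longlonglongrightarrow> (x - z) \<bullet> (x - z) + 0\<^sup>2"
        by (intro tendsto_intros)
      then have "(\<lambda>k. c * regularised_pole e (?d k) z x) \<longlonglongrightarrow> c * ((x - z) \<bullet> (x - z)) powr (- e / 2)"
        unfolding regularised_pole_def using False by (intro tendsto_intros) auto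
      moreover have "((x - z) \<bullet> (x - z)) powr (- e / 2) = 1 / norm (x - z) powr e"
      proof -
        have "(x - z) \<bullet> (x - z) = norm (x - z) powr 2" by (simp add: power2_norm_eq_inner[symmetric])
        moreover have "2 * (- e / 2) = - e" by simp
        ultimately have "((x - z) \<bullet> (x - z)) powr (- e / 2) = norm (x - z) powr (- e)"
          by (simp only: powr_powr)
        then show ?thesis by (simp add: powr_minus_divide)
      qed
      ultimately have "(\<lambda>k. c * regularised_pole e (?d k) z x) \<longlonglongrightarrow> c * (1 / norm (x - z) powr e)"
        by (simp only:)
      moreover have "pole_term e c z x = ereal (c * (1 / norm (x - z) powr e))"
        using False c by (simp add: pole_term_def)
      ultimately show ?thesis by (simp only: tendsto_ereal)
    qed
  qed
  then show ?thesis using LIMSEQ_SUP[OF inc] LIMSEQ_unique by blast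
qed

text \<open>Separates the strict hypograph of \<open>K\<close> from the graph point over
  \<open>x\<close>. Strictness makes the two sets disjoint, and values on the graph are recovered by
  letting the height increase to \<open>K z\<close>.\<close>

lemma concave_on_supergradient:
  fixes K :: "'a::euclidean_space \<Rightarrow> real"
  assumes "concave_on UNIV K"
  obtains v where "\<And>z. K z \<le> K x + v \<bullet> (z - x)"
proof -
  have cc: "convex_on UNIV (\<lambda>x. - K x)" using assms by (simp add: concave_on_def)
  define S where "S = {(z, t). t < K z}"
  have "convex S"
  proof (rule convexI)
    fix P Q u v assume PQ: "P \<in> S" "Q \<in> S" and uv: "0 \<le> u" "0 \<le> v" "u + v = (1::real)"
    obtain z1 t1 z2 t2 where P: "P = (z1, t1)" "t1 < K z1" and Q: "Q = (z2, t2)" "t2 < K z2"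
      using PQ by (auto simp: S_def)
    have "- K (u *\<^sub>R z1 + v *\<^sub>R z2) \<le> u * - K z1 + v * - K z2"
      using cc uv unfolding convex_on_def by blast
    then have "u * K z1 + v * K z2 \<le> K (u *\<^sub>R z1 + v *\<^sub>R z2)" by simp
    moreover have "u * t1 + v * t2 < u * K z1 + v * K z2"
    proof (cases "u = 0")
      case False
      then have "u * t1 < u * K z1" using P uv by simp
      moreover have "v * t2 \<le> v * K z2" using Q uv by (simp add: mult_left_mono)
      ultimately show ?thesis by simp
    qed (use Q uv in auto)
    ultimately show "u *\<^sub>R P + v *\<^sub>R Q \<in> S" by (simp add: P Q S_def)
  qed
  moreover have "(x, K x - 1) \<in> S" "S \<inter> {(x, K x)} = {}" by (auto simp: S_def)
  ultimately have "\<exists>A b. A \<noteq> 0 \<and> (\<forall>P\<in>S. A \<bullet> P \<le> b) \<and> (\<forall>P\<in>{(x, K x)}. b \<le> A \<bullet> P)"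
    by (intro separating_hyperplane_sets) auto
  then obtain A b where "A \<noteq> 0 \<and> (\<forall>P\<in>S. A \<bullet> P \<le> b) \<and> (\<forall>P\<in>{(x, K x)}. b \<le> A \<bullet> P)"
    by blast
  then have A: "A \<noteq> 0" "\<And>P. P \<in> S \<Longrightarrow> A \<bullet> P \<le> b" "b \<le> A \<bullet> (x, K x)"
    by auto
  obtain q r where qr: "A = (q, r)" by (cases A)
  have sep: "q \<bullet> z + r * t \<le> q \<bullet> x + r * K x" if "t < K z" for z t
    using A(2)[of "(z, t)"] A(3) that by (auto simp: S_def qr inner_prod_def)
  have r0: "r \<ge> 0" using sep[of "K x - 1" x] by (simp add: algebra_simps)
  have "r \<noteq> 0"
  proof
    assume r: "r = 0"
    \<comment> \<open>A vertical hyperplane is impossible because \<open>K\<close> is finite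
      everywhere: moving from \<open>x\<close> in the direction \<open>q\<close> would cross
      it.\<close>
    have "q \<bullet> q \<le> 0" using sep[of "K (x + q) - 1" "x + q"] by (simp add: r inner_add_right)
    then have "q = 0" by (metis inner_eq_zero_iff inner_ge_zero antisym)
    then show False using A(1) r by (simp add: qr zero_prod_def)
  qed
  with r0 have r: "r > 0" by simp
  have "K z \<le> K x + (- (1 / r) *\<^sub>R q) \<bullet> (z - x)" for z
  proof (rule dense_le)
    fix t assume "t < K z"
    from sep[OF this] show "t \<le> K x + (- (1 / r) *\<^sub>R q) \<bullet> (z - x)"
      using r by (simp add: inner_diff_right field_simps)
  qed
  then show ?thesis using that by blast
qed

text \<open>The one-sided half of Dini's theorem. It is phrased without a limit function, so the
  increasing sequence may diverge at some points, as it does at the poles.\<close>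

lemma compact_uniform_lower_bound:
  fixes S :: "nat \<Rightarrow> 'a::metric_space \<Rightarrow> real"
  assumes F: "compact F" and f: "continuous_on F f" and S: "\<And>k. continuous_on F (S k)"
    and inc: "\<And>j k x. j \<le> k \<Longrightarrow> S j x \<le> S k x"
    and lt: "\<And>x. x \<in> F \<Longrightarrow> \<exists>k. f x < S k x"
  shows "\<exists>k. \<forall>x\<in>F. f x < S k x"
proof (rule ccontr)
  assume "\<not> ?thesis"
  then have "\<forall>k. \<exists>x. x \<in> F \<and> S k x \<le> f x" by (auto simp: not_less)
  then obtain z where z: "\<And>k. z k \<in> F" "\<And>k. S k (z k) \<le> f (z k)" by metis
  obtain l r where l: "l \<in> F" and r: "strict_mono r" and lim: "(z \<circ> r) \<longlonglongrightarrow> l"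
    using F z(1) unfolding compact_def by blast
  have "S j l \<le> f l" for j
  proof (rule LIMSEQ_le)
    show "(\<lambda>k. S j ((z \<circ> r) k)) \<longlonglongrightarrow> S j l"
      by (rule continuous_on_tendsto_compose[OF S lim l]) (simp add: z)
    show "(\<lambda>k. f ((z \<circ> r) k)) \<longlonglongrightarrow> f l"
      by (rule continuous_on_tendsto_compose[OF f lim l]) (simp add: z)
    have "S j (z (r k)) \<le> f (z (r k))" if "k \<ge> j" for k
      using inc[of j "r k" "z (r k)"] z(2)[of "r k"] that seq_suble[OF r, of k] by linarith
    then show "\<exists>N. \<forall>k\<ge>N. S j ((z \<circ> r) k) \<le> f ((z \<circ> r) k)" by auto
  qed
  then show False using lt[OF l] by (auto simp: not_less[symmetric])
qed

section \<open>Superharmonicity of the sum\<close>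

theorem theorem1p1:
  fixes p :: real and K :: "'a::euclidean_space \<Rightarrow> real"
    and a :: "nat \<Rightarrow> real" and y :: "nat \<Rightarrow> 'a" and W :: "'a \<Rightarrow> ereal"
  assumes "2 \<le> p" and "p < real DIM('a)"
    and "concave_on UNIV K"
    and "\<And>i. a i \<ge> 0"
    and "\<And>x. W x = (\<Sum>i. pole_term ((real DIM('a) - p) / (p - 1)) (a i) (y i) x) + ereal (K x)"
    and "\<exists>x0. (\<Sum>i. pole_term ((real DIM('a) - p) / (p - 1)) (a i) (y i) x0) < \<infinity>"
  shows "p_superharmonic p UNIV W"
proof -
  define e where "e = (real DIM('a) - p) / (p - 1)"
  have e: "e > 0" using assms(1,2) by (simp add: e_def)
  define d where "d k = inverse (real (Suc k))" for k
  have d: "d k > 0" "d j \<le> d k" if "k \<le> j" for j k using that by (auto simp: d_def le_imp_inverse_le)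
  define V where "V x = (\<Sum>i. pole_term e (a i) (y i) x)" for x
  have W: "W x = V x + ereal (K x)" for x using assms(5) by (simp add: V_def e_def)
  \<comment> \<open>One index both truncates the series and regularises its terms, which yields a
    single increasing sequence of continuous functions.\<close>
  define S where "S k x = (\<Sum>i<k. a i * regularised_pole e (d k) (y i) x)" for k x
  have pole0: "regularised_pole e t z x \<ge> 0" for t x and z :: 'a by (simp add: regularised_pole_def)
  have pole_inc: "a i * regularised_pole e (d j) (y i) x \<le> a i * regularised_pole e (d k) (y i) x" if "j \<le> k" for i j k x
    using d[OF that] d(1)[OF order_refl] e assms(4) by (intro mult_left_mono regularised_pole_antimono) auto
  have S_part: "(\<Sum>i<N. a i * regularised_pole e (d j) (y i) x) \<le> S k x" if "N \<le> k" "j \<le> k" for N j k x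
  proof -
    have "(\<Sum>i<N. a i * regularised_pole e (d j) (y i) x) \<le> (\<Sum>i<N. a i * regularised_pole e (d k) (y i) x)"
      using pole_inc that by (intro sum_mono)
    also have "\<dots> \<le> S k x"
      unfolding S_def using that assms(4) pole0 by (intro sum_mono2) auto
    finally show ?thesis .
  qed
  have S_inc: "S j x \<le> S k x" if "j \<le> k" for j k x
    unfolding S_def[of j] using that by (intro S_part)
  have contS: "continuous_on T (S k)" for k T
    unfolding S_def[abs_def]
    by (intro continuous_intros continuous_on_subset[OF continuous_regularised_pole[of _ UNIV]]) (auto simp: d_def)
  have pole: "pole_term e (a i) (y i) x = (SUP k. ereal (a i * regularised_pole e (d k) (y i) x))" for i x
    unfolding d_def by (rule pole_term_eq_SUP[OF e assms(4)])
  have pole_nonneg: "pole_term e (a i) (y i) x \<ge> 0" for i x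
    using assms(4) by (simp add: pole_term_def)
  have V_SUP: "V x = (SUP k. ereal (S k x))" for x
  proof (rule antisym)
    have "V x = (SUP N. \<Sum>i<N. pole_term e (a i) (y i) x)"
      unfolding V_def by (rule suminf_ereal_eq_SUP) (rule pole_nonneg)
    also have "\<dots> \<le> (SUP k. ereal (S k x))"
    proof (rule SUP_least)
      fix N
      have "(\<Sum>i<N. pole_term e (a i) (y i) x) = (SUP k. \<Sum>i<N. ereal (a i * regularised_pole e (d k) (y i) x))"
        unfolding pole using assms(4) pole0 pole_inc by (intro SUP_ereal_sum[symmetric]) (auto simp: incseq_def)
      also have "\<dots> \<le> (SUP k. ereal (S k x))"
      proof (rule SUP_least)
        fix j
        have "(\<Sum>i<N. ereal (a i * regularised_pole e (d j) (y i) x)) \<le> ereal (S (max N j) x)"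
          \<comment> \<open>The iterated supremum over truncations and regularisations is reached
            along the diagonal, at \<open>max N j\<close>.\<close>
          using S_part[of N "max N j" j x] by simp
        also have "\<dots> \<le> (SUP k. ereal (S k x))" by (rule SUP_upper) simp
        finally show "(\<Sum>i<N. ereal (a i * regularised_pole e (d j) (y i) x)) \<le> (SUP k. ereal (S k x))" .
      qed
      finally show "(\<Sum>i<N. pole_term e (a i) (y i) x) \<le> (SUP k. ereal (S k x))" .
    qed
    finally show "V x \<le> (SUP k. ereal (S k x))" .
    show "(SUP k. ereal (S k x)) \<le> V x"
    proof (rule SUP_least)
      fix k
      have "ereal (S k x) = (\<Sum>i<k. ereal (a i * regularised_pole e (d k) (y i) x))"
        by (simp add: S_def)
      also have "\<dots> \<le> (\<Sum>i<k. pole_term e (a i) (y i) x)"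
        unfolding pole by (intro sum_mono SUP_upper) simp
      also have "\<dots> \<le> V x"
        unfolding V_def using pole_nonneg by (intro sum_le_suminf summable_ereal_pos) auto
      finally show "ereal (S k x) \<le> V x" .
    qed
  qed
  have W_SUP: "W x = (SUP k. ereal (S k x + K x))" for x
    unfolding W V_SUP plus_ereal.simps(1)[symmetric] by (rule SUP_ereal_add_left[symmetric]) auto
  have contK: "continuous_on UNIV K"
  proof -
    have "continuous_on UNIV (\<lambda>x. - K x)"
      using assms(3) by (intro convex_on_continuous) (auto simp: concave_on_def)
    then show ?thesis using continuous_on_minus by fastforce
  qed
  show ?thesis
    unfolding p_superharmonic_def
  proof (intro conjI ballI allI impI)
    obtain x0 where "V x0 < \<infinity>" using assms(6) by (auto simp: V_def e_def)
    then have "W x0 \<noteq> \<infinity>" by (auto simp: W)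
    then show "\<exists>x\<in>UNIV. W x \<noteq> \<infinity>" by blast
  next
    fix x :: 'a
    \<comment> \<open>A supremum of continuous functions is lower semicontinuous.\<close>
    show "W x \<le> Liminf (at x within UNIV) W"
      unfolding W_SUP[of x]
    proof (rule SUP_least)
      fix k
      have "continuous_on UNIV (\<lambda>z. S k z + K z)" by (intro continuous_intros contS contK)
      then have "((\<lambda>z. S k z + K z) \<longlongrightarrow> S k x + K x) (at x)"
        by (simp add: continuous_on_def)
      then have "((\<lambda>z. ereal (S k z + K z)) \<longlongrightarrow> ereal (S k x + K x)) (at x)" by simp
      then have "ereal (S k x + K x) = Liminf (at x) (\<lambda>z. ereal (S k z + K z))"
        by (intro lim_imp_Liminf[symmetric]) auto
      also have "\<dots> \<le> Liminf (at x) W"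
        by (intro Liminf_mono always_eventually allI) (auto simp: W_SUP intro: SUP_upper)
      finally show "ereal (S k x + K x) \<le> Liminf (at x within UNIV) W" .
    qed
  next
    fix D h x
    assume A: "open D \<and> compact (closure D) \<and> closure D \<subseteq> UNIV \<and> continuous_on (closure D) h
      \<and> p_harmonic p D h \<and> (\<forall>x\<in>frontier D. ereal (h x) \<le> W x)" and x: "x \<in> D"
    obtain v where v: "\<And>z. K z \<le> K x + v \<bullet> (z - x)"
      by (rule concave_on_supergradient[OF assms(3)]) (rule that)
    \<comment> \<open>The affine majorant touches \<open>K\<close> at the one point where the
      conclusion is wanted: replacing \<open>K\<close> by \<open>L\<close> only raises the
      competitor on the frontier and loses nothing at \<open>x\<close>.\<close>
    define L where "L z = (K x - v \<bullet> x) + v \<bullet> z" for z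
    have KL: "K z \<le> L z" for z using v[of z] by (simp add: L_def inner_diff_right)
    have Lx: "L x = K x" by (simp add: L_def)
    have F: "compact (frontier D)" "frontier D \<subseteq> closure D"
      using A by (auto simp: frontier_def compact_diff)
    have "ereal (h x) \<le> W x + ereal \<eta>" if \<eta>: "\<eta> > 0" for \<eta>
    proof -
      have "\<exists>k. \<forall>z\<in>frontier D. h z - L z - \<eta> / 2 < S k z"
      proof (rule compact_uniform_lower_bound[OF F(1) _ contS S_inc])
        show "continuous_on (frontier D) (\<lambda>z. h z - L z - \<eta> / 2)"
          unfolding L_def using A F(2) by (intro continuous_intros) (auto intro: continuous_on_subset)
        show "\<exists>k. h z - L z - \<eta> / 2 < S k z" if z: "z \<in> frontier D" for z
        proof -
          \<comment> \<open>Giving away \<open>\<eta> / 2\<close> makes the inequality with the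
            supremum strict, so a single member of the sequence already exceeds the left
            side.\<close>
          have "ereal (h z - \<eta> / 2) < ereal (h z)" using \<eta> by simp
          also have "\<dots> \<le> W z" using A z by blast
          finally obtain k where "h z - \<eta> / 2 < S k z + K z"
            unfolding W_SUP less_SUP_iff by auto
          then show ?thesis using KL[of z] by (intro exI[of _ k]) simp
        qed
      qed
      then obtain k where k: "\<And>z. z \<in> frontier D \<Longrightarrow> h z - L z - \<eta> / 2 < S k z" by blast
      obtain \<xi>1 X1 \<kappa>1 where 1: "strict_supersolution p (S k) \<xi>1 X1 \<kappa>1" "\<forall>x. \<kappa>1 x \<ge> 0"
        using regularised_poles_supersolution[where k = k and y = y and a = a and d = "d k",
            OF assms(1,2) d(1)[OF order_refl] assms(4) e_def]
        unfolding S_def[abs_def] by blast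
      \<comment> \<open>\<open>S k\<close> and the affine part may have \<open>\<kappa>\<close>
        equal to zero, for instance when all coefficients vanish; this extra pole makes the
        competitor strict.\<close>
      obtain \<xi>2 X2 \<kappa>2 where 2: "strict_supersolution p (\<lambda>z. \<eta> / 2 * regularised_pole e 1 (0::'a) z) \<xi>2 X2 \<kappa>2"
        "\<forall>x. \<kappa>2 x > 0"
        using regularised_pole_strict_supersolution[OF assms(1,2) _ _ e_def, of 1 "\<eta> / 2" "0::'a"] \<eta>
        by (metis half_gt_zero less_imp_le zero_less_one)
      \<comment> \<open>The added constant \<open>\<eta> / 2\<close> repays the loss on the
        frontier. The extra pole is nonnegative and at most \<open>\<eta> / 2\<close>, so at
        \<open>x\<close> the competitor exceeds \<open>S k x + K x\<close> by at most
        \<open>\<eta>\<close>.\<close>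
      define w where "w z = (S k z + \<eta> / 2 * regularised_pole e 1 0 z) + ((\<eta> / 2 + (K x - v \<bullet> x)) + v \<bullet> z)" for z
      have w: "strict_supersolution p w (\<lambda>z. \<xi>1 z + \<xi>2 z + v) (\<lambda>z u. X1 z u + X2 z u + 0) (\<lambda>z. \<kappa>1 z + \<kappa>2 z + 0)"
        unfolding w_def[abs_def]
        by (rule strict_supersolution_add[OF strict_supersolution_add[OF 1(1) 2(1)] strict_supersolution_affine])
      have "h x \<le> w x"
      proof (rule comparison_principle[OF assms(1) w])
        show "0 < \<kappa>1 z + \<kappa>2 z + 0" for z using 1(2) 2(2) by (simp add: add_nonneg_pos)
        show "h z \<le> w z" if "z \<in> frontier D" for z
        proof -
          have "0 \<le> \<eta> / 2 * regularised_pole e 1 0 z"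
            using pole0[of 1 0 z] \<eta> by (intro mult_nonneg_nonneg) auto
          then show ?thesis using k[OF that] unfolding w_def L_def by linarith
        qed
      qed (use A x in auto)
      moreover have "regularised_pole e 1 0 x \<le> 1"
      proof -
        have "(x \<bullet> x + 1) powr (- e / 2) \<le> 1 powr (- e / 2)" using e by (intro powr_mono2') auto
        then show ?thesis by (simp add: regularised_pole_def)
      qed
      then have "\<eta> / 2 * regularised_pole e 1 0 x \<le> \<eta> / 2 * 1" using \<eta> by (intro mult_left_mono) auto
      ultimately have "h x \<le> (S k x + K x) + \<eta>" using Lx by (simp add: w_def L_def)
      then have "ereal (h x) \<le> ereal (S k x + K x) + ereal \<eta>" by simp
      also have "\<dots> \<le> W x + ereal \<eta>"
        unfolding W_SUP by (intro add_right_mono SUP_upper) simp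
      finally show ?thesis .
    qed
    then show "ereal (h x) \<le> W x"
      by (rule ereal_le_epsilon2)
  qed
qed

end
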